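(* Let $X$ be a Hadamard manifold of dimension $n$, $\gamma>0$, and let $\{\phi_k\}_{k\in\mathbb N}$ be the Markov chain on $X$ defined by $\phi_{k+1}=\mathrm{Exp}_{\phi_k}(-\gamma s(\phi_k)+U_{k+1})$, where $s$ is a vector field on $X$ and $\{U_{k+1}\}_{k\in\mathbb N}$ is an i.i.d. sequence of $\mathbb R^n$-valued random variables independent of $\phi_0$. Assume that $s$ is locally Lipschitz and that $U_1$ admits a density $q$ with respect to the Lebesgue measure on $\mathbb R^n$ which is (everywhere) positive and lower semicontinuous. Then $\{\phi_k\}_{k\in\mathbb N}$ is a ($\varphi$-)irreducible and aperiodic T-chain. In addition, every compact subset of $X$ is small for the corresponding Markov kernel.
   Context: A Hadamard manifold is a complete, simply connected (connected, smooth) Riemannian manifold with nonpositive sectional curvature. $\mathrm{Exp}$ is the Riemannian exponential map. The tangent bundle $TX$ is identified with $X\times\mathbb R^n$ through a fixed smooth global frame $(x,u)\in X\times\mathbb R^n\mapsto\iota_x(u)\in T_xX$ ($\iota_x$ a linear isomorphism depending smoothly on $x$); thus $s$ is viewed as a map $X\to\mathbb R^n$, and $\mathrm{Exp}_x(u)$ for $u\in\mathbb R^n$ means $\mathrm{Exp}_x(\iota_x(u))$. **Markov chain notions** (for the kernel $P$ of the chain, with iterates $P^k$). $P$ is $\varphi$-irreducible if there is a nontrivial measure $\varphi$ on $\mathcal B(X)$ such that $\varphi(A)>0$ implies $\sum_{k\ge1}P^k(x,A)>0$ for all $x\in X$ (such $\varphi$ is called an irreducibility measure). For a probability $b$ on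 $\mathbb N=\{0,1,\dots\}$, $K_b=\sum_{k\ge0}b(k)P^k$. $P$ is a T-chain if for some $b$ there is a substochastic kernel $T\le K_b$ with $T(\cdot,A)$ lower semicontinuous for every $A\in\mathcal B(X)$ and $T(x,X)>0$ for all $x$. $C\in\mathcal B(X)$ is small if there are $a\in\mathbb N$ and a nontrivial measure $\nu$ with $P^a(x,A)\ge\nu(A)$ for all $x\in C$, $A\in\mathcal B(X)$. For $P$ $\varphi$-irreducible, a $d$-cycle is a family of disjoint Borel sets $(D_i)_{i\in\mathbb Z/d\mathbb Z}$ with $P(x,D_{i+1})=1$ for $x\in D_i$ and $\varphi((\bigcup_iD_i)^c)=0$ for every irreducibility measure $\varphi$; $P$ is aperiodic if the largest $d$ for which a $d$-cycle exists is $1$. *)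

theory Defs
  imports "HOL-Probability.Probability"
begin

section \<open>Smooth manifolds\<close>

text \<open>A manifold is a whole type \<open>'x\<close> (Hausdorff and second countable by its type classes)
  together with a smooth atlas \<open>A\<close> with values in \<open>real^'n\<close>; its dimension is \<open>CARD('n)\<close>.
  A chart is a pair of a domain and a coordinate map; the values of the coordinate map outside the
  domain are irrelevant.\<close>

type_synonym ('x, 'n) chart = "'x set \<times> ('x \<Rightarrow> real ^ 'n)"

primrec Ck_on :: "nat \<Rightarrow> 'a::real_normed_vector set \<Rightarrow> ('a \<Rightarrow> 'b::real_normed_vector) \<Rightarrow> bool" where
  "Ck_on 0 S f \<longleftrightarrow> continuous_on S f"
| "Ck_on (Suc k) S f \<longleftrightarrow> (\<forall>x\<in>S. f differentiable (at x)) \<and>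
     (\<forall>v. Ck_on k S (\<lambda>x. frechet_derivative f (at x) v))"

text \<open>Only used for open \<open>S\<close>.\<close>

definition smooth_on :: "'a::real_normed_vector set \<Rightarrow> ('a \<Rightarrow> 'b::real_normed_vector) \<Rightarrow> bool" where
  "smooth_on S f \<longleftrightarrow> (\<forall>k. Ck_on k S f)"

abbreviation chart_dom :: "('x, 'n::finite) chart \<Rightarrow> 'x set" where
  "chart_dom c \<equiv> fst c"

abbreviation chart_map :: "('x, 'n::finite) chart \<Rightarrow> 'x \<Rightarrow> real ^ 'n" where
  "chart_map c \<equiv> snd c"

definition chart_img :: "('x, 'n::finite) chart \<Rightarrow> (real ^ 'n) set" where
  "chart_img c = chart_map c ` chart_dom c"

definition chart_inv :: "('x, 'n::finite) chart \<Rightarrow> real ^ 'n \<Rightarrow> 'x" where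
  "chart_inv c = inv_into (chart_dom c) (chart_map c)"

definition smooth_atlas :: "('x::topological_space, 'n::finite) chart set \<Rightarrow> bool" where
  "smooth_atlas A \<longleftrightarrow>
     (\<forall>c\<in>A. open (chart_dom c) \<and> open (chart_img c) \<and>
        homeomorphism (chart_dom c) (chart_img c) (chart_map c) (chart_inv c)) \<and>
     (\<Union>c\<in>A. chart_dom c) = UNIV \<and>
     (\<forall>c\<in>A. \<forall>d\<in>A. smooth_on (chart_map c ` (chart_dom c \<inter> chart_dom d)) (chart_map d \<circ> chart_inv c))"

text \<open>A tangent vector at \<open>x\<close> is the family of its coordinate vectors in all charts around \<open>x\<close>,
  related by the derivatives of the coordinate changes. In charts of which \<open>x\<close> is not in the domain
  the value is 0, so that each tangent vector has exactly one representation. The vector space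
  operations are pointwise.\<close>

type_synonym ('x, 'n) tangent = "('x, 'n) chart \<Rightarrow> real ^ 'n"

definition coord_change ::
    "('x, 'n::finite) chart \<Rightarrow> ('x, 'n) chart \<Rightarrow> 'x \<Rightarrow> real ^ 'n \<Rightarrow> real ^ 'n" where
  "coord_change c d x = frechet_derivative (chart_map d \<circ> chart_inv c) (at (chart_map c x))"

definition tangent_space :: "('x, 'n::finite) chart set \<Rightarrow> 'x \<Rightarrow> ('x, 'n) tangent set" where
  "tangent_space A x = {w.
     (\<forall>c. \<not> (c \<in> A \<and> x \<in> chart_dom c) \<longrightarrow> w c = 0) \<and>
     (\<forall>c\<in>A. \<forall>d\<in>A. x \<in> chart_dom c \<inter> chart_dom d \<longrightarrow> w d = coord_change c d x (w c))}"

text \<open>The tangent vector at \<open>x\<close> whose coordinate vector in the chart \<open>c\<close> is \<open>v\<close>.\<close>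

definition tangent_of ::
    "('x, 'n::finite) chart set \<Rightarrow> ('x, 'n) chart \<Rightarrow> 'x \<Rightarrow> real ^ 'n \<Rightarrow> ('x, 'n) tangent" where
  "tangent_of A c x v = (\<lambda>d. if d \<in> A \<and> x \<in> chart_dom d then coord_change c d x v else 0)"

text \<open>A smooth global frame: linear isomorphisms from \<open>real^'n\<close> onto the tangent spaces, depending
  smoothly on the base point.\<close>

definition smooth_frame ::
    "('x, 'n::finite) chart set \<Rightarrow> ('x \<Rightarrow> real ^ 'n \<Rightarrow> ('x, 'n) tangent) \<Rightarrow> bool" where
  "smooth_frame A \<iota> \<longleftrightarrow>
     (\<forall>x. (\<forall>c. linear (\<lambda>u. \<iota> x u c)) \<and> bij_betw (\<iota> x) UNIV (tangent_space A x)) \<and>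
     (\<forall>c\<in>A. \<forall>u. smooth_on (chart_img c) (\<lambda>z. \<iota> (chart_inv c z) u c))"

definition locally_lipschitz ::
    "('x, 'n::finite) chart set \<Rightarrow> ('x \<Rightarrow> 'b::metric_space) \<Rightarrow> bool" where
  "locally_lipschitz A f \<longleftrightarrow>
     (\<forall>c\<in>A. \<forall>z\<in>chart_img c. \<exists>\<epsilon>>0. \<exists>L. L-lipschitz_on (ball z \<epsilon> \<inter> chart_img c) (f \<circ> chart_inv c))"


section \<open>Riemannian geometry\<close>

text \<open>A Riemannian metric assigns to every point \<open>x\<close> an inner product on the tangent space at \<open>x\<close>;
  the values of \<open>g x\<close> outside the tangent space are irrelevant.\<close>

type_synonym ('x, 'n) metric_tensor = "'x \<Rightarrow> ('x, 'n) tangent \<Rightarrow> ('x, 'n) tangent \<Rightarrow> real"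

definition metric_matrix ::
    "('x, 'n::finite) chart set \<Rightarrow> ('x, 'n) metric_tensor \<Rightarrow> ('x, 'n) chart \<Rightarrow> real ^ 'n \<Rightarrow> real ^ 'n ^ 'n" where
  "metric_matrix A g c z = (\<chi> i j.
     g (chart_inv c z) (tangent_of A c (chart_inv c z) (axis i 1)) (tangent_of A c (chart_inv c z) (axis j 1)))"

definition riemannian_metric ::
    "('x, 'n::finite) chart set \<Rightarrow> ('x, 'n) metric_tensor \<Rightarrow> bool" where
  "riemannian_metric A g \<longleftrightarrow>
     (\<forall>x. \<forall>u\<in>tangent_space A x. \<forall>v\<in>tangent_space A x.
        g x u v = g x v u \<and>
        (\<forall>a. g x (\<lambda>c. a *\<^sub>R u c) v = a * g x u v) \<and>
        (\<forall>w\<in>tangent_space A x. g x (\<lambda>c. u c + w c) v = g x u v + g x w v) \<and>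
        (u \<noteq> (\<lambda>c. 0) \<longrightarrow> g x u u > 0)) \<and>
     (\<forall>c\<in>A. \<forall>i j. smooth_on (chart_img c) (\<lambda>z. metric_matrix A g c z $ i $ j))"

definition partial_deriv :: "'n::finite \<Rightarrow> (real ^ 'n \<Rightarrow> real) \<Rightarrow> real ^ 'n \<Rightarrow> real" where
  "partial_deriv i f z = frechet_derivative f (at z) (axis i 1)"

text \<open>Christoffel symbols \<open>\<Gamma>\<^sup>k\<^sub>i\<^sub>j\<close> of the Levi-Civita connection in the chart \<open>c\<close>.\<close>

definition christoffel ::
    "('x, 'n::finite) chart set \<Rightarrow> ('x, 'n) metric_tensor \<Rightarrow> ('x, 'n) chart \<Rightarrow>
     'n \<Rightarrow> 'n \<Rightarrow> 'n \<Rightarrow> real ^ 'n \<Rightarrow> real" where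
  "christoffel A g c k i j z = (1/2) * (\<Sum>l\<in>UNIV. matrix_inv (metric_matrix A g c z) $ k $ l *
     (partial_deriv i (\<lambda>y. metric_matrix A g c y $ j $ l) z
    + partial_deriv j (\<lambda>y. metric_matrix A g c y $ i $ l) z
    - partial_deriv l (\<lambda>y. metric_matrix A g c y $ i $ j) z))"

text \<open>The component along the \<open>l\<close>-th coordinate field of \<open>R(\<partial>\<^sub>i, \<partial>\<^sub>j)\<partial>\<^sub>k\<close>, with the sign convention
  \<open>R(X,Y)Z = \<nabla>\<^sub>X\<nabla>\<^sub>YZ - \<nabla>\<^sub>Y\<nabla>\<^sub>XZ - \<nabla>\<^bsub>[X,Y]\<^esub>Z\<close>.\<close>

definition riemann_curvature ::
    "('x, 'n::finite) chart set \<Rightarrow> ('x, 'n) metric_tensor \<Rightarrow> ('x, 'n) chart \<Rightarrow>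
     'n \<Rightarrow> 'n \<Rightarrow> 'n \<Rightarrow> 'n \<Rightarrow> real ^ 'n \<Rightarrow> real" where
  "riemann_curvature A g c l i j k z =
     partial_deriv i (christoffel A g c l j k) z - partial_deriv j (christoffel A g c l i k) z
     + (\<Sum>m\<in>UNIV. christoffel A g c l i m z * christoffel A g c m j k z
               - christoffel A g c l j m z * christoffel A g c m i k z)"

text \<open>Sectional curvature \<open>\<langle>R(u,v)v, u\<rangle> / (|u|\<^sup>2 |v|\<^sup>2 - \<langle>u,v\<rangle>\<^sup>2)\<close> of the plane spanned by the
  tangent vectors with linearly independent coordinate vectors \<open>u\<close>, \<open>v\<close> at the point with
  coordinates \<open>z\<close> in the chart \<open>c\<close>.\<close>

definition sectional_curvature ::
    "('x, 'n::finite) chart set \<Rightarrow> ('x, 'n) metric_tensor \<Rightarrow> ('x, 'n) chart \<Rightarrow>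
     real ^ 'n \<Rightarrow> real ^ 'n \<Rightarrow> real ^ 'n \<Rightarrow> real" where
  "sectional_curvature A g c z u v =
     (let G = metric_matrix A g c z;
          Ruvv = (\<chi> l. \<Sum>i\<in>UNIV. \<Sum>j\<in>UNIV. \<Sum>k\<in>UNIV.
                    riemann_curvature A g c l i j k z * u $ i * v $ j * v $ k)
      in (Ruvv \<bullet> (G *v u)) / ((u \<bullet> (G *v u)) * (v \<bullet> (G *v v)) - (u \<bullet> (G *v v))\<^sup>2))"

definition nonpositive_curvature ::
    "('x, 'n::finite) chart set \<Rightarrow> ('x, 'n) metric_tensor \<Rightarrow> bool" where
  "nonpositive_curvature A g \<longleftrightarrow> (\<forall>c\<in>A. \<forall>z\<in>chart_img c. \<forall>u v.
     u \<noteq> v \<and> independent {u, v} \<longrightarrow> sectional_curvature A g c z u v \<le> 0)"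

definition velocity ::
    "('x, 'n::finite) chart set \<Rightarrow> (real \<Rightarrow> 'x) \<Rightarrow> real \<Rightarrow> ('x, 'n) tangent" where
  "velocity A \<sigma> t = (\<lambda>c. if c \<in> A \<and> \<sigma> t \<in> chart_dom c
     then vector_derivative (\<lambda>\<tau>. chart_map c (\<sigma> \<tau>)) (at t) else 0)"

text \<open>Geodesics defined on all of the real line.\<close>

definition geodesic ::
    "('x::topological_space, 'n::finite) chart set \<Rightarrow> ('x, 'n) metric_tensor \<Rightarrow> (real \<Rightarrow> 'x) \<Rightarrow> bool" where
  "geodesic A g \<sigma> \<longleftrightarrow> continuous_on UNIV \<sigma> \<and>
     (\<forall>c\<in>A. \<forall>t. \<sigma> t \<in> chart_dom c \<longrightarrow>
        (\<lambda>\<tau>. chart_map c (\<sigma> \<tau>)) differentiable (at t) \<and>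
        ((\<lambda>\<tau>. vector_derivative (\<lambda>\<tau>. chart_map c (\<sigma> \<tau>)) (at \<tau>)) has_vector_derivative
           (\<chi> k. - (\<Sum>i\<in>UNIV. \<Sum>j\<in>UNIV. christoffel A g c k i j (chart_map c (\<sigma> t)) *
                     velocity A \<sigma> t c $ i * velocity A \<sigma> t c $ j))) (at t))"

text \<open>Completeness in the sense that every geodesic extends to the whole real line.\<close>

definition geodesically_complete ::
    "('x::topological_space, 'n::finite) chart set \<Rightarrow> ('x, 'n) metric_tensor \<Rightarrow> bool" where
  "geodesically_complete A g \<longleftrightarrow> (\<forall>x. \<forall>w\<in>tangent_space A x.
     \<exists>\<sigma>. geodesic A g \<sigma> \<and> \<sigma> 0 = x \<and> velocity A \<sigma> 0 = w)"

definition Exp ::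
    "('x::topological_space, 'n::finite) chart set \<Rightarrow> ('x, 'n) metric_tensor \<Rightarrow> 'x \<Rightarrow> ('x, 'n) tangent \<Rightarrow> 'x" where
  "Exp A g x w = (THE y. \<exists>\<sigma>. geodesic A g \<sigma> \<and> \<sigma> 0 = x \<and> velocity A \<sigma> 0 = w \<and> y = \<sigma> 1)"

definition hadamard_manifold ::
    "('x::{t2_space, second_countable_topology}, 'n::finite) chart set \<Rightarrow> ('x, 'n) metric_tensor \<Rightarrow> bool" where
  "hadamard_manifold A g \<longleftrightarrow>
     smooth_atlas A \<and> riemannian_metric A g \<and> geodesically_complete A g \<and>
     connected (UNIV :: 'x set) \<and> simply_connected (UNIV :: 'x set) \<and> nonpositive_curvature A g"


section \<open>Markov chains\<close>

definition lower_semicontinuous :: "('a::topological_space \<Rightarrow> 'b::linorder) \<Rightarrow> bool" where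
  "lower_semicontinuous f \<longleftrightarrow> (\<forall>x a. a < f x \<longrightarrow> eventually (\<lambda>y. a < f y) (nhds x))"

definition markov_kernel :: "('x::topological_space \<Rightarrow> 'x measure) \<Rightarrow> bool" where
  "markov_kernel P \<longleftrightarrow> P \<in> borel \<rightarrow>\<^sub>M prob_algebra borel"

primrec kernel_pow ::
    "('x::topological_space \<Rightarrow> 'x measure) \<Rightarrow> nat \<Rightarrow> 'x \<Rightarrow> 'x measure" where
  "kernel_pow P 0 = return borel"
| "kernel_pow P (Suc k) = (\<lambda>x. bind (P x) (kernel_pow P k))"

definition past :: "'w measure \<Rightarrow> (nat \<Rightarrow> 'w \<Rightarrow> 'x::topological_space) \<Rightarrow> nat \<Rightarrow> 'w measure" where
  "past M \<phi> k = sigma (space M) (\<Union>i\<in>{..k}. {\<phi> i -` B \<inter> space M | B. B \<in> sets borel})"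

definition markov_chain ::
    "'w measure \<Rightarrow> ('x::topological_space \<Rightarrow> 'x measure) \<Rightarrow> (nat \<Rightarrow> 'w \<Rightarrow> 'x) \<Rightarrow> bool" where
  "markov_chain M P \<phi> \<longleftrightarrow> markov_kernel P \<and> (\<forall>k. \<phi> k \<in> M \<rightarrow>\<^sub>M borel) \<and>
     (\<forall>k. \<forall>B\<in>sets borel. AE \<omega> in M.
        real_cond_exp M (past M \<phi> k) (\<lambda>\<omega>. indicator B (\<phi> (Suc k) \<omega>)) \<omega> = measure (P (\<phi> k \<omega>)) B)"

definition irreducibility_measure ::
    "('x::topological_space \<Rightarrow> 'x measure) \<Rightarrow> 'x measure \<Rightarrow> bool" where
  "irreducibility_measure P \<psi> \<longleftrightarrow> sets \<psi> = sets borel \<and> emeasure \<psi> UNIV > 0 \<and>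
     (\<forall>B\<in>sets borel. emeasure \<psi> B > 0 \<longrightarrow> (\<forall>x. (\<Sum>k. emeasure (kernel_pow P (Suc k) x) B) > 0))"

definition irreducible_kernel :: "('x::topological_space \<Rightarrow> 'x measure) \<Rightarrow> bool" where
  "irreducible_kernel P \<longleftrightarrow> (\<exists>\<psi>. irreducibility_measure P \<psi>)"

definition T_chain :: "('x::topological_space \<Rightarrow> 'x measure) \<Rightarrow> bool" where
  "T_chain P \<longleftrightarrow> (\<exists>(b :: nat pmf) T. T \<in> borel \<rightarrow>\<^sub>M subprob_algebra borel \<and>
     (\<forall>x. \<forall>B\<in>sets borel. emeasure (T x) B \<le> (\<Sum>k. ennreal (pmf b k) * emeasure (kernel_pow P k x) B)) \<and>
     (\<forall>B\<in>sets borel. lower_semicontinuous (\<lambda>x. emeasure (T x) B)) \<and>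
     (\<forall>x. emeasure (T x) UNIV > 0))"

definition small_set :: "('x::topological_space \<Rightarrow> 'x measure) \<Rightarrow> 'x set \<Rightarrow> bool" where
  "small_set P C \<longleftrightarrow> C \<in> sets borel \<and> (\<exists>(a :: nat) \<nu>. sets \<nu> = sets borel \<and> emeasure \<nu> UNIV > 0 \<and>
     (\<forall>x\<in>C. \<forall>B\<in>sets borel. emeasure (kernel_pow P a x) B \<ge> emeasure \<nu> B))"

text \<open>The index set of a \<open>d\<close>-cycle, the integers modulo \<open>d\<close>, is \<open>{..<d}\<close> with successor modulo \<open>d\<close>.\<close>

definition is_cycle ::
    "('x::topological_space \<Rightarrow> 'x measure) \<Rightarrow> nat \<Rightarrow> (nat \<Rightarrow> 'x set) \<Rightarrow> bool" where
  "is_cycle P d D \<longleftrightarrow> d \<ge> 1 \<and> (\<forall>i<d. D i \<in> sets borel) \<and> disjoint_family_on D {..<d} \<and>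
     (\<forall>i<d. \<forall>x\<in>D i. emeasure (P x) (D (Suc i mod d)) = 1) \<and>
     (\<forall>\<psi>. irreducibility_measure P \<psi> \<longrightarrow> emeasure \<psi> (- (\<Union>i<d. D i)) = 0)"

definition aperiodic_kernel :: "('x::topological_space \<Rightarrow> 'x measure) \<Rightarrow> bool" where
  "aperiodic_kernel P \<longleftrightarrow> (\<exists>D. is_cycle P 1 D) \<and> (\<forall>d D. is_cycle P d D \<longrightarrow> d \<le> 1)"

text \<open>The recursion \<open>\<phi>\<^bsub>k+1\<^esub> = Exp\<^bsub>\<phi>\<^sub>k\<^esub>(-\<gamma> s(\<phi>\<^sub>k) + U\<^bsub>k+1\<^esub>)\<close> and its transition kernel, the law of
  one step started at \<open>x\<close>.\<close>

definition exp_step ::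
    "('x::topological_space, 'n::finite) chart set \<Rightarrow> ('x, 'n) metric_tensor \<Rightarrow>
     ('x \<Rightarrow> real ^ 'n \<Rightarrow> ('x, 'n) tangent) \<Rightarrow> real \<Rightarrow> ('x \<Rightarrow> real ^ 'n) \<Rightarrow> 'x \<Rightarrow> real ^ 'n \<Rightarrow> 'x" where
  "exp_step A g \<iota> \<gamma> s x u = Exp A g x (\<iota> x (- (\<gamma> *\<^sub>R s x) + u))"

definition step_kernel ::
    "'w measure \<Rightarrow> ('w \<Rightarrow> 'u) \<Rightarrow> ('x::topological_space \<Rightarrow> 'u \<Rightarrow> 'x) \<Rightarrow> 'x \<Rightarrow> 'x measure" where
  "step_kernel M V F x = distr M borel (\<lambda>\<omega>. F x (V \<omega>))"

end

theory Submission
  imports Defs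
begin

text \<open>Short geodesics are compared with straight lines in a chart: by Gronwall
  the time-one map \<open>u \<mapsto> Exp\<^sub>x(u)\<close> is Lipschitz near \<open>0\<close>, it differs from
  \<open>x + u\<close> by \<open>O(|u|\<^sup>2)\<close>, and so by Brouwer its image contains a neighbourhood of \<open>x\<close>, uniformly
  for \<open>x\<close> near a given point. A Lipschitz map enlarges Lebesgue measure by at most a constant factor, and \<open>q\<close>
  is locally bounded below by a positive constant; hence every point has an open neighbourhood \<open>V\<close>
  and a measure \<open>\<nu>\<close> charging all nonempty open subsets of \<open>V\<close> with \<open>P(x, \<cdot>) \<ge> \<nu>\<close> for \<open>x \<in> V\<close>.
  Connectedness propagates this local minorization: for one fixed \<open>\<nu>\<close>, every point has a
  neighbourhood on which \<open>P\<^sup>m \<ge> c \<nu>\<close> for all large \<open>m\<close>, with \<open>c > 0\<close> depending on \<open>m\<close>. Irreducibility,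
  aperiodicity, the T-chain property and smallness of compact sets all follow from this.\<close>

section \<open>Locally minorized kernels\<close>

text \<open>A lower bound on \<open>P x B\<close> is a lower bound on the volume of the set of
  innovations that lead from x into B. So what has to be controlled from above is how much the map
  from innovations to endpoints expands volume, and this map must reach a set that does not depend
  on x. Gronwall's inequality gives Lipschitz dependence on the initial velocity, which is why
  volume is compared through coverings by cubes and surjectivity is a fixed point problem. These
  estimates concern velocities near 0: innovations near the value that cancels the drift are enough,
  because \<open>q\<close> is positive there. Large velocities enter through measurability of the
  kernel, which requires the geodesic flow at time 1 to be continuous on the whole tangent bundle.
  The frame turns this bundle into a product, completeness supplies the integral curves, and
  uniqueness and continuity are carried from short times to time 1. On the probabilistic side, all
  large iterates are minorized and not just one of them. This yields a common exponent for finitely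
  many points, which settles compact sets and excludes cycles.\<close>

lemma kernel_pow_measurable:
  assumes "markov_kernel P"
  shows "kernel_pow P k \<in> borel \<rightarrow>\<^sub>M prob_algebra borel"
proof (induction k)
  case 0
  show ?case by (simp add: measurable_return_prob_space)
next
  case (Suc k)
  have P: "P \<in> borel \<rightarrow>\<^sub>M prob_algebra borel"
    using assms by (simp add: markov_kernel_def)
  have "(\<lambda>x. P x \<bind> kernel_pow P k) \<in> borel \<rightarrow>\<^sub>M prob_algebra borel"
  proof (rule measurable_bind_prob_space2[OF P])
    show "(\<lambda>(x, y). kernel_pow P k y) \<in> borel \<Otimes>\<^sub>M borel \<rightarrow>\<^sub>M prob_algebra borel"
      using Suc by measurable
  qed
  then show ?case by simp
qed

context
  fixes P :: "'x::topological_space \<Rightarrow> 'x measure"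
  assumes P: "markov_kernel P"
begin

lemma kernel_pow_prob: "prob_space (kernel_pow P k x)"
  and sets_kernel_pow: "sets (kernel_pow P k x) = sets borel"
  and emeasure_kernel_pow_UNIV: "emeasure (kernel_pow P k x) UNIV = 1"
  and kernel_prob: "prob_space (P x)"
  and sets_kernel: "sets (P x) = sets borel"
proof -
  have "kernel_pow P k x \<in> space (prob_algebra borel)"
    using kernel_pow_measurable[OF P, of k] by (rule measurable_space) simp
  then show *: "prob_space (kernel_pow P k x)" and **: "sets (kernel_pow P k x) = sets borel"
    by (auto simp: space_prob_algebra)
  have "space (kernel_pow P k x) = UNIV"
    using sets_eq_imp_space_eq[OF **] by simp
  then show "emeasure (kernel_pow P k x) UNIV = 1"
    using prob_space.emeasure_space_1[OF *] by simp
  have "P x \<in> space (prob_algebra borel)"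
    using P[unfolded markov_kernel_def] by (rule measurable_space) simp
  then show "prob_space (P x)" and "sets (P x) = sets borel"
    by (auto simp: space_prob_algebra)
qed

lemma emeasure_kernel_pow_Suc:
  assumes "B \<in> sets borel"
  shows "emeasure (kernel_pow P (Suc k) x) B = (\<integral>\<^sup>+z. emeasure (kernel_pow P k z) B \<partial>P x)"
proof -
  have "kernel_pow P k \<in> borel \<rightarrow>\<^sub>M subprob_algebra borel"
    by (rule measurable_prob_algebraD[OF kernel_pow_measurable[OF P]])
  then have "kernel_pow P k \<in> P x \<rightarrow>\<^sub>M subprob_algebra borel"
    using measurable_cong_sets[OF sets_kernel refl] by blast
  moreover have "space (P x) \<noteq> {}"
    using sets_eq_imp_space_eq[OF sets_kernel] by simp
  ultimately show ?thesis
    using emeasure_bind[of "P x" "kernel_pow P k" borel B] assms by simp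
qed

lemma kernel_pow_1: "B \<in> sets borel \<Longrightarrow> emeasure (kernel_pow P (Suc 0) x) B = emeasure (P x) B"
  using emeasure_kernel_pow_Suc[of B 0 x] by (simp add: sets_kernel)

text \<open>Only paths whose first step lands in \<open>W\<close> are counted. Bounds pass from one
  iterate to the next in this way, both for minorizations and for cycles.\<close>

lemma kernel_pow_Suc_minorized:
  assumes B: "B \<in> sets borel" and W: "W \<in> sets borel"
    and "\<And>z. z \<in> W \<Longrightarrow> c \<le> emeasure (kernel_pow P k z) B"
  shows "c * emeasure (P x) W \<le> emeasure (kernel_pow P (Suc k) x) B"
proof -
  have "c * emeasure (P x) W = (\<integral>\<^sup>+z. c * indicator W z \<partial>P x)"
    using W by (simp add: nn_integral_cmult_indicator sets_kernel)
  also have "\<dots> \<le> (\<integral>\<^sup>+z. emeasure (kernel_pow P k z) B \<partial>P x)"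
    using assms(3) by (intro nn_integral_mono) (simp split: split_indicator)
  finally show ?thesis
    using emeasure_kernel_pow_Suc[OF B] by simp
qed

end

section \<open>Propagation of local minorizations\<close>

definition minorizes_on :: "('x::topological_space \<Rightarrow> 'x measure) \<Rightarrow> 'x measure \<Rightarrow> ennreal \<Rightarrow> 'x set \<Rightarrow> bool" where
  "minorizes_on Q \<nu> c V \<longleftrightarrow> (\<forall>x\<in>V. \<forall>B\<in>sets borel. c * emeasure \<nu> B \<le> emeasure (Q x) B)"

text \<open>Positivity of \<open>\<nu>\<close> on the open sets meeting \<open>V\<close> ensures
  that one step from any point of \<open>V\<close> enters each such set with positive
  probability.\<close>

definition minorizing_on_opens :: "('x::topological_space \<Rightarrow> 'x measure) \<Rightarrow> 'x set \<Rightarrow> 'x measure \<Rightarrow> bool" where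
  "minorizing_on_opens Q V \<nu> \<longleftrightarrow> open V \<and> sets \<nu> = sets borel \<and>
      (\<forall>N. open N \<longrightarrow> N \<inter> V \<noteq> {} \<longrightarrow> emeasure \<nu> N > 0) \<and>
      (\<forall>x\<in>V. \<forall>B\<in>sets borel. emeasure \<nu> B \<le> emeasure (Q x) B)"

locale locally_minorized_kernel =
  fixes P :: "'x::t2_space \<Rightarrow> 'x measure"
  assumes markov: "markov_kernel P"
    and conn: "connected (UNIV :: 'x set)"
    and locally_minorized: "\<exists>V \<nu>. x0 \<in> V \<and> minorizing_on_opens P V \<nu>"
begin

text \<open>One neighbourhood serves all large m, while the constant may depend on m. Asking for all
  large m makes the exponents at different points comparable, as \<open>compact_small\<close> and
  \<open>aperiodic\<close> require.\<close>

definition eventually_minorized_at :: "'x measure \<Rightarrow> 'x \<Rightarrow> bool" where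
  "eventually_minorized_at \<nu> x \<longleftrightarrow> (\<exists>N m0. open N \<and> x \<in> N \<and>
     (\<forall>m\<ge>m0. \<exists>c>0. minorizes_on (kernel_pow P m) \<nu> c N))"

text \<open>With \<open>\<nu>\<close> taken from the minorization near one base point, the set
  \<open>R\<close> of points that it eventually minorizes is nonempty, open and closed.\<close>

lemma eventually_minorized:
  obtains \<nu> where "sets \<nu> = sets borel" "emeasure \<nu> UNIV > 0"
    "\<And>x. eventually_minorized_at \<nu> x"
proof -
  fix xs :: 'x
  obtain Vs \<nu> where Vs: "open Vs" "xs \<in> Vs" and \<nu>: "sets \<nu> = sets borel"
    "\<And>N. open N \<Longrightarrow> N \<inter> Vs \<noteq> {} \<Longrightarrow> emeasure \<nu> N > 0"
    "\<And>x B. x \<in> Vs \<Longrightarrow> B \<in> sets borel \<Longrightarrow> emeasure \<nu> B \<le> emeasure (P x) B"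
    using locally_minorized[of xs] unfolding minorizing_on_opens_def by metis
  define R where "R = {x. eventually_minorized_at \<nu> x}"
  \<comment> \<open>Near the base point a trajectory can wait: a step from \<open>Vs\<close> stays
    in \<open>Vs\<close> with probability at least \<open>emeasure \<nu> Vs\<close>, and each
    further iterate costs this factor.\<close>
  have "\<exists>c>0. minorizes_on (kernel_pow P (Suc m)) \<nu> c Vs" for m
  proof (induction m)
    case 0
    show ?case
      using \<nu>(3) by (intro exI[of _ 1]) (auto simp: minorizes_on_def kernel_pow_1[OF markov] simp del: kernel_pow.simps)
  next
    case (Suc m)
    then obtain c where c: "c > 0" "minorizes_on (kernel_pow P (Suc m)) \<nu> c Vs" by blast
    have "minorizes_on (kernel_pow P (Suc (Suc m))) \<nu> (c * emeasure \<nu> Vs) Vs"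
      unfolding minorizes_on_def
    proof (intro ballI)
      fix x B assume x: "x \<in> Vs" and B: "B \<in> sets (borel :: 'x measure)"
      have "c * emeasure \<nu> Vs * emeasure \<nu> B \<le> c * emeasure \<nu> B * emeasure (P x) Vs"
        using \<nu>(3)[OF x borel_open[OF Vs(1)]] by (simp add: mult.assoc mult.commute[of _ "emeasure \<nu> B"] mult_left_mono)
      also have "\<dots> \<le> emeasure (kernel_pow P (Suc (Suc m)) x) B"
        using c(2) B Vs by (intro kernel_pow_Suc_minorized[OF markov]) (auto simp: minorizes_on_def)
      finally show "c * emeasure \<nu> Vs * emeasure \<nu> B \<le> emeasure (kernel_pow P (Suc (Suc m)) x) B" .
    qed
    moreover have "c * emeasure \<nu> Vs > 0"
      using c(1) \<nu>(2)[OF Vs(1)] Vs(2) by (auto simp: ennreal_zero_less_mult_iff)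
    ultimately show ?case by blast
  qed
  then have "\<forall>m\<ge>1. \<exists>c>0. minorizes_on (kernel_pow P m) \<nu> c Vs"
    by (metis Suc_le_D One_nat_def)
  then have "xs \<in> R"
    using Vs unfolding R_def eventually_minorized_at_def by blast
  have "open R"
  proof (subst open_subopen, intro ballI)
    fix x assume "x \<in> R"
    then obtain N m0 where "open N" "x \<in> N" "\<forall>m\<ge>m0. \<exists>c>0. minorizes_on (kernel_pow P m) \<nu> c N"
      unfolding R_def eventually_minorized_at_def by blast
    then show "\<exists>T. open T \<and> x \<in> T \<and> T \<subseteq> R"
      unfolding R_def eventually_minorized_at_def by (intro exI[of _ N]) blast
  qed
  \<comment> \<open>A minorized neighbourhood \<open>V\<close> that meets \<open>R\<close> lies
    entirely in \<open>R\<close>: from any point of \<open>V\<close> one step enters the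
    neighbourhood \<open>N\<close> of a point of \<open>R\<close>, which raises the exponent by one
    and costs the factor \<open>emeasure \<nu>' N\<close>.\<close>
  have "open (- R)"
  proof (subst open_subopen, intro ballI)
    fix x0 assume "x0 \<in> - R"
    obtain V \<nu>' where V: "open V" "x0 \<in> V" and \<nu>': "sets \<nu>' = sets borel"
      "\<And>N. open N \<Longrightarrow> N \<inter> V \<noteq> {} \<Longrightarrow> emeasure \<nu>' N > 0"
      "\<And>x B. x \<in> V \<Longrightarrow> B \<in> sets borel \<Longrightarrow> emeasure \<nu>' B \<le> emeasure (P x) B"
      using locally_minorized[of x0] unfolding minorizing_on_opens_def by metis
    have "V \<inter> R = {}"
    proof (rule ccontr)
      assume "V \<inter> R \<noteq> {}"
      then obtain x1 where x1: "x1 \<in> V" "x1 \<in> R" by blast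
      then obtain N m0 where N: "open N" "x1 \<in> N" and
        m0: "\<forall>m\<ge>m0. \<exists>c>0. minorizes_on (kernel_pow P m) \<nu> c N"
        unfolding R_def eventually_minorized_at_def by blast
      have "\<exists>c>0. minorizes_on (kernel_pow P m) \<nu> c V" if m: "m \<ge> Suc m0" for m
      proof -
        obtain k where k: "m = Suc k" "k \<ge> m0" using m by (metis Suc_le_D Suc_le_mono)
        obtain c where c: "c > 0" "minorizes_on (kernel_pow P k) \<nu> c N" using m0 k by blast
        have "minorizes_on (kernel_pow P m) \<nu> (c * emeasure \<nu>' N) V"
          unfolding minorizes_on_def
        proof (intro ballI)
          fix x B assume x: "x \<in> V" and B: "B \<in> sets (borel :: 'x measure)"
          have "c * emeasure \<nu>' N * emeasure \<nu> B \<le> c * emeasure \<nu> B * emeasure (P x) N"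
            using \<nu>'(3)[OF x borel_open[OF N(1)]] by (simp add: mult.assoc mult.commute[of _ "emeasure \<nu> B"] mult_left_mono)
          also have "\<dots> \<le> emeasure (kernel_pow P m x) B"
            using c(2) B N unfolding k by (intro kernel_pow_Suc_minorized[OF markov]) (auto simp: minorizes_on_def)
          finally show "c * emeasure \<nu>' N * emeasure \<nu> B \<le> emeasure (kernel_pow P m x) B" .
        qed
        moreover have "c * emeasure \<nu>' N > 0"
          using c(1) \<nu>'(2)[OF N(1)] N(2) x1 by (auto simp: ennreal_zero_less_mult_iff)
        ultimately show ?thesis by blast
      qed
      then have "x0 \<in> R" using V unfolding R_def eventually_minorized_at_def by blast
      with \<open>x0 \<in> - R\<close> show False by blast
    qed
    then show "\<exists>T. open T \<and> x0 \<in> T \<and> T \<subseteq> - R" using V by blast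
  qed
  then have "R = UNIV"
    using conn \<open>open R\<close> \<open>xs \<in> R\<close> connected_clopen[of "UNIV :: 'x set"]
    by (auto simp: closed_def)
  moreover have "emeasure \<nu> UNIV > 0"
    using \<nu>(2)[of UNIV] Vs by auto
  ultimately show thesis
    using \<nu>(1) by (intro that[of \<nu>]) (auto simp: R_def)
qed

lemma irreducibility_measure_minorized:
  assumes \<nu>: "sets \<nu> = sets borel" "emeasure \<nu> UNIV > 0"
    "\<And>x. eventually_minorized_at \<nu> x"
  shows "irreducibility_measure P \<nu>"
proof -
  have "(\<Sum>k. emeasure (kernel_pow P (Suc k) x) B) > 0" if B: "B \<in> sets borel" "emeasure \<nu> B > 0" for B x
  proof -
    obtain N m0 where N: "x \<in> N" "\<forall>m\<ge>m0. \<exists>c>0. minorizes_on (kernel_pow P m) \<nu> c N"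
      using \<nu>(3)[of x] unfolding eventually_minorized_at_def by blast
    \<comment> \<open>The exponent is \<open>Suc m0\<close> because the series defining
      irreducibility starts with the first iterate.\<close>
    then obtain c where c: "c > 0" "minorizes_on (kernel_pow P (Suc m0)) \<nu> c N"
      by (meson le_SucI order_refl)
    have "0 < c * emeasure \<nu> B" using c B by (auto simp: ennreal_zero_less_mult_iff)
    also have "\<dots> \<le> emeasure (kernel_pow P (Suc m0) x) B"
      using c N B by (auto simp: minorizes_on_def)
    also have "\<dots> = (\<Sum>k\<in>{m0}. emeasure (kernel_pow P (Suc k) x) B)" by simp
    also have "\<dots> \<le> (\<Sum>k. emeasure (kernel_pow P (Suc k) x) B)"
      by (intro sum_le_suminf) auto
    finally show ?thesis .
  qed
  then show ?thesis
    using \<nu> unfolding irreducibility_measure_def by blast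
qed

lemma irreducible: "irreducible_kernel P"
  using eventually_minorized irreducibility_measure_minorized unfolding irreducible_kernel_def by metis

text \<open>\<open>T x\<close> is a multiple \<open>h x\<close> of the fixed measure
  \<open>\<nu>\<close>, so lower semicontinuity concerns the scalar \<open>h\<close> alone. The
  weights are geometric so that whichever iterate minorizes near \<open>x\<close> has positive
  weight.\<close>

lemma T_chain: "T_chain P"
proof -
  obtain \<nu> where \<nu>: "sets \<nu> = sets borel" "emeasure \<nu> UNIV > 0" "\<And>x. eventually_minorized_at \<nu> x"
    by (rule eventually_minorized, rule that)
  define b :: "nat pmf" where "b = geometric_pmf (1/2)"
  have b_pos: "pmf b k > 0" for k by (simp add: b_def)
  define K where "K x B = (\<Sum>k. ennreal (pmf b k) * emeasure (kernel_pow P k x) B)" for x B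
  define S where "S x = {c. \<exists>V. open V \<and> x \<in> V \<and> (\<forall>y\<in>V. \<forall>B\<in>sets borel. c * emeasure \<nu> B \<le> K y B)}" for x
  \<comment> \<open>The best constant valid on some neighbourhood of \<open>x\<close> is lower semicontinuous in \<open>x\<close> by construction.\<close>
  define h where "h x = Sup (S x)" for x
  \<comment> \<open>In \<open>ennreal\<close> multiplication commutes with suprema, even for the
    factors 0 and \<infinity>; bounds valid for each \<open>c\<close> thus pass to
    \<open>h x\<close>.\<close>
  have h_mult: "h x * e = (SUP c\<in>S x. c * e)" for x e
    unfolding h_def using SUP_mult_right_ennreal[of "\<lambda>c. c" "S x" e] by simp
  have h_pos: "h x > 0" for x
  proof -
    obtain N m where N: "open N" "x \<in> N" "\<forall>k\<ge>m. \<exists>c>0. minorizes_on (kernel_pow P k) \<nu> c N"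
      using \<nu>(3)[of x] unfolding eventually_minorized_at_def by blast
    obtain c where c: "c > 0" "minorizes_on (kernel_pow P m) \<nu> c N" using N(3) by blast
    have "ennreal (pmf b m) * c * emeasure \<nu> B \<le> K y B" if "y \<in> N" "B \<in> sets borel" for y B
    proof -
      have "ennreal (pmf b m) * c * emeasure \<nu> B \<le> ennreal (pmf b m) * emeasure (kernel_pow P m y) B"
        using c(2) that by (auto simp: minorizes_on_def mult.assoc intro!: mult_left_mono)
      also have "\<dots> = (\<Sum>k\<in>{m}. ennreal (pmf b k) * emeasure (kernel_pow P k y) B)" by simp
      also have "\<dots> \<le> K y B" unfolding K_def by (intro sum_le_suminf) auto
      finally show ?thesis .
    qed
    then have "ennreal (pmf b m) * c \<in> S x" using N(1,2) unfolding S_def by blast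
    then have "ennreal (pmf b m) * c \<le> h x" unfolding h_def by (rule Sup_upper)
    moreover have "ennreal (pmf b m) * c > 0" using c(1) b_pos by (auto simp: ennreal_zero_less_mult_iff)
    ultimately show ?thesis by (rule less_le_trans[rotated])
  qed
  have h_le: "h x * emeasure \<nu> B \<le> K x B" if "B \<in> sets borel" for x B
    unfolding h_mult using that by (intro SUP_least) (auto simp: S_def)
  have lsc: "lower_semicontinuous (\<lambda>x. h x * e)" for e
    unfolding lower_semicontinuous_def
  proof (intro allI impI)
    fix x a assume "a < h x * e"
    then obtain c where c: "c \<in> S x" "a < c * e" unfolding h_mult less_SUP_iff by blast
    then obtain V where V: "open V" "x \<in> V" "\<forall>y\<in>V. \<forall>B\<in>sets borel. c * emeasure \<nu> B \<le> K y B"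
      unfolding S_def by blast
    have "a < h y * e" if "y \<in> V" for y
    proof -
      have "c \<in> S y" using V that unfolding S_def by blast
      then have "c * e \<le> h y * e" unfolding h_def by (intro mult_right_mono Sup_upper) auto
      then show ?thesis using c(2) by simp
    qed
    then show "eventually (\<lambda>y. a < h y * e) (nhds x)"
      using V(1,2) by (auto simp: eventually_nhds)
  qed
  define T where "T x = scale_measure (h x) \<nu>" for x
  have T: "T \<in> borel \<rightarrow>\<^sub>M subprob_algebra borel"
  proof (rule measurable_subprob_algebra)
    fix x
    show sT: "sets (T x) = sets borel" using \<nu>(1) by (simp add: T_def)
    have "h x * emeasure \<nu> UNIV \<le> K x UNIV" by (rule h_le) simp
    also have "K x UNIV = (\<Sum>k. ennreal (pmf b k))"
      unfolding K_def by (simp add: emeasure_kernel_pow_UNIV[OF markov])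
    also have "\<dots> = 1"
      using nn_integral_pmf[of UNIV b] by (simp add: nn_integral_count_space_nat)
    finally show "subprob_space (T x)"
      using sets_eq_imp_space_eq[OF sT] sets_eq_imp_space_eq[OF \<nu>(1)]
      by (intro subprob_spaceI) (auto simp: T_def)
  next
    fix B :: "'x set" assume "B \<in> sets borel"
    \<comment> \<open>Lower semicontinuity makes the superlevel sets open and so supplies the
      measurability of \<open>T\<close>.\<close>
    have "open {x. a < h x * emeasure \<nu> B}" for a
      using lsc[of "emeasure \<nu> B"] unfolding lower_semicontinuous_def open_subopen[of "{x. a < h x * emeasure \<nu> B}"]
        eventually_nhds by fast
    then show "(\<lambda>x. emeasure (T x) B) \<in> borel_measurable borel"
      unfolding T_def by (intro borel_measurableI_greater) simp
  qed
  show ?thesis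
    unfolding T_chain_def
  proof (intro exI[of _ b] exI[of _ T] conjI ballI allI T)
    show "emeasure (T x) B \<le> (\<Sum>k. ennreal (pmf b k) * emeasure (kernel_pow P k x) B)"
      if "B \<in> sets borel" for x B
      using h_le[OF that, of x] by (simp add: T_def K_def)
    show "lower_semicontinuous (\<lambda>x. emeasure (T x) B)" for B
      using lsc by (simp add: T_def)
    show "emeasure (T x) UNIV > 0" for x
      using h_pos[of x] \<nu>(2) by (simp add: T_def ennreal_zero_less_mult_iff)
  qed
qed

lemma compact_small:
  assumes "compact C"
  shows "small_set P C"
proof -
  obtain \<nu> where \<nu>: "sets \<nu> = sets borel" "emeasure \<nu> UNIV > 0"
    "\<And>x. eventually_minorized_at \<nu> x"
    by (rule eventually_minorized, rule that)
  then obtain N m0 where N: "\<And>x. open (N x)" "\<And>x. x \<in> N x"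
    and m0: "\<And>x m. m \<ge> m0 x \<Longrightarrow> \<exists>c>0. minorizes_on (kernel_pow P m) \<nu> c (N x)"
    unfolding eventually_minorized_at_def by metis
  obtain F where F: "F \<subseteq> C" "finite F" "C \<subseteq> (\<Union>x\<in>F. N x)"
    by (rule compactE_image[OF assms, of C N]) (use N in auto)
  \<comment> \<open>A common exponent: the sum is at least each threshold \<open>m0 x\<close>, and
    every larger exponent is admissible.\<close>
  define a where "a = (\<Sum>x\<in>F. m0 x)"
  have "m0 x \<le> a" if "x \<in> F" for x
    using that F(2) unfolding a_def by (simp add: member_le_sum)
  then have "\<forall>x\<in>F. \<exists>c>0. minorizes_on (kernel_pow P a) \<nu> c (N x)" using m0 by blast
  then obtain c where c: "\<And>x. x \<in> F \<Longrightarrow> c x > 0" "\<And>x. x \<in> F \<Longrightarrow> minorizes_on (kernel_pow P a) \<nu> (c x) (N x)"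
    by metis
  \<comment> \<open>The inserted 1 gives the minimum a value when \<open>F\<close> is empty.\<close>
  define e where "e = Min (insert 1 (c ` F))"
  have e: "e > 0" "\<And>x. x \<in> F \<Longrightarrow> e \<le> c x"
    using F(2) c(1) unfolding e_def by (auto simp: Min_gr_iff)
  have "emeasure (scale_measure e \<nu>) B \<le> emeasure (kernel_pow P a x) B"
    if x: "x \<in> C" and B: "B \<in> sets borel" for x B
  proof -
    obtain y where y: "y \<in> F" "x \<in> N y" using F(3) x by blast
    have "e * emeasure \<nu> B \<le> c y * emeasure \<nu> B" using e(2)[OF y(1)] by (intro mult_right_mono) auto
    also have "\<dots> \<le> emeasure (kernel_pow P a x) B"
      using c(2)[OF y(1)] y B by (auto simp: minorizes_on_def)
    finally show ?thesis by simp
  qed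
  moreover have "C \<in> sets borel" using assms by (intro borel_closed compact_imp_closed)
  moreover have "emeasure (scale_measure e \<nu>) UNIV > 0"
    using e(1) \<nu>(2) by (auto simp: ennreal_zero_less_mult_iff)
  ultimately show ?thesis
    using \<nu>(1) unfolding small_set_def by (intro conjI exI[of _ a] exI[of _ "scale_measure e \<nu>"]) auto
qed

section \<open>Cycles and aperiodicity\<close>

lemma kernel_pow_cycle:
  assumes D: "is_cycle P d D" and i: "i < d" and x: "x \<in> D i"
  shows "emeasure (kernel_pow P k x) (D ((i + k) mod d)) = 1"
  using i x
proof (induction k arbitrary: i x)
  case 0
  then show ?case using D by (auto simp: is_cycle_def)
next
  case (Suc k)
  let ?j = "Suc i mod d"
  have j: "?j < d" using Suc.prems by simp
  have [measurable]: "\<And>i. i < d \<Longrightarrow> D i \<in> sets borel" using D by (auto simp: is_cycle_def)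
  have m: "(i + Suc k) mod d < d" using Suc.prems by simp
  have "emeasure (P x) (D ?j) = 1" using D Suc.prems by (auto simp: is_cycle_def)
  moreover have "1 * emeasure (P x) (D ?j) \<le> emeasure (kernel_pow P (Suc k) x) (D ((i + Suc k) mod d))"
  proof (rule kernel_pow_Suc_minorized[OF markov])
    fix z assume "z \<in> D ?j"
    from Suc.IH[OF j this] show "1 \<le> emeasure (kernel_pow P k z) (D ((i + Suc k) mod d))"
      by (simp add: mod_add_left_eq)
  qed (use m j in auto)
  moreover have "emeasure (kernel_pow P (Suc k) x) (D ((i + Suc k) mod d)) \<le> 1"
    using prob_space.emeasure_le_1[OF kernel_pow_prob[OF markov]] .
  ultimately show ?case by (simp add: antisym del: kernel_pow.simps)
qed

text \<open>If d \<ge> 2, points of two consecutive classes are in different, hence disjoint,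
  classes after any common number k of steps. For large k both laws dominate a positive multiple of
  \<open>\<nu>\<close>, which would then be carried by two disjoint sets and vanish.\<close>

lemma aperiodic: "aperiodic_kernel P"
  unfolding aperiodic_kernel_def
proof (intro conjI allI impI)
  have "space (P x) = UNIV" for x using sets_eq_imp_space_eq[OF sets_kernel[OF markov]] by simp
  then have "is_cycle P 1 (\<lambda>_. UNIV)"
    using prob_space.emeasure_space_1[OF kernel_prob[OF markov]]
    by (auto simp: is_cycle_def disjoint_family_on_def lessThan_Suc)
  then show "\<exists>D. is_cycle P 1 D" by blast
next
  fix d D assume D: "is_cycle P d D"
  obtain \<nu> where \<nu>: "sets \<nu> = sets borel" "emeasure \<nu> UNIV > 0"
    "\<And>x. eventually_minorized_at \<nu> x"
    by (rule eventually_minorized, rule that)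
  show "d \<le> 1"
  proof (rule ccontr)
    assume "\<not> d \<le> 1"
    then have d: "d \<ge> 2" by simp
    have Ds: "\<And>i. i < d \<Longrightarrow> D i \<in> sets borel" using D by (auto simp: is_cycle_def)
    have "emeasure \<nu> (- (\<Union>i<d. D i)) = 0"
      using D irreducibility_measure_minorized[OF \<nu>] by (auto simp: is_cycle_def)
    \<comment> \<open>Some class is nonempty: the classes cover the space up to a
      \<open>\<nu>\<close>-null set, and \<open>\<nu>\<close> is nonzero.\<close>
    then have "- (\<Union>i<d. D i) \<noteq> UNIV" using \<nu>(2) by (metis less_irrefl)
    then obtain i x where ix: "i < d" "x \<in> D i" by blast
    let ?j = "Suc i mod d"
    have j: "?j < d" "?j \<noteq> i" using d ix by (auto simp: mod_Suc)
    have "emeasure (P x) (D ?j) = 1" using D ix by (auto simp: is_cycle_def)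
    then obtain y where y: "y \<in> D ?j" by fastforce
    obtain N m where N: "x \<in> N" "\<forall>k\<ge>m. \<exists>c>0. minorizes_on (kernel_pow P k) \<nu> c N"
      using \<nu>(3)[of x] unfolding eventually_minorized_at_def by blast
    obtain N' m' where N': "y \<in> N'" "\<forall>k\<ge>m'. \<exists>c>0. minorizes_on (kernel_pow P k) \<nu> c N'"
      using \<nu>(3)[of y] unfolding eventually_minorized_at_def by blast
    define k where "k = max m m'"
    obtain c where c: "c > 0" "minorizes_on (kernel_pow P k) \<nu> c N" using N(2) unfolding k_def by (meson max.cobounded1)
    obtain c' where c': "c' > 0" "minorizes_on (kernel_pow P k) \<nu> c' N'" using N'(2) unfolding k_def by (meson max.cobounded2)
    have null: "emeasure \<nu> (- D l) = 0"
      if "e > 0" "minorizes_on (kernel_pow P k) \<nu> e W" "z \<in> W" "l < d" "emeasure (kernel_pow P k z) (D l) = 1" for e W z l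
    proof -
      have "emeasure (kernel_pow P k z) (- D l) = 0"
        using emeasure_compl[of "D l" "kernel_pow P k z"] that(5) Ds[OF that(4)]
          sets_kernel_pow[OF markov, of k z] emeasure_kernel_pow_UNIV[OF markov, of k z]
          sets_eq_imp_space_eq[OF sets_kernel_pow[OF markov, of k z]]
        by (simp add: Compl_eq_Diff_UNIV)
      moreover have "e * emeasure \<nu> (- D l) \<le> emeasure (kernel_pow P k z) (- D l)"
        using that Ds by (auto simp: minorizes_on_def)
      ultimately show ?thesis using \<open>e > 0\<close> by auto
    qed
    let ?a = "(i + k) mod d" and ?b = "(?j + k) mod d"
    have ab: "?a < d" "?b < d" using d by auto
    have "?a \<noteq> ?b"
    proof -
      have "?b = Suc (i + k) mod d" by (simp add: mod_add_left_eq)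
      then show ?thesis using d by (auto simp: mod_Suc)
    qed
    then have "D ?a \<inter> D ?b = {}"
      using D ab by (auto simp: is_cycle_def disjoint_family_on_def)
    then have "- D ?a \<union> - D ?b = UNIV" by blast
    moreover have "emeasure \<nu> (- D ?a) = 0"
      using null[OF c N(1) ab(1)] kernel_pow_cycle[OF D ix] by blast
    moreover have "emeasure \<nu> (- D ?b) = 0"
      using null[OF c' N'(1) ab(2)] kernel_pow_cycle[OF D j(1) y] by blast
    ultimately have "emeasure \<nu> UNIV = 0"
      using emeasure_subadditive[of "- D ?a" \<nu> "- D ?b"] Ds ab \<nu>(1) by simp
    with \<nu>(2) show False by simp
  qed
qed

end

section \<open>Recursions driven by independent innovations\<close>

text \<open>Independence within the sequence and independence of the initial value from the whole
  sequence, seen as one variable in path space, merge into a single family with the initial value at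
  index 0. Such a family can be split at any time.\<close>

lemma (in prob_space) indep_sets_initial_and_innovations:
  fixes X :: "'a \<Rightarrow> 'x::topological_space" and V :: "nat \<Rightarrow> 'a \<Rightarrow> 'u::topological_space"
  assumes indep: "indep_vars (\<lambda>_. borel) V UNIV"
    and indep_init: "indep_set {X -` B \<inter> space M | B. B \<in> sets borel}
           {(\<lambda>\<omega> k. V k \<omega>) -` B \<inter> space M | B. B \<in> sets (PiM UNIV (\<lambda>_. borel))}"
  shows "indep_sets (case_nat {X -` B \<inter> space M | B. B \<in> sets borel}
    (\<lambda>k. {V k -` B \<inter> space M | B. B \<in> sets borel})) UNIV"
proof (rule indep_setsI)
  let ?E = "case_nat {X -` B \<inter> space M | B. B \<in> sets borel} (\<lambda>k. {V k -` B \<inter> space M | B. B \<in> sets borel})"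
  have V: "indep_sets (\<lambda>k. {V k -` B \<inter> space M | B. B \<in> sets borel}) UNIV"
    using indep by (simp add: indep_vars_def2)
  show "?E i \<subseteq> events" for i
    using indep_setD_ev1[OF indep_init] V by (cases i) (auto simp: indep_sets_def)
  fix A J assume J: "J \<noteq> {}" "J \<subseteq> UNIV" "finite J" and A: "\<forall>j\<in>J. A j \<in> ?E j"
  define J' where "J' = Suc -` J"
  have J': "finite J'" "J - {0} = Suc ` J'"
  proof -
    show "finite J'" unfolding J'_def using J(3) by (rule finite_vimageI) simp
    show "J - {0} = Suc ` J'"
    proof
      show "J - {0} \<subseteq> Suc ` J'"
      proof
        fix j assume "j \<in> J - {0}"
        then show "j \<in> Suc ` J'" by (cases j) (auto simp: J'_def)
      qed
    qed (auto simp: J'_def)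
  qed
  have AV: "A (Suc j) \<in> {V j -` B \<inter> space M | B. B \<in> sets borel}" if "j \<in> J'" for j
    using A that by (auto simp: J'_def dest!: bspec)
  have tail: "prob (\<Inter>j\<in>J'. A (Suc j)) = (\<Prod>j\<in>J'. prob (A (Suc j)))" if "J' \<noteq> {}"
    using indep_setsD[OF V _ that J'(1), of "\<lambda>j. A (Suc j)"] AV by auto
  have prod_tail: "(\<Prod>j\<in>J - {0}. prob (A j)) = (\<Prod>j\<in>J'. prob (A (Suc j)))"
    unfolding J'(2) by (subst prod.reindex) auto
  have Inter_tail: "(\<Inter>j\<in>J - {0}. A j) = (\<Inter>j\<in>J'. A (Suc j))"
    unfolding J'(2) by simp
  show "prob (\<Inter>j\<in>J. A j) = (\<Prod>j\<in>J. prob (A j))"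
  proof (cases "0 \<in> J")
    case False
    then have "J' \<noteq> {}" using J(1) J'(2) by auto
    then show ?thesis using False tail prod_tail Inter_tail by simp
  next
    case True
    have J0: "J = insert 0 (J - {0})" using True by blast
    have A0: "A 0 \<in> {X -` B \<inter> space M | B. B \<in> sets borel}" using A True by (auto dest!: bspec)
    show ?thesis
    proof (cases "J' = {}")
      case True
      then have "J = {0}" using J0 J'(2) by simp
      then show ?thesis by simp
    next
      case False
      have "\<forall>j\<in>J'. \<exists>B. B \<in> sets borel \<and> A (Suc j) = V j -` B \<inter> space M"
        using AV by blast
      then obtain B where "\<forall>j\<in>J'. B j \<in> sets borel \<and> A (Suc j) = V j -` B j \<inter> space M"
        by (rule bchoice[THEN exE])
      then have B: "B j \<in> sets borel" "A (Suc j) = V j -` B j \<inter> space M" if "j \<in> J'" for j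
        using that by simp_all
      \<comment> \<open>The intersection over the innovations is the preimage of a cylinder in path
        space, to which the independence of the initial value from the path applies.\<close>
      have "{f. \<forall>j\<in>J'. f j \<in> B j} \<in> sets (PiM (UNIV :: nat set) (\<lambda>_. borel :: 'u measure))"
      proof -
        have "{f \<in> space (PiM (UNIV :: nat set) (\<lambda>_. borel :: 'u measure)). \<forall>j\<in>J'. f j \<in> B j} \<in>
            sets (PiM (UNIV :: nat set) (\<lambda>_. borel :: 'u measure))"
          using J'(1) B(1) by measurable
        then show ?thesis by (simp add: space_PiM)
      qed
      moreover have "(\<Inter>j\<in>J'. A (Suc j)) = (\<lambda>\<omega> k. V k \<omega>) -` {f. \<forall>j\<in>J'. f j \<in> B j} \<inter> space M"
        using False B(2) by auto
      ultimately have "prob (A 0 \<inter> (\<Inter>j\<in>J'. A (Suc j))) = prob (A 0) * prob (\<Inter>j\<in>J'. A (Suc j))"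
        using A0 by (intro indep_setD[OF indep_init]) blast+
      moreover have "(\<Inter>j\<in>J. A j) = A 0 \<inter> (\<Inter>j\<in>J'. A (Suc j))"
        using True unfolding Inter_tail[symmetric] by auto
      moreover have "(\<Prod>j\<in>J. prob (A j)) = prob (A 0) * (\<Prod>j\<in>J'. prob (A (Suc j)))"
        using J(3) True by (simp add: prod.remove[of J 0] prod_tail)
      ultimately show ?thesis using tail[OF False] by simp
    qed
  qed
qed

lemma Int_stable_vimage_sets: "Int_stable {X -` B \<inter> S | B. B \<in> sets N}"
  unfolding Int_stable_def
proof (intro ballI)
  fix a b assume "a \<in> {X -` B \<inter> S | B. B \<in> sets N}" "b \<in> {X -` B \<inter> S | B. B \<in> sets N}"
  then obtain A B where AB: "A \<in> sets N" "B \<in> sets N" "a = X -` A \<inter> S" "b = X -` B \<inter> S" by blast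
  then have "a \<inter> b = X -` (A \<inter> B) \<inter> S" by auto
  then show "a \<inter> b \<in> {X -` B \<inter> S | B. B \<in> sets N}" using AB by blast
qed

lemma measurable_compose_binary:
  assumes "case_prod F \<in> K \<Otimes>\<^sub>M L \<rightarrow>\<^sub>M R" "f \<in> N \<rightarrow>\<^sub>M K" "g \<in> N \<rightarrow>\<^sub>M L"
  shows "(\<lambda>\<omega>. F (f \<omega>) (g \<omega>)) \<in> N \<rightarrow>\<^sub>M R"
  using measurable_compose[OF measurable_Pair[OF assms(2,3)] assms(1)] by simp

text \<open>Measurability in the starting point is that of an integral with a parameter, and rests
  on joint measurability of \<open>F\<close>.\<close>

lemma markov_kernel_step_kernel:
  fixes F :: "'x::topological_space \<Rightarrow> 'u::topological_space \<Rightarrow> 'x"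
  assumes "prob_space M" and [measurable]: "V \<in> M \<rightarrow>\<^sub>M borel"
    and F[measurable]: "case_prod F \<in> borel \<Otimes>\<^sub>M borel \<rightarrow>\<^sub>M borel"
  shows "markov_kernel (step_kernel M V F)"
proof -
  interpret prob_space M by fact
  have [measurable]: "F x \<in> borel \<rightarrow>\<^sub>M borel" for x
    using measurable_Pair2[OF F, of x] by simp
  show ?thesis
    unfolding markov_kernel_def
  proof (rule measurable_prob_algebraI)
    show "prob_space (step_kernel M V F x)" for x
      unfolding step_kernel_def by (rule prob_space_distr) measurable
    show "step_kernel M V F \<in> borel \<rightarrow>\<^sub>M subprob_algebra borel"
    proof (rule measurable_subprob_algebra)
      fix x
      show "subprob_space (step_kernel M V F x)"
        unfolding step_kernel_def by (intro prob_space_imp_subprob_space prob_space_distr) measurable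
      show "sets (step_kernel M V F x) = sets borel" by (simp add: step_kernel_def)
    next
      fix B :: "'x set" assume B[measurable]: "B \<in> sets borel"
      have "emeasure (step_kernel M V F x) B = (\<integral>\<^sup>+\<omega>. indicator B (case_prod F (x, V \<omega>)) \<partial>M)" for x
        unfolding step_kernel_def
        by (subst nn_integral_indicator[symmetric], simp, subst nn_integral_distr) simp_all
      moreover have "(\<lambda>x. \<integral>\<^sup>+\<omega>. indicator B (case_prod F (x, V \<omega>)) \<partial>M) \<in> borel_measurable borel"
        by (rule borel_measurable_nn_integral) measurable
      ultimately show "(\<lambda>x. emeasure (step_kernel M V F x) B) \<in> borel_measurable borel" by simp
    qed
  qed
qed

text \<open>The integral identity characterising the conditional expectation is computed in a
  sigma-algebra larger than the past, generated by \<open>\<phi> 0\<close> and \<open>U 1\<close>,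
  ..., \<open>U k\<close>. Independence of the next innovation is available there, and it contains
  every event of the past.\<close>

lemma markov_chain_recursion:
  fixes \<phi> :: "nat \<Rightarrow> 'w \<Rightarrow> 'x::topological_space" and U :: "nat \<Rightarrow> 'w \<Rightarrow> 'u::topological_space"
  assumes prob: "prob_space M" and init: "\<phi> 0 \<in> M \<rightarrow>\<^sub>M borel"
    and indep: "prob_space.indep_vars M (\<lambda>_. borel) (\<lambda>k. U (Suc k)) UNIV"
    and ident: "\<And>k. distr M borel (U (Suc k)) = distr M borel (U 1)"
    and indep_init: "prob_space.indep_set M
           {\<phi> 0 -` B \<inter> space M | B. B \<in> sets borel}
           {(\<lambda>\<omega> k. U (Suc k) \<omega>) -` B \<inter> space M | B. B \<in> sets (PiM UNIV (\<lambda>_. borel))}"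
    and step: "\<And>k \<omega>. \<omega> \<in> space M \<Longrightarrow> \<phi> (Suc k) \<omega> = F (\<phi> k \<omega>) (U (Suc k) \<omega>)"
    and F[measurable]: "case_prod F \<in> borel \<Otimes>\<^sub>M borel \<rightarrow>\<^sub>M borel"
  shows "markov_chain M (step_kernel M (U 1) F) \<phi>"
proof -
  interpret prob_space M by fact
  have U[measurable]: "U (Suc k) \<in> M \<rightarrow>\<^sub>M borel" for k
    using indep by (auto simp: indep_vars_def2)
  note F_comp = measurable_compose_binary[OF F]
  define P where "P = step_kernel M (U 1) F"
  have P: "markov_kernel P"
    unfolding P_def using U[of 0] by (intro markov_kernel_step_kernel prob F) simp
  have \<phi>[measurable]: "\<phi> k \<in> M \<rightarrow>\<^sub>M borel" for k
  proof (induction k)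
    case (Suc k)
    have "(\<lambda>\<omega>. F (\<phi> k \<omega>) (U (Suc k) \<omega>)) \<in> M \<rightarrow>\<^sub>M borel" by (rule F_comp[OF Suc U])
    then show ?case using step by (subst measurable_cong) auto
  qed (rule init)
  define E where "E = case_nat {\<phi> 0 -` B \<inter> space M | B. B \<in> sets borel}
      (\<lambda>k. {U (Suc k) -` B \<inter> space M | B. B \<in> sets borel})"
  have E: "indep_sets E UNIV"
    unfolding E_def by (rule indep_sets_initial_and_innovations[OF indep indep_init])
  have E_stable: "Int_stable (E i)" for i
    by (cases i) (simp_all add: E_def Int_stable_vimage_sets)
  have "AE \<omega> in M. real_cond_exp M (past M \<phi> k) (\<lambda>\<omega>. indicator B (\<phi> (Suc k) \<omega>)) \<omega> = measure (P (\<phi> k \<omega>)) B"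
    if B[measurable]: "B \<in> sets borel" for k B
  proof -
    \<comment> \<open>Index 0 of \<open>E\<close> is the initial value, so the indices up to
      \<open>k\<close> stop at \<open>U k\<close>; the next innovation \<open>U (Suc k)\<close> has
      index \<open>Suc k\<close>.\<close>
    define N where "N = sigma (space M) (\<Union>i\<in>{..k}. E i)"
    have E_events: "E i \<subseteq> events" for i using E by (auto simp: indep_sets_def)
    have E_sub: "(\<Union>i\<in>{..k}. E i) \<subseteq> Pow (space M)"
      using E_events sets.sets_into_space by blast
    have space_N: "space N = space M" unfolding N_def by (rule space_measure_of[OF E_sub])
    have sets_N: "sets N = sigma_sets (space M) (\<Union>i\<in>{..k}. E i)"
      unfolding N_def by (rule sets_measure_of[OF E_sub])
    have N_sub: "sets N \<subseteq> sets M"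
      unfolding sets_N using E_events by (intro sets.sigma_sets_subset) blast
    have \<phi>N: "\<phi> i \<in> N \<rightarrow>\<^sub>M borel" if "i \<le> k" for i
      using that
    proof (induction i)
      case 0
      show ?case
      proof (rule measurableI)
        fix B :: "'x set" assume "B \<in> sets borel"
        then have "\<phi> 0 -` B \<inter> space M \<in> E 0" unfolding E_def by auto
        then show "\<phi> 0 -` B \<inter> space N \<in> sets N" unfolding space_N sets_N by (intro sigma_sets.Basic) blast
      qed simp
    next
      case (Suc i)
      have "U (Suc i) \<in> N \<rightarrow>\<^sub>M borel"
      proof (rule measurableI)
        fix B :: "'u set" assume "B \<in> sets borel"
        then have "U (Suc i) -` B \<inter> space M \<in> E (Suc i)" unfolding E_def by auto
        then show "U (Suc i) -` B \<inter> space N \<in> sets N"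
          unfolding space_N sets_N using Suc.prems by (intro sigma_sets.Basic) blast
      qed simp
      then have "(\<lambda>\<omega>. F (\<phi> i \<omega>) (U (Suc i) \<omega>)) \<in> N \<rightarrow>\<^sub>M borel"
        using Suc by (intro F_comp) auto
      then show ?case using step space_N by (subst measurable_cong) auto
    qed
    have gen_sub: "(\<Union>i\<in>{..k}. {\<phi> i -` B \<inter> space M | B. B \<in> sets borel}) \<subseteq> Pow (space M)" by auto
    have space_past: "space (past M \<phi> k) = space M"
      unfolding past_def by (rule space_measure_of[OF gen_sub])
    have sets_past: "sets (past M \<phi> k) = sigma_sets (space M) (\<Union>i\<in>{..k}. {\<phi> i -` B \<inter> space M | B. B \<in> sets borel})"
      unfolding past_def by (rule sets_measure_of[OF gen_sub])
    have past_N: "sets (past M \<phi> k) \<subseteq> sets N"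
      unfolding sets_past space_N[symmetric]
      by (intro sets.sigma_sets_subset) (auto intro!: measurable_sets[OF \<phi>N])
    have sub: "subalgebra M (past M \<phi> k)"
      using past_N N_sub space_past by (auto simp: subalgebra_def)
    interpret finite_measure_subalgebra M "past M \<phi> k"
      by unfold_locales (rule sub)
    have \<phi>_past: "\<phi> k \<in> past M \<phi> k \<rightarrow>\<^sub>M borel"
      by (rule measurableI) (auto simp: space_past sets_past intro!: sigma_sets.Basic)
    have P_meas: "(\<lambda>z. measure (P z) B) \<in> borel_measurable borel"
    proof -
      have "P \<in> borel \<rightarrow>\<^sub>M subprob_algebra borel"
        using P unfolding markov_kernel_def by (rule measurable_prob_algebraD)
      from measurable_compose[OF this measurable_measure_subprob_algebra[OF B]] show ?thesis .
    qed
    have P_prob: "prob_space (P z)" for z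
      using measurable_space[OF P[unfolded markov_kernel_def], of z] by (auto simp: space_prob_algebra)
    have indep_N: "indep_set (sets N) (sigma_sets (space M) (E (Suc k)))"
    proof -
      have "indep_sets (\<lambda>b. sigma_sets (space M) (\<Union>i\<in>case_bool {..k} {Suc k} b. E i)) UNIV"
      proof (rule indep_sets_collect_sigma)
        show "indep_sets E (\<Union>b\<in>UNIV. case_bool {..k} {Suc k} b)"
          by (rule indep_sets_mono_index[OF _ E]) simp
        show "disjoint_family_on (case_bool {..k} {Suc k}) UNIV"
          by (auto simp: disjoint_family_on_def split: bool.splits)
      qed (rule E_stable)
      then show ?thesis
        unfolding indep_set_def sets_N by (rule indep_sets_mono_sets) (auto split: bool.splits)
    qed
    \<comment> \<open>Seen as a map from \<open>M\<close> to \<open>N\<close>, the identity is a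
      random variable that carries all information up to time \<open>k\<close>. Its joint law with
      \<open>U (Suc k)\<close> is a product, ready for Fubini.\<close>
    have id_meas: "(\<lambda>\<omega>. \<omega>) \<in> M \<rightarrow>\<^sub>M N"
      using N_sub space_N by (intro measurableI) (auto simp: Int_absorb2 dest: sets.sets_into_space)
    have joint: "distr M N (\<lambda>\<omega>. \<omega>) \<Otimes>\<^sub>M distr M borel (U (Suc k)) = distr M (N \<Otimes>\<^sub>M borel) (\<lambda>\<omega>. (\<omega>, U (Suc k) \<omega>))"
    proof (rule pair_measure_eqI)
      show "sigma_finite_measure (distr M N (\<lambda>\<omega>. \<omega>))" "sigma_finite_measure (distr M borel (U (Suc k)))"
        using prob_space_distr[OF id_meas] prob_space_distr[OF U[of k]]
        by (simp_all add: prob_space_imp_sigma_finite)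
      show "sets (distr M N (\<lambda>\<omega>. \<omega>) \<Otimes>\<^sub>M distr M borel (U (Suc k))) = sets (distr M (N \<Otimes>\<^sub>M borel) (\<lambda>\<omega>. (\<omega>, U (Suc k) \<omega>)))"
        by (simp cong: sets_pair_measure_cong)
      fix A B assume "A \<in> sets (distr M N (\<lambda>\<omega>. \<omega>))" "B \<in> sets (distr M borel (U (Suc k)))"
      then have AB: "A \<in> sets N" "B \<in> sets borel" by auto
      have A_sub: "A \<subseteq> space M" using sets.sets_into_space[OF AB(1)] space_N by simp
      have "U (Suc k) -` B \<inter> space M \<in> E (Suc k)" using AB(2) unfolding E_def by auto
      then have "U (Suc k) -` B \<inter> space M \<in> sigma_sets (space M) (E (Suc k))" by (rule sigma_sets.Basic)
      from indep_setD[OF indep_N AB(1) this]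
      have "prob (A \<inter> U (Suc k) -` B) = prob A * prob (U (Suc k) -` B \<inter> space M)"
        using A_sub by (simp add: Int_assoc[symmetric] Int_absorb2 Int_commute Int_left_commute)
      moreover have "(\<lambda>\<omega>. (\<omega>, U (Suc k) \<omega>)) -` (A \<times> B) \<inter> space M = A \<inter> U (Suc k) -` B"
        using A_sub by auto
      moreover have "(\<lambda>\<omega>. (\<omega>, U (Suc k) \<omega>)) \<in> M \<rightarrow>\<^sub>M N \<Otimes>\<^sub>M borel" using id_meas by measurable
      moreover have "(\<lambda>\<omega>. \<omega>) -` A \<inter> space M = A" using A_sub by auto
      ultimately show "emeasure (distr M N (\<lambda>\<omega>. \<omega>)) A * emeasure (distr M borel (U (Suc k))) B =
          emeasure (distr M (N \<Otimes>\<^sub>M borel) (\<lambda>\<omega>. (\<omega>, U (Suc k) \<omega>))) (A \<times> B)"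
        using AB id_meas by (simp add: emeasure_distr emeasure_eq_measure ennreal_mult)
    qed
    show ?thesis
    proof (rule real_cond_exp_charact)
      fix A assume "A \<in> sets (past M \<phi> k)"
      then have A[measurable]: "A \<in> sets N" and AM[measurable]: "A \<in> sets M" using past_N N_sub by auto
      interpret D: prob_space "distr M borel (U (Suc k))" by (rule prob_space_distr) measurable
      have [measurable]: "\<phi> k \<in> N \<rightarrow>\<^sub>M borel" by (rule \<phi>N) simp
      let ?g = "\<lambda>(\<omega>, u). indicator A \<omega> * indicator B (F (\<phi> k \<omega>) u) :: ennreal"
      have "(\<lambda>p. F (\<phi> k (fst p)) (snd p)) \<in> N \<Otimes>\<^sub>M borel \<rightarrow>\<^sub>M borel"
        by (rule F_comp) measurable
      then have g: "?g \<in> borel_measurable (N \<Otimes>\<^sub>M borel)"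
        unfolding case_prod_beta by measurable
      have "(\<integral>\<^sup>+\<omega>. indicator A \<omega> * indicator B (\<phi> (Suc k) \<omega>) \<partial>M) = (\<integral>\<^sup>+\<omega>. ?g (\<omega>, U (Suc k) \<omega>) \<partial>M)"
        using step by (intro nn_integral_cong) simp
      also have "\<dots> = (\<integral>\<^sup>+p. ?g p \<partial>distr M (N \<Otimes>\<^sub>M borel) (\<lambda>\<omega>. (\<omega>, U (Suc k) \<omega>)))"
        using g by (intro nn_integral_distr[OF measurable_Pair[OF id_meas U], symmetric]) simp
      also have "\<dots> = (\<integral>\<^sup>+\<omega>. \<integral>\<^sup>+u. ?g (\<omega>, u) \<partial>distr M borel (U (Suc k)) \<partial>distr M N (\<lambda>\<omega>. \<omega>))"
        unfolding joint[symmetric] using g by (intro D.nn_integral_fst[symmetric]) simp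
      also have "\<dots> = (\<integral>\<^sup>+\<omega>. indicator A \<omega> * emeasure (P (\<phi> k \<omega>)) B \<partial>distr M N (\<lambda>\<omega>. \<omega>))"
      proof (intro nn_integral_cong)
        fix \<omega>
        have Fx[measurable]: "F (\<phi> k \<omega>) \<in> borel \<rightarrow>\<^sub>M borel" using measurable_Pair2[OF F, of "\<phi> k \<omega>"] by simp
        have "P (\<phi> k \<omega>) = distr (distr M borel (U (Suc k))) borel (F (\<phi> k \<omega>))"
          unfolding P_def step_kernel_def ident using U[of 0] by (subst distr_distr) (auto simp: o_def)
        then have "emeasure (P (\<phi> k \<omega>)) B = (\<integral>\<^sup>+u. indicator B (F (\<phi> k \<omega>) u) \<partial>distr M borel (U (Suc k)))"
          by (simp add: nn_integral_indicator[symmetric] nn_integral_distr del: nn_integral_indicator)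
        then show "(\<integral>\<^sup>+u. ?g (\<omega>, u) \<partial>distr M borel (U (Suc k))) = indicator A \<omega> * emeasure (P (\<phi> k \<omega>)) B"
          by (simp add: nn_integral_cmult)
      qed
      also have "\<dots> = (\<integral>\<^sup>+\<omega>. indicator A \<omega> * emeasure (P (\<phi> k \<omega>)) B \<partial>M)"
      proof (rule nn_integral_distr[OF id_meas])
        have "P \<in> borel \<rightarrow>\<^sub>M subprob_algebra borel"
          using P unfolding markov_kernel_def by (rule measurable_prob_algebraD)
        then show "(\<lambda>\<omega>. indicator A \<omega> * emeasure (P (\<phi> k \<omega>)) B) \<in> borel_measurable (distr M N (\<lambda>\<omega>. \<omega>))" 
          by measurable
      qed
      finally have eq: "(\<integral>\<^sup>+\<omega>. indicator A \<omega> * indicator B (\<phi> (Suc k) \<omega>) \<partial>M) =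
        (\<integral>\<^sup>+\<omega>. indicator A \<omega> * emeasure (P (\<phi> k \<omega>)) B \<partial>M)" .
      have "(\<integral>\<omega>\<in>A. indicator B (\<phi> (Suc k) \<omega>) \<partial>M) = enn2real (\<integral>\<^sup>+\<omega>. indicator A \<omega> * indicator B (\<phi> (Suc k) \<omega>) \<partial>M)"
        unfolding set_lebesgue_integral_def
        by (subst integral_eq_nn_integral) (auto intro!: arg_cong[where f=enn2real] nn_integral_cong split: split_indicator)
      also have "\<dots> = (\<integral>\<omega>\<in>A. measure (P (\<phi> k \<omega>)) B \<partial>M)"
        unfolding eq set_lebesgue_integral_def using measurable_compose[OF \<phi> P_meas, of k]
        by (subst integral_eq_nn_integral)
          (auto intro!: arg_cong[where f=enn2real] nn_integral_cong
            simp: finite_measure.emeasure_eq_measure[OF prob_space.finite_measure[OF P_prob]] split: split_indicator)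
      finally show "(\<integral>\<omega>\<in>A. indicator B (\<phi> (Suc k) \<omega>) \<partial>M) = (\<integral>\<omega>\<in>A. measure (P (\<phi> k \<omega>)) B \<partial>M)" .
    next
      show "integrable M (\<lambda>\<omega>. indicator B (\<phi> (Suc k) \<omega>) :: real)"
        by (rule integrable_const_bound[where B=1]) auto
      show "integrable M (\<lambda>\<omega>. measure (P (\<phi> k \<omega>)) B)"
        using measurable_compose[OF \<phi> P_meas, of k] prob_space.prob_le_1[OF P_prob]
        by (intro integrable_const_bound[where B=1]) auto
      show "(\<lambda>\<omega>. measure (P (\<phi> k \<omega>)) B) \<in> borel_measurable (past M \<phi> k)"
        by (rule measurable_compose[OF \<phi>_past P_meas])
    qed
  qed
  then show ?thesis using P \<phi> unfolding markov_chain_def P_def[symmetric] by blast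
qed

section \<open>Flows of locally Lipschitz vector fields\<close>

text \<open>The squared distance times \<open>exp (- (2 * L * t))\<close> is nonincreasing. The
  square is differentiable even where the curves meet.\<close>

lemma gronwall_lipschitz:
  fixes u v :: "real \<Rightarrow> 'e::real_inner"
  assumes lip: "L-lipschitz_on S f" and T: "0 \<le> T"
    and u: "\<And>t. 0 \<le> t \<Longrightarrow> t \<le> T \<Longrightarrow> u t \<in> S \<and> (u has_vector_derivative f (u t)) (at t)"
    and v: "\<And>t. 0 \<le> t \<Longrightarrow> t \<le> T \<Longrightarrow> v t \<in> S \<and> (v has_vector_derivative f (v t)) (at t)"
  shows "norm (u T - v T) \<le> exp (L * T) * norm (u 0 - v 0)"
proof -
  define \<psi> where "\<psi> t = ((u t - v t) \<bullet> (u t - v t)) * exp (- (2 * L * t))" for t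
  have "\<psi> T \<le> \<psi> 0"
  proof (rule DERIV_nonpos_imp_nonincreasing[OF T])
    fix t assume t: "0 \<le> t" "t \<le> T"
    let ?d = "u t - v t" and ?d' = "f (u t) - f (v t)"
    have "((\<lambda>t. u t - v t) has_vector_derivative ?d') (at t)"
      using u[OF t] v[OF t] by (auto intro: has_vector_derivative_diff)
    then have d: "((\<lambda>t. u t - v t) has_derivative (\<lambda>x. x *\<^sub>R ?d')) (at t)"
      by (simp add: has_vector_derivative_def)
    have "((\<lambda>t. (u t - v t) \<bullet> (u t - v t)) has_derivative (\<lambda>x. ?d \<bullet> (x *\<^sub>R ?d') + (x *\<^sub>R ?d') \<bullet> ?d)) (at t)"
      by (rule has_derivative_inner[OF d d])
    then have inner_deriv: "((\<lambda>t. (u t - v t) \<bullet> (u t - v t)) has_real_derivative 2 * (?d \<bullet> ?d')) (at t)"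
      unfolding has_field_derivative_def
      by (rule has_derivative_eq_rhs) (auto simp: fun_eq_iff inner_commute algebra_simps)
    have D: "(\<psi> has_real_derivative (2 * (?d \<bullet> ?d') - 2 * L * (?d \<bullet> ?d)) * exp (- (2 * L * t))) (at t)"
    proof -
      have "((\<lambda>t. exp (- (2 * L * t))) has_real_derivative - (2 * L) * exp (- (2 * L * t))) (at t)"
        by (auto intro!: derivative_eq_intros)
      from DERIV_mult[OF inner_deriv this] show ?thesis
        unfolding \<psi>_def by (rule DERIV_cong) (simp add: algebra_simps)
    qed
    have "?d \<bullet> ?d' \<le> norm ?d * norm ?d'" by (rule norm_cauchy_schwarz)
    also have "\<dots> \<le> norm ?d * (L * norm ?d)"
      using u[OF t] v[OF t] lipschitz_on_normD[OF lip] by (intro mult_left_mono) auto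
    also have "\<dots> = L * (?d \<bullet> ?d)" by (simp add: power2_norm_eq_inner[symmetric] power2_eq_square)
    finally have "(2 * (?d \<bullet> ?d') - 2 * L * (?d \<bullet> ?d)) * exp (- (2 * L * t)) \<le> 0"
      by (intro mult_nonpos_nonneg) auto
    with D show "\<exists>y. DERIV \<psi> t :> y \<and> y \<le> 0" by blast
  qed
  then have "(norm (u T - v T))\<^sup>2 * exp (- (2 * L * T)) \<le> (norm (u 0 - v 0))\<^sup>2"
    by (simp add: \<psi>_def power2_norm_eq_inner)
  then have "(norm (u T - v T))\<^sup>2 \<le> (norm (u 0 - v 0))\<^sup>2 * exp (2 * L * T)"
    by (simp add: exp_minus field_simps)
  also have "\<dots> = (exp (L * T) * norm (u 0 - v 0))\<^sup>2"
    by (simp add: power_mult_distrib exp_double[symmetric] mult.assoc mult.commute)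
  finally show ?thesis by (rule power2_le_imp_le) simp
qed

text \<open>A bootstrap: \<open>step\<close> improves membership in the closed set \<open>K\<close>
  up to time t to membership in the smaller open set \<open>W\<close>. At the first time outside
  \<open>W\<close> the curve is still in \<open>K\<close> by closedness, hence in \<open>W\<close>,
  a contradiction.\<close>

lemma curve_stays_in:
  fixes Y :: "real \<Rightarrow> 's::topological_space"
  assumes cont: "continuous_on UNIV Y" and K: "closed K" and W: "open W" "W \<subseteq> K" and 0: "Y 0 \<in> K"
    and step: "\<And>t. 0 \<le> t \<Longrightarrow> t \<le> T \<Longrightarrow> (\<And>\<tau>. 0 \<le> \<tau> \<Longrightarrow> \<tau> \<le> t \<Longrightarrow> Y \<tau> \<in> K) \<Longrightarrow> Y t \<in> W"
    and t: "0 \<le> t" "t \<le> T"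
  shows "Y t \<in> K"
proof (rule ccontr)
  assume "Y t \<notin> K"
  define E where "E = {0..t} \<inter> Y -` (- W)"
  have "closed (Y -` (- W))"
    using cont W(1) by (intro continuous_closed_vimage) (auto simp: continuous_on_eq_continuous_at)
  then have "compact E" unfolding E_def by (intro compact_Int_closed) auto
  moreover have "t \<in> E" using \<open>Y t \<notin> K\<close> W(2) t by (auto simp: E_def)
  ultimately obtain s where s: "s \<in> E" "\<And>r. r \<in> E \<Longrightarrow> s \<le> r"
    using compact_attains_inf[of E] by blast
  have before: "Y \<tau> \<in> K" if "0 \<le> \<tau>" "\<tau> < s" for \<tau>
    using that s(1) s(2)[of \<tau>] W(2) by (force simp: E_def)
  have "Y s \<in> K"
  proof (cases "s = 0")
    case False
    then have "0 < s" using s(1) by (auto simp: E_def)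
    have "closed (Y -` K)"
      using cont K by (intro continuous_closed_vimage) (auto simp: continuous_on_eq_continuous_at)
    moreover have "{0..<s} \<subseteq> Y -` K" using before by auto
    ultimately have "closure {0..<s} \<subseteq> Y -` K" by (rule closure_minimal[rotated])
    moreover have "s \<in> closure {0..<s}" using \<open>0 < s\<close> by simp
    ultimately show ?thesis by blast
  qed (use 0 in simp)
  then have "Y s \<in> W"
    using before s(1) t by (intro step) (auto simp: E_def order.order_iff_strict)
  then show False using s(1) by (auto simp: E_def)
qed

text \<open>Induction along the half-line, by the infimum of the failing times. It extends
  uniqueness and continuity of the flow from short times to all nonnegative times.\<close>

lemma nonneg_real_induct:
  fixes S :: "real set"
  assumes 0: "0 \<in> S" and lim: "\<And>t. t > 0 \<Longrightarrow> {0..<t} \<subseteq> S \<Longrightarrow> t \<in> S"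
    and step: "\<And>t. t \<ge> 0 \<Longrightarrow> t \<in> S \<Longrightarrow> \<exists>\<delta>>0. {t..t+\<delta>} \<subseteq> S"
    and t: "t \<ge> 0"
  shows "t \<in> S"
proof (rule ccontr)
  assume "t \<notin> S"
  define E where "E = {0..} - S"
  have ne: "E \<noteq> {}" using \<open>t \<notin> S\<close> t by (auto simp: E_def)
  have bd: "bdd_below E" by (rule bdd_belowI[of _ 0]) (auto simp: E_def)
  define s where "s = Inf E"
  have "s \<ge> 0" unfolding s_def using ne by (intro cInf_greatest) (auto simp: E_def)
  have below: "{0..<s} \<subseteq> S"
  proof
    fix r assume r: "r \<in> {0..<s}"
    show "r \<in> S"
    proof (rule ccontr)
      assume "r \<notin> S"
      then have "r \<in> E" using r by (simp add: E_def)
      from cInf_lower[OF this bd] show False using r by (simp add: s_def)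
    qed
  qed
  have "s \<in> S" using 0 lim[OF _ below] \<open>s \<ge> 0\<close> by (cases "s = 0") auto
  then obtain \<delta> where \<delta>: "\<delta> > 0" "{s..s+\<delta>} \<subseteq> S" using step \<open>s \<ge> 0\<close> by blast
  have "s + \<delta> \<le> Inf E"
  proof (rule cInf_greatest[OF ne])
    fix r assume r: "r \<in> E"
    then have "r \<ge> s" using cInf_lower[OF r bd] by (simp add: s_def)
    moreover have "r \<notin> {s..s+\<delta>}" using r \<delta>(2) by (auto simp: E_def)
    ultimately show "s + \<delta> \<le> r" by simp
  qed
  with \<delta>(1) show False by (simp add: s_def)
qed

text \<open>An autonomous vector field given in charts, \<open>f i\<close> being its expression in
  the coordinates \<open>h i\<close>. The space will be \<open>'x \<times> (real ^ 'n)\<close>, the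
  tangent bundle trivialised by the frame.\<close>

locale charted_flow =
  fixes I :: "'i set" and D :: "'i \<Rightarrow> 's::t2_space set"
    and h :: "'i \<Rightarrow> 's \<Rightarrow> 'e::euclidean_space" and k :: "'i \<Rightarrow> 'e \<Rightarrow> 's"
    and f :: "'i \<Rightarrow> 'e \<Rightarrow> 'e"
  assumes cover: "\<exists>i\<in>I. y \<in> D i"
    and open_dom: "i \<in> I \<Longrightarrow> open (D i)"
    and open_img: "i \<in> I \<Longrightarrow> open (h i ` D i)"
    and homeo: "i \<in> I \<Longrightarrow> homeomorphism (D i) (h i ` D i) (h i) (k i)"
    and field_lipschitz: "i \<in> I \<Longrightarrow> z \<in> h i ` D i \<Longrightarrow>
      \<exists>R>0. \<exists>L. cball z R \<subseteq> h i ` D i \<and> L-lipschitz_on (cball z R) (f i)"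
begin

text \<open>Continuity is demanded separately because \<open>h i\<close> is arbitrary off
  \<open>D i\<close>: a derivative of the coordinates would not by itself keep the curve in the
  domain nearby.\<close>

definition integral_curve :: "(real \<Rightarrow> 's) \<Rightarrow> bool" where
  "integral_curve Y \<longleftrightarrow> continuous_on UNIV Y \<and> (\<forall>i\<in>I. \<forall>t. Y t \<in> D i \<longrightarrow>
     ((\<lambda>\<tau>. h i (Y \<tau>)) has_vector_derivative f i (h i (Y t))) (at t))"

lemma integral_curve_shift:
  assumes "integral_curve Y"
  shows "integral_curve (\<lambda>t. Y (a + t))"
  unfolding integral_curve_def
proof (intro conjI ballI allI impI)
  show "continuous_on UNIV (\<lambda>t. Y (a + t))"
    using assms unfolding integral_curve_def
    by (intro continuous_on_compose2[where f="\<lambda>t. a + t" and g=Y and t=UNIV] continuous_intros) auto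
next
  fix i t assume "i \<in> I" "Y (a + t) \<in> D i"
  then have "((\<lambda>\<tau>. h i (Y \<tau>)) has_vector_derivative f i (h i (Y (a + t)))) (at (a + t))"
    using assms by (auto simp: integral_curve_def)
  then have "(((\<lambda>\<tau>. h i (Y \<tau>)) \<circ> (\<lambda>t. a + t)) has_vector_derivative 1 *\<^sub>R f i (h i (Y (a + t)))) (at t)"
    by (intro vector_diff_chain_at) (auto intro!: derivative_eq_intros)
  then show "((\<lambda>t. h i (Y (a + t))) has_vector_derivative f i (h i (Y (a + t)))) (at t)"
    by (simp add: o_def)
qed

lemma integral_curve_isCont: "integral_curve Y \<Longrightarrow> isCont Y t"
  by (auto simp: integral_curve_def continuous_on_eq_continuous_at)

lemma inv_dom: "i \<in> I \<Longrightarrow> x \<in> D i \<Longrightarrow> k i (h i x) = x"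
  and dom_inv: "i \<in> I \<Longrightarrow> z \<in> h i ` D i \<Longrightarrow> h i (k i z) = z"
  and inv_in_dom: "i \<in> I \<Longrightarrow> z \<in> h i ` D i \<Longrightarrow> k i z \<in> D i"
  and isCont_inv: "i \<in> I \<Longrightarrow> z \<in> h i ` D i \<Longrightarrow> isCont (k i) z"
  and isCont_chart: "i \<in> I \<Longrightarrow> x \<in> D i \<Longrightarrow> isCont (h i) x"
  using homeo[of i] open_img[of i] open_dom[of i]
  by (auto simp: homeomorphism_def continuous_on_eq_continuous_at)

lemma open_chart_ball:
  assumes i: "i \<in> I"
  shows "open {x \<in> D i. h i x \<in> ball z R}"
proof -
  have "continuous_on (D i) (h i)" using homeo[OF i] by (auto simp: homeomorphism_def)
  then have "open (D i \<inter> h i -` ball z R)"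
    using open_dom[OF i] by (intro continuous_open_preimage) auto
  then show ?thesis by (simp add: vimage_def Int_def)
qed

text \<open>Gronwall needs both curves inside the ball, and staying inside needs Gronwall;
  \<open>curve_stays_in\<close> resolves the circle. The reference curve keeps to half the radius,
  and by \<open>close\<close> the deviation never uses up the other half.\<close>

lemma tracking:
  assumes i: "i \<in> I" and ball: "cball z R \<subseteq> h i ` D i" and lip: "L-lipschitz_on (cball z R) (f i)"
    and Y0: "integral_curve Y0" "\<And>t. 0 \<le> t \<Longrightarrow> t \<le> T \<Longrightarrow> Y0 t \<in> D i \<and> h i (Y0 t) \<in> cball z (R / 2)"
    and Y: "integral_curve Y" "Y 0 \<in> D i"
    and close: "exp (L * T) * norm (h i (Y 0) - h i (Y0 0)) < R / 2"
    and t: "0 \<le> t" "t \<le> T"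
  shows "Y t \<in> D i \<and> h i (Y t) \<in> cball z R \<and>
    norm (h i (Y t) - h i (Y0 t)) \<le> exp (L * t) * norm (h i (Y 0) - h i (Y0 0))"
proof -
  have L: "L \<ge> 0" using lip lipschitz_on_nonneg by blast
  have T: "T \<ge> 0" using t by simp
  let ?a = "norm (h i (Y 0) - h i (Y0 0))"
  have "0 \<le> exp (L * T) * ?a" by simp
  then have "R > 0" using close by linarith
  \<comment> \<open>The closed ball as a subset of the space: compact, and therefore closed by the
    Hausdorff property.\<close>
  define K where "K = k i ` cball z R"
  define W where "W = {x \<in> D i. h i x \<in> ball z R}"
  have "continuous_on (cball z R) (k i)"
    using homeo[OF i] ball by (auto simp: homeomorphism_def intro: continuous_on_subset)
  then have K: "closed K" unfolding K_def by (intro compact_imp_closed compact_continuous_image) auto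
  have inK: "x \<in> K \<longleftrightarrow> x \<in> D i \<and> h i x \<in> cball z R" for x
    unfolding K_def using ball inv_dom[OF i] dom_inv[OF i] inv_in_dom[OF i] by force
  have W: "open W" "W \<subseteq> K" unfolding W_def by (rule open_chart_ball[OF i]) (auto simp: inK)
  have bound: "norm (h i (Y s) - h i (Y0 s)) \<le> exp (L * s) * ?a"
    if s: "0 \<le> s" "s \<le> T" and inside: "\<And>\<tau>. 0 \<le> \<tau> \<Longrightarrow> \<tau> \<le> s \<Longrightarrow> Y \<tau> \<in> K" for s
  proof (rule gronwall_lipschitz[OF lip s(1)])
    fix \<tau> assume \<tau>: "0 \<le> \<tau>" "\<tau> \<le> s"
    show "h i (Y \<tau>) \<in> cball z R \<and> ((\<lambda>t. h i (Y t)) has_vector_derivative f i (h i (Y \<tau>))) (at \<tau>)"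
      using inside[OF \<tau>] Y(1) i by (auto simp: inK integral_curve_def)
    have "Y0 \<tau> \<in> D i" "h i (Y0 \<tau>) \<in> cball z (R / 2)" using Y0(2)[of \<tau>] \<tau> s by auto
    then show "h i (Y0 \<tau>) \<in> cball z R \<and> ((\<lambda>t. h i (Y0 t)) has_vector_derivative f i (h i (Y0 \<tau>))) (at \<tau>)"
      using Y0(1) i \<open>R > 0\<close> by (auto simp: integral_curve_def)
  qed
  have tri: "dist z (h i (Y s)) < R"
    if "0 \<le> s" "s \<le> T" "norm (h i (Y s) - h i (Y0 s)) \<le> exp (L * s) * ?a" for s
  proof -
    have "exp (L * s) * ?a \<le> exp (L * T) * ?a"
      using that L by (intro mult_right_mono) (auto intro: mult_left_mono)
    then have "norm (h i (Y s) - h i (Y0 s)) < R / 2" using that close by linarith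
    moreover have "dist z (h i (Y0 s)) \<le> R / 2" using Y0(2)[of s] that by auto
    ultimately show ?thesis
      using dist_triangle[of z "h i (Y s)" "h i (Y0 s)"] by (simp add: dist_norm norm_minus_commute)
  qed
  have stay: "Y s \<in> K" if "0 \<le> s" "s \<le> T" for s
  proof (rule curve_stays_in[of Y K W T s])
    show "continuous_on UNIV Y" using Y(1) by (simp add: integral_curve_def)
    show "Y 0 \<in> K" using tri[of 0] T Y(2) by (auto simp: inK)
    fix r assume r: "0 \<le> r" "r \<le> T" "\<And>\<tau>. 0 \<le> \<tau> \<Longrightarrow> \<tau> \<le> r \<Longrightarrow> Y \<tau> \<in> K"
    then have "Y r \<in> D i" by (auto simp: inK)
    then show "Y r \<in> W" using tri[OF r(1,2) bound[OF r]] by (auto simp: W_def)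
  qed (use K W that in auto)
  show ?thesis
    using stay[OF t] bound[OF t] stay t by (force simp: inK)
qed

lemma curve_in_chart_initially:
  assumes i: "i \<in> I" and Y: "integral_curve Y" "Y 0 \<in> D i" and R: "R > 0"
  obtains \<delta> where "\<delta> > 0" "\<And>t. 0 \<le> t \<Longrightarrow> t \<le> \<delta> \<Longrightarrow> Y t \<in> D i \<and> h i (Y t) \<in> cball (h i (Y 0)) R"
proof -
  let ?W = "{x \<in> D i. h i x \<in> ball (h i (Y 0)) R}"
  have "open (Y -` ?W)"
    using Y open_chart_ball[OF i] by (intro continuous_open_vimage) (auto intro: integral_curve_isCont)
  moreover have "0 \<in> Y -` ?W" using Y(2) R by auto
  ultimately obtain e where e: "e > 0" "\<And>t. dist t 0 < e \<Longrightarrow> t \<in> Y -` ?W"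
    unfolding open_dist by blast
  show thesis
  proof (rule that[of "e / 2"])
    fix t :: real assume "0 \<le> t" "t \<le> e / 2"
    then have "dist t 0 < e" using e(1) by (auto simp: dist_real_def)
    from e(2)[OF this] show "Y t \<in> D i \<and> h i (Y t) \<in> cball (h i (Y 0)) R" by auto
  qed (use e in auto)
qed

text \<open>Coincidence is a closed condition in a Hausdorff space, and it persists for a short time
  by \<open>tracking\<close> with initial distance 0.\<close>

lemma integral_curve_unique:
  assumes Y: "integral_curve Y" "integral_curve Y'" "Y 0 = Y' 0" and t: "t \<ge> 0"
  shows "Y t = Y' t"
proof -
  have "closed {t. Y t = Y' t}"
    using Y by (intro closed_Collect_eq) (auto simp: integral_curve_def)
  have "t \<in> {t. Y t = Y' t}"
  proof (rule nonneg_real_induct[OF _ _ _ t])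
    fix t :: real assume "t > 0" "{0..<t} \<subseteq> {t. Y t = Y' t}"
    then have "closure {0..<t} \<subseteq> {t. Y t = Y' t}"
      using \<open>closed {t. Y t = Y' t}\<close> by (intro closure_minimal)
    moreover have "t \<in> closure {0..<t}" using \<open>t > 0\<close> by simp
    ultimately show "t \<in> {t. Y t = Y' t}" by blast
  next
    fix t :: real assume "t \<in> {t. Y t = Y' t}"
    then have eq: "Y t = Y' t" by simp
    obtain i where i: "i \<in> I" "Y t \<in> D i" using cover by blast
    obtain R L where R: "R > 0" "cball (h i (Y t)) R \<subseteq> h i ` D i" "L-lipschitz_on (cball (h i (Y t)) R) (f i)"
      using field_lipschitz[of i "h i (Y t)"] i by blast
    let ?Y = "\<lambda>r. Y (t + r)" and ?Y' = "\<lambda>r. Y' (t + r)"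
    have c: "integral_curve ?Y" "integral_curve ?Y'" using Y by (auto intro: integral_curve_shift)
    obtain \<delta> where \<delta>: "\<delta> > 0" "\<And>r. 0 \<le> r \<Longrightarrow> r \<le> \<delta> \<Longrightarrow> ?Y r \<in> D i \<and> h i (?Y r) \<in> cball (h i (?Y 0)) (R / 2)"
      using curve_in_chart_initially[OF i(1) c(1), of "R / 2"] i(2) R(1) by auto
    have "Y (t + r) = Y' (t + r)" if r: "0 \<le> r" "r \<le> \<delta>" for r
    proof -
      have "?Y' r \<in> D i \<and> h i (?Y' r) \<in> cball (h i (Y t)) R \<and>
         norm (h i (?Y' r) - h i (?Y r)) \<le> exp (L * r) * norm (h i (?Y' 0) - h i (?Y 0))"
        using i eq \<delta>(2) R r by (intro tracking[OF i(1) R(2,3) c(1) _ c(2), where T=\<delta>]) auto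
      then have "?Y' r \<in> D i" "h i (?Y' r) = h i (?Y r)" using eq by auto
      then show ?thesis using \<delta>(2)[OF r] inv_dom[OF i(1)] by metis
    qed
    then have "{t..t+\<delta>} \<subseteq> {t. Y t = Y' t}"
      by (auto simp: subset_iff) (metis add_diff_cancel_left' diff_add_cancel diff_ge_0_iff_ge le_diff_eq add.commute)
    then show "\<exists>\<delta>>0. {t..t+\<delta>} \<subseteq> {t. Y t = Y' t}" using \<delta>(1) by blast
  qed (use Y in simp)
  then show ?thesis by simp
qed

end

text \<open>Existence of integral curves is assumed; for geodesics it comes from completeness of the
  manifold.\<close>

locale complete_charted_flow = charted_flow I D h k f
  for I :: "'i set" and D :: "'i \<Rightarrow> 's::t2_space set"
    and h :: "'i \<Rightarrow> 's \<Rightarrow> 'e::euclidean_space" and k :: "'i \<Rightarrow> 'e \<Rightarrow> 's"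
    and f :: "'i \<Rightarrow> 'e \<Rightarrow> 'e" +
  assumes complete: "\<exists>Y. integral_curve Y \<and> Y 0 = y"
begin

text \<open>By \<open>integral_curve_unique\<close> the chosen curve does not matter for t \<ge>
  0.\<close>

definition flow :: "real \<Rightarrow> 's \<Rightarrow> 's" where
  "flow t y = (SOME Y. integral_curve Y \<and> Y 0 = y) t"

lemma integral_curve_flow: "integral_curve (\<lambda>t. flow t y)"
  and flow_0: "flow 0 y = y"
  using someI_ex[OF complete, of y] by (auto simp: flow_def)

lemma flow_unique: "integral_curve Y \<Longrightarrow> t \<ge> 0 \<Longrightarrow> Y t = flow t (Y 0)"
  by (rule integral_curve_unique[OF _ integral_curve_flow]) (auto simp: flow_0)

lemma flow_add: "t \<ge> 0 \<Longrightarrow> flow (s + t) y = flow t (flow s y)"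
  using flow_unique[OF integral_curve_shift[OF integral_curve_flow, of s y]] by simp

text \<open>The time \<open>\<delta>\<close> is uniform over \<open>N\<close>. This lets
  \<open>isCont_flow\<close> apply the statement at a point of a trajectory reached shortly before a
  limit time.\<close>

lemma flow_locally_continuous:
  "\<exists>\<delta>>0. \<exists>N. open N \<and> p \<in> N \<and> (\<forall>y\<in>N. \<forall>r\<in>{0..\<delta>}. isCont (flow r) y)"
proof -
  obtain i where i: "i \<in> I" "p \<in> D i" using cover by blast
  obtain R L where R: "R > 0" "cball (h i p) R \<subseteq> h i ` D i" "L-lipschitz_on (cball (h i p) R) (f i)"
    using field_lipschitz[of i "h i p"] i by blast
  have L: "L \<ge> 0" using R(3) lipschitz_on_nonneg by blast
  note ic = integral_curve_flow
  \<comment> \<open>The trajectory of \<open>p\<close> stays within \<open>R / 8\<close> of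
    \<open>p\<close>, and \<open>N\<close> is so small that, after the Gronwall factor
    \<open>E\<close>, trajectories from \<open>N\<close> stay less than \<open>R / 8\<close> from
    it. They remain in the half ball and can themselves be reference curves for
    \<open>tracking\<close>.\<close>
  obtain \<delta> where \<delta>: "\<delta> > 0"
    "\<And>r. 0 \<le> r \<Longrightarrow> r \<le> \<delta> \<Longrightarrow> flow r p \<in> D i \<and> h i (flow r p) \<in> cball (h i p) (R / 8)"
    using curve_in_chart_initially[OF i(1) ic[of p], of "R / 8"] i(2) R(1) by (auto simp: flow_0)
  define E where "E = exp (L * \<delta>)"
  have E: "E > 0" by (simp add: E_def)
  have expE: "exp (L * r) \<le> E" if "r \<le> \<delta>" for r using that L by (auto simp: E_def intro: mult_left_mono)
  define N where "N = {x \<in> D i. h i x \<in> ball (h i p) (R / (8 * E))}"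
  have N: "open N" "p \<in> N" unfolding N_def using open_chart_ball[OF i(1)] i R E by auto
  have in_half: "flow r y \<in> D i \<and> h i (flow r y) \<in> cball (h i p) (R / 2)"
    if y: "y \<in> N" and r: "0 \<le> r" "r \<le> \<delta>" for y r
  proof -
    have "norm (h i y - h i p) < R / (8 * E)" using y by (auto simp: N_def dist_norm norm_minus_commute)
    then have c: "E * norm (h i y - h i p) < R / 8" using E by (simp add: field_simps)
    have *: "flow r y \<in> D i \<and> h i (flow r y) \<in> cball (h i p) R \<and>
       norm (h i (flow r y) - h i (flow r p)) \<le> exp (L * r) * norm (h i (flow 0 y) - h i (flow 0 p))"
    proof (rule tracking[OF i(1) R(2,3) ic _ ic, where T=\<delta>])
      show "flow t p \<in> D i \<and> h i (flow t p) \<in> cball (h i p) (R / 2)" if "0 \<le> t" "t \<le> \<delta>" for t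
        using \<delta>(2)[OF that] R(1) by auto
    qed (use y c R(1) r in \<open>auto simp: flow_0 N_def E_def\<close>)
    moreover have "exp (L * r) * norm (h i y - h i p) \<le> E * norm (h i y - h i p)"
      using expE[OF r(2)] by (intro mult_right_mono) auto
    ultimately have "norm (h i (flow r y) - h i (flow r p)) < R / 8" using c by (simp add: flow_0)
    moreover have "dist (h i p) (h i (flow r p)) \<le> R / 8" using \<delta>(2)[OF r] by simp
    ultimately have "dist (h i p) (h i (flow r y)) \<le> R / 2"
      using dist_triangle[of "h i p" "h i (flow r y)" "h i (flow r p)"] R(1)
      by (simp add: dist_norm norm_minus_commute)
    then show ?thesis using * by simp
  qed
  have "isCont (flow r) y" if y: "y \<in> N" and r: "0 \<le> r" "r \<le> \<delta>" for y r
  proof -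
    have close: "flow r y' \<in> D i \<and> norm (h i (flow r y') - h i (flow r y)) \<le> E * norm (h i y' - h i y)"
      if y': "y' \<in> N" for y'
    proof -
      have "norm (h i y' - h i p) < R / (8 * E)" "norm (h i y - h i p) < R / (8 * E)"
        using y y' by (auto simp: N_def dist_norm norm_minus_commute)
      then have "norm (h i y' - h i y) < R / (8 * E) + R / (8 * E)"
        using norm_triangle_ineq4[of "h i y' - h i p" "h i y - h i p"] by simp
      then have "E * norm (h i y' - h i y) < R / 2" using E R(1) by (simp add: field_simps)
      then have *: "flow r y' \<in> D i \<and> h i (flow r y') \<in> cball (h i p) R \<and>
         norm (h i (flow r y') - h i (flow r y)) \<le> exp (L * r) * norm (h i (flow 0 y') - h i (flow 0 y))"
        using in_half[OF y] y' r
        by (intro tracking[OF i(1) R(2,3) ic _ ic, where T=\<delta>]) (auto simp: flow_0 N_def E_def)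
      moreover have "exp (L * r) * norm (h i y' - h i y) \<le> E * norm (h i y' - h i y)"
        using expE[OF r(2)] by (intro mult_right_mono) auto
      ultimately show ?thesis by (auto simp: flow_0)
    qed
    have "y \<in> D i" using y by (simp add: N_def)
    have "((\<lambda>y'. h i (flow r y') - h i (flow r y)) \<longlongrightarrow> 0) (at y)"
    proof (rule Lim_null_comparison)
      show "\<forall>\<^sub>F y' in at y. norm (h i (flow r y') - h i (flow r y)) \<le> E * norm (h i y' - h i y)"
        using close N(1) y by (auto simp: eventually_at_topological)
      have "(h i \<longlongrightarrow> h i y) (at y)" using isCont_chart[OF i(1) \<open>y \<in> D i\<close>] by (simp add: isCont_def)
      then have "((\<lambda>y'. E * norm (h i y' - h i y)) \<longlongrightarrow> E * norm (h i y - h i y)) (at y)"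
        by (intro tendsto_intros)
      then show "((\<lambda>y'. E * norm (h i y' - h i y)) \<longlongrightarrow> 0) (at y)" by simp
    qed
    then have c: "isCont (\<lambda>y'. h i (flow r y')) y" by (simp add: isCont_def LIM_zero_iff)
    have "h i (flow r y) \<in> h i ` D i" using close[OF y] by auto
    then have "isCont (\<lambda>y'. k i (h i (flow r y'))) y"
      by (rule isCont_o2[OF c isCont_inv[OF i(1)]])
    moreover have ev: "\<forall>\<^sub>F y' in nhds y. k i (h i (flow r y')) = flow r y'"
      unfolding eventually_nhds using close inv_dom[OF i(1)] N(1) y by (intro exI[of _ N]) simp
    ultimately show ?thesis using isCont_cong[OF ev] by simp
  qed
  then show ?thesis using \<delta>(1) N by (intro exI[of _ \<delta>] conjI exI[of _ N]) auto
qed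

text \<open>Real induction with the semigroup law. At a limit time the flow is restarted from an
  earlier time, where continuity is known already.\<close>

lemma isCont_flow:
  assumes "t \<ge> 0"
  shows "isCont (flow t) y"
proof -
  have "t \<in> {t. isCont (flow t) y}"
  proof (rule nonneg_real_induct[OF _ _ _ assms])
    have "flow 0 = (\<lambda>y. y)" by (simp add: fun_eq_iff flow_0)
    then show "0 \<in> {t. isCont (flow t) y}" by simp
  next
    fix t :: real assume t: "t > 0" "{0..<t} \<subseteq> {t. isCont (flow t) y}"
    obtain \<delta> N where \<delta>: "\<delta> > 0" "open N" "flow t y \<in> N" "\<And>x r. x \<in> N \<Longrightarrow> 0 \<le> r \<Longrightarrow> r \<le> \<delta> \<Longrightarrow> isCont (flow r) x"
      using flow_locally_continuous[of "flow t y"] by force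
    have "open ((\<lambda>s. flow s y) -` N)"
      using \<delta>(2) integral_curve_isCont[OF integral_curve_flow] by (intro continuous_open_vimage) auto
    then obtain e where e: "e > 0" "\<And>s. dist s t < e \<Longrightarrow> flow s y \<in> N"
      using \<delta>(3) unfolding open_dist vimage_eq by blast
    \<comment> \<open>\<open>s\<close> precedes \<open>t\<close> by at most \<open>\<delta>\<close>,
      and so little that \<open>flow s y\<close> is already in \<open>N\<close>; the maximum with 0
      keeps it nonnegative.\<close>
    define s where "s = max 0 (t - min \<delta> (e / 2))"
    have s: "0 \<le> s" "s < t" "t - s \<le> \<delta>" "dist s t < e"
      using t(1) \<delta>(1) e(1) by (auto simp: s_def dist_real_def)
    have "isCont (flow s) y" using s t(2) by auto
    moreover have "isCont (flow (t - s)) (flow s y)" using \<delta>(4) e(2) s by auto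
    ultimately have "isCont (\<lambda>y. flow (t - s) (flow s y)) y" by (rule isCont_o2)
    moreover have "flow t = (\<lambda>y. flow (t - s) (flow s y))"
      using s flow_add[of "t - s" s] by (simp add: fun_eq_iff)
    ultimately show "t \<in> {t. isCont (flow t) y}" by simp
  next
    fix t :: real assume t: "t \<ge> 0" "t \<in> {t. isCont (flow t) y}"
    obtain \<delta> N where \<delta>: "\<delta> > 0" "open N" "flow t y \<in> N" "\<And>x r. x \<in> N \<Longrightarrow> 0 \<le> r \<Longrightarrow> r \<le> \<delta> \<Longrightarrow> isCont (flow r) x"
      using flow_locally_continuous[of "flow t y"] by force
    have "isCont (flow s) y" if "s \<in> {t..t+\<delta>}" for s
    proof -
      have "isCont (\<lambda>y. flow (s - t) (flow t y)) y"
      proof (rule isCont_o2[where f="flow t" and g="flow (s - t)"])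
        show "isCont (flow t) y" using t(2) by simp
        show "isCont (flow (s - t)) (flow t y)" using that by (intro \<delta>(4)[OF \<delta>(3)]) auto
      qed
      moreover have "flow s = (\<lambda>y. flow (s - t) (flow t y))"
        using that flow_add[of "s - t" t] by (simp add: fun_eq_iff)
      ultimately show ?thesis by simp
    qed
    then show "\<exists>\<delta>>0. {t..t+\<delta>} \<subseteq> {t. isCont (flow t) y}" using \<delta>(1) by blast
  qed
  then show ?thesis by simp
qed

end

section \<open>Locally Lipschitz functions\<close>

text \<open>The regularity used for all coefficients: closed under the algebra behind Christoffel
  symbols and inverse matrices, and strong enough for Gronwall.\<close>

definition loclip_on :: "'a::metric_space set \<Rightarrow> ('a \<Rightarrow> 'b::metric_space) \<Rightarrow> bool" where
  "loclip_on S f \<longleftrightarrow> (\<forall>z\<in>S. \<exists>r>0. \<exists>L. L-lipschitz_on (ball z r \<inter> S) f)"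

lemma loclip_onE:
  assumes "loclip_on S f" "z \<in> S"
  obtains r L where "r > 0" "\<And>r'. r' \<le> r \<Longrightarrow> L-lipschitz_on (ball z r' \<inter> S) f"
proof -
  obtain r L where r: "r > 0" "L-lipschitz_on (ball z r \<inter> S) f"
    using assms unfolding loclip_on_def by blast
  show thesis
    by (rule that[OF r(1)], rule lipschitz_on_subset[OF r(2)]) auto
qed

lemma loclip_on_continuous_on:
  assumes "loclip_on S f"
  shows "continuous_on S f"
  unfolding continuous_on_eq_continuous_within
proof
  fix z assume z: "z \<in> S"
  obtain r L where r: "r > 0" "\<And>r'. r' \<le> r \<Longrightarrow> L-lipschitz_on (ball z r' \<inter> S) f"
    using loclip_onE[OF assms z] by blast
  have "continuous_on (ball z r \<inter> S) f" using lipschitz_on_continuous_on[OF r(2)] by simp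
  then have "continuous (at z within (ball z r \<inter> S)) f"
    using z r(1) by (auto simp: continuous_on_eq_continuous_within)
  moreover have "at z within (ball z r \<inter> S) = at z within S"
    by (rule at_within_nhd[of _ "ball z r"]) (use r(1) in auto)
  ultimately show "continuous (at z within S) f" by simp
qed

lemma loclip_on_cong:
  assumes "\<And>z. z \<in> S \<Longrightarrow> f z = g z"
  shows "loclip_on S f \<longleftrightarrow> loclip_on S g"
proof -
  have "L-lipschitz_on (ball z r \<inter> S) f \<longleftrightarrow> L-lipschitz_on (ball z r \<inter> S) g" for L z r
    using assms by (intro lipschitz_on_cong) auto
  then show ?thesis by (simp add: loclip_on_def)
qed

lemma loclip_on_const: "loclip_on S (\<lambda>_. c)"
  unfolding loclip_on_def by (intro ballI exI[of _ 1] exI[of _ 0] conjI lipschitz_on_constant) simp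

lemma loclip_on_bounded_linear:
  assumes "bounded_linear f"
  shows "loclip_on S f"
  unfolding loclip_on_def
proof
  fix z
  obtain B where "B-lipschitz_on (ball z 1 \<inter> S) f" using bounded_linear.lipschitz_boundE[OF assms] by blast
  then show "\<exists>r>0. \<exists>L. L-lipschitz_on (ball z r \<inter> S) f" by (intro exI[of _ 1]) auto
qed

lemma loclip_on_compose:
  assumes f: "loclip_on S f" and g: "loclip_on T g" and "f ` S \<subseteq> T"
  shows "loclip_on S (\<lambda>x. g (f x))"
  unfolding loclip_on_def
proof
  fix z assume z: "z \<in> S"
  obtain r L where r: "r > 0" "\<And>r'. r' \<le> r \<Longrightarrow> L-lipschitz_on (ball z r' \<inter> S) f"
    using loclip_onE[OF f z] by blast
  obtain q M where q: "q > 0" "\<And>r'. r' \<le> q \<Longrightarrow> M-lipschitz_on (ball (f z) r' \<inter> T) g"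
    using loclip_onE[OF g] z assms(3) by blast
  have L: "L \<ge> 0" using r(2)[of r] lipschitz_on_nonneg by blast
  \<comment> \<open>\<open>L + 1\<close> in place of \<open>L\<close> avoids division by zero and
    makes the bound on the image strict.\<close>
  define e where "e = min r (q / (L + 1))"
  have e: "e > 0" "e \<le> r" using r(1) q(1) L by (auto simp: e_def)
  have "f y \<in> ball (f z) q \<inter> T" if "y \<in> ball z e \<inter> S" for y
  proof -
    have "dist (f z) (f y) \<le> L * dist z y"
      using lipschitz_onD[OF r(2)[OF order_refl]] that z e r(1) by auto
    also have "\<dots> \<le> L * e" using that L by (intro mult_left_mono) auto
    also have "\<dots> \<le> L * (q / (L + 1))" using L by (intro mult_left_mono) (auto simp: e_def)
    also have "\<dots> < q" using q(1) L by (simp add: field_simps)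
    finally show ?thesis using that assms(3) by auto
  qed
  then have "f ` (ball z e \<inter> S) \<subseteq> ball (f z) q \<inter> T" by blast
  then have "(M * L)-lipschitz_on (ball z e \<inter> S) (\<lambda>x. g (f x))"
    by (intro lipschitz_on_compose2[OF r(2)[OF e(2)]] lipschitz_on_subset[OF q(2)[OF order_refl]])
  then show "\<exists>r>0. \<exists>L. L-lipschitz_on (ball z r \<inter> S) (\<lambda>x. g (f x))" using e by blast
qed

lemma loclip_on_Pair:
  assumes f: "loclip_on S f" and g: "loclip_on S g"
  shows "loclip_on S (\<lambda>x. (f x, g x))"
  unfolding loclip_on_def
proof
  fix z assume z: "z \<in> S"
  obtain r L where r: "r > 0" "\<And>r'. r' \<le> r \<Longrightarrow> L-lipschitz_on (ball z r' \<inter> S) f"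
    using loclip_onE[OF f z] by blast
  obtain q M where q: "q > 0" "\<And>r'. r' \<le> q \<Longrightarrow> M-lipschitz_on (ball z r' \<inter> S) g"
    using loclip_onE[OF g z] by blast
  have "(sqrt (L\<^sup>2 + M\<^sup>2))-lipschitz_on (ball z (min r q) \<inter> S) (\<lambda>x. (f x, g x))"
    by (intro lipschitz_on_Pair r(2) q(2)) auto
  then show "\<exists>r>0. \<exists>L. L-lipschitz_on (ball z r \<inter> S) (\<lambda>x. (f x, g x))"
    using r(1) q(1) by (intro exI[of _ "min r q"]) auto
qed

lemma loclip_on_add:
  fixes f g :: "'a::metric_space \<Rightarrow> 'b::real_normed_vector"
  assumes "loclip_on S f" "loclip_on S g"
  shows "loclip_on S (\<lambda>x. f x + g x)"
  using loclip_on_compose[OF loclip_on_Pair[OF assms], of UNIV "\<lambda>p. fst p + snd p"]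
  by (simp add: loclip_on_bounded_linear bounded_linear_add bounded_linear_fst bounded_linear_snd)

lemma loclip_on_sum:
  fixes f :: "'i \<Rightarrow> 'a::metric_space \<Rightarrow> 'b::real_normed_vector"
  assumes "\<And>i. i \<in> I \<Longrightarrow> loclip_on S (f i)"
  shows "loclip_on S (\<lambda>x. \<Sum>i\<in>I. f i x)"
  using assms by (induction I rule: infinite_finite_induct) (auto intro: loclip_on_const loclip_on_add)

lemma loclip_on_minus:
  fixes f :: "'a::metric_space \<Rightarrow> 'b::real_normed_vector"
  assumes "loclip_on S f"
  shows "loclip_on S (\<lambda>x. - f x)"
  using loclip_on_compose[OF assms, of UNIV uminus]
  by (simp add: loclip_on_bounded_linear bounded_linear_minus bounded_linear_ident)

lemma loclip_on_diff:
  fixes f g :: "'a::metric_space \<Rightarrow> 'b::real_normed_vector"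
  assumes "loclip_on S f" "loclip_on S g"
  shows "loclip_on S (\<lambda>x. f x - g x)"
  using loclip_on_add[OF assms(1) loclip_on_minus[OF assms(2)]] by simp

lemma loclip_on_vec:
  fixes f :: "'a::metric_space \<Rightarrow> 'n::finite \<Rightarrow> real"
  assumes "\<And>i. loclip_on S (\<lambda>x. f x i)"
  shows "loclip_on S (\<lambda>x. \<chi> i. f x i)"
proof -
  have "(\<chi> i. f x i) = (\<Sum>i\<in>UNIV. f x i *\<^sub>R axis i 1)" for x
    by (simp add: vec_eq_iff axis_def if_distrib cong: if_cong)
  moreover have "loclip_on S (\<lambda>x. \<Sum>i\<in>UNIV. f x i *\<^sub>R (axis i 1 :: real ^ 'n))"
    using loclip_on_compose[OF assms, of UNIV "\<lambda>a. a *\<^sub>R (axis _ 1 :: real ^ 'n)"]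
    by (intro loclip_on_sum) (simp add: loclip_on_bounded_linear bounded_linear_scaleR_left)
  ultimately show ?thesis by simp
qed

lemma loclip_on_component:
  fixes f :: "real ^ 'n \<Rightarrow> real ^ 'n"
  assumes "loclip_on S f"
  shows "loclip_on S (\<lambda>z. f z $ i)"
  using loclip_on_compose[OF assms, of UNIV "\<lambda>v. v $ i"]
  by (simp add: loclip_on_bounded_linear bounded_linear_vec_nth)

text \<open>Composition with multiplication on the plane, which is Lipschitz on unit balls because
  both factors are bounded there.\<close>

lemma loclip_on_mult:
  fixes f g :: "'a::metric_space \<Rightarrow> real"
  assumes f: "loclip_on S f" and g: "loclip_on S g"
  shows "loclip_on S (\<lambda>x. f x * g x)"
proof -
  have "loclip_on UNIV (\<lambda>p::real \<times> real. fst p * snd p)"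
    unfolding loclip_on_def
  proof
    fix z :: "real \<times> real"
    define B where "B = norm z + 1"
    have "(2 * B)-lipschitz_on (ball z 1 \<inter> UNIV) (\<lambda>p. fst p * snd p)"
    proof (rule lipschitz_onI)
      fix p q assume "p \<in> ball z 1 \<inter> UNIV" "q \<in> ball z 1 \<inter> UNIV"
      then have "norm p \<le> B" "norm q \<le> B"
        using norm_triangle_ineq2[of p z] norm_triangle_ineq2[of q z] by (auto simp: B_def dist_norm norm_minus_commute)
      then have b: "\<bar>fst p\<bar> \<le> B" "\<bar>snd q\<bar> \<le> B"
        using norm_fst_le[of "fst p" "snd p"] norm_snd_le[of "snd q" "fst q"] by auto
      have "fst p * snd p - fst q * snd q = fst p * (snd p - snd q) + (fst p - fst q) * snd q"
        by (simp add: algebra_simps)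
      then have "\<bar>fst p * snd p - fst q * snd q\<bar> \<le> \<bar>fst p\<bar> * \<bar>snd p - snd q\<bar> + \<bar>fst p - fst q\<bar> * \<bar>snd q\<bar>"
        by (metis abs_mult abs_triangle_ineq)
      also have "\<dots> \<le> B * dist p q + dist p q * B"
        using b dist_fst_le[of p q] dist_snd_le[of p q]
        by (intro add_mono mult_mono) (auto simp: dist_real_def)
      finally show "dist (fst p * snd p) (fst q * snd q) \<le> 2 * B * dist p q" by (simp add: dist_real_def)
    qed (simp add: B_def)
    then show "\<exists>r>0. \<exists>L. L-lipschitz_on (ball z r \<inter> UNIV) (\<lambda>p. fst p * snd p)" by (intro exI[of _ 1]) auto
  qed
  from loclip_on_compose[OF loclip_on_Pair[OF f g] this] show ?thesis by simp
qed

lemma loclip_on_inverse: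
  fixes f :: "'a::metric_space \<Rightarrow> real"
  assumes f: "loclip_on S f" and nz: "\<And>x. x \<in> S \<Longrightarrow> f x \<noteq> 0"
  shows "loclip_on S (\<lambda>x. inverse (f x))"
proof -
  have "loclip_on (- {0}) (inverse :: real \<Rightarrow> real)"
    unfolding loclip_on_def
  proof
    fix z :: real assume z: "z \<in> - {0}"
    let ?r = "\<bar>z\<bar> / 2"
    have "(1 / ?r\<^sup>2)-lipschitz_on (ball z ?r \<inter> - {0}) inverse"
    proof (rule lipschitz_onI)
      fix x y assume "x \<in> ball z ?r \<inter> - {0}" "y \<in> ball z ?r \<inter> - {0}"
      then have d: "x \<noteq> 0" "y \<noteq> 0" "\<bar>z - x\<bar> < ?r" "\<bar>z - y\<bar> < ?r" by (auto simp: dist_real_def)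
      then have xy: "x \<noteq> 0" "y \<noteq> 0" "\<bar>x\<bar> \<ge> ?r" "\<bar>y\<bar> \<ge> ?r" by arith+
      have r: "?r > 0" using z by simp
      have "dist (inverse x) (inverse y) = \<bar>x - y\<bar> / (\<bar>x\<bar> * \<bar>y\<bar>)"
      proof -
        have "inverse x - inverse y = (y - x) / (x * y)" using xy by (simp add: field_simps)
        then show ?thesis by (simp add: dist_real_def abs_mult abs_minus_commute)
      qed
      also have "\<dots> \<le> \<bar>x - y\<bar> / (?r * ?r)"
        using xy r by (intro divide_left_mono mult_mono mult_pos_pos) auto
      finally show "dist (inverse x) (inverse y) \<le> 1 / ?r\<^sup>2 * dist x y"
        by (simp add: dist_real_def power2_eq_square mult.commute)
    qed simp
    then show "\<exists>r>0. \<exists>L. L-lipschitz_on (ball z r \<inter> - {0}) inverse"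
      using z by (intro exI[of _ ?r]) auto
  qed
  then show ?thesis using nz by (intro loclip_on_compose[OF f]) auto
qed

lemma loclip_on_prod:
  fixes f :: "'i \<Rightarrow> 'a::metric_space \<Rightarrow> real"
  assumes "\<And>i. i \<in> I \<Longrightarrow> loclip_on S (f i)"
  shows "loclip_on S (\<lambda>x. \<Prod>i\<in>I. f i x)"
  using assms by (induction I rule: infinite_finite_induct) (auto intro: loclip_on_const loclip_on_mult)

lemma loclip_on_det:
  fixes M :: "'a::metric_space \<Rightarrow> real ^ 'n ^ 'n"
  assumes "\<And>i j. loclip_on S (\<lambda>z. M z $ i $ j)"
  shows "loclip_on S (\<lambda>z. det (M z))"
  unfolding det_def by (intro loclip_on_sum loclip_on_mult loclip_on_prod loclip_on_const assms)

text \<open>Quotients of determinants involve only sums, products and an inverse, so local Lipschitz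
  continuity passes from a matrix to its inverse.\<close>

lemma matrix_inv_entry_cramer:
  fixes M :: "real ^ 'n ^ 'n"
  assumes "invertible M"
  shows "matrix_inv M $ k $ l = det (\<chi> i j. if j = k then axis l 1 $ i else M $ i $ j) * inverse (det M)"
proof -
  have "M ** matrix_inv M = mat 1"
    using someI_ex[OF assms[unfolded invertible_def]] unfolding matrix_inv_def by blast
  then have "M *v (matrix_inv M *v axis l 1) = axis l 1"
    by (simp add: matrix_vector_mul_assoc)
  moreover have "det M \<noteq> 0" using assms by (simp add: invertible_det_nz)
  ultimately have "matrix_inv M *v axis l 1 = (\<chi> k. det (\<chi> i j. if j = k then axis l 1 $ i else M $ i $ j) / det M)"
    using cramer by blast
  then have "(matrix_inv M *v axis l 1) $ k = det (\<chi> i j. if j = k then axis l 1 $ i else M $ i $ j) / det M"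
    by simp
  then show ?thesis by (simp add: matrix_vector_mul_component inner_axis divide_inverse)
qed

lemma loclip_on_matrix_inv:
  fixes M :: "'a::metric_space \<Rightarrow> real ^ 'n ^ 'n"
  assumes M: "\<And>i j. loclip_on S (\<lambda>z. M z $ i $ j)" and inv: "\<And>z. z \<in> S \<Longrightarrow> invertible (M z)"
  shows "loclip_on S (\<lambda>z. matrix_inv (M z) $ k $ l)"
proof -
  have "loclip_on S (\<lambda>z. if j = k then axis l 1 $ i else M z $ i $ j)" for i j
    using M loclip_on_const by (cases "j = k") auto
  then have "loclip_on S (\<lambda>z. det (\<chi> i j. if j = k then axis l 1 $ i else M z $ i $ j) * inverse (det (M z)))"
    using inv by (intro loclip_on_mult loclip_on_inverse loclip_on_det M)
      (auto simp: invertible_det_nz cong: if_cong)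
  then show ?thesis
    using matrix_inv_entry_cramer[OF inv] loclip_on_cong by (metis (no_types, lifting))
qed

lemma smooth_on_frechet_derivative:
  "smooth_on S f \<Longrightarrow> smooth_on S (\<lambda>x. frechet_derivative f (at x) v)"
  unfolding smooth_on_def using Ck_on.simps(2) by blast

lemma smooth_on_differentiable: "smooth_on S f \<Longrightarrow> x \<in> S \<Longrightarrow> f differentiable (at x)"
  unfolding smooth_on_def using Ck_on.simps(2) by blast

lemma smooth_on_continuous_on: "smooth_on S f \<Longrightarrow> continuous_on S f"
  unfolding smooth_on_def using Ck_on.simps(1) by blast

text \<open>\<open>Ck_on\<close> controls the derivative direction by direction. Bounds for the
  finitely many basis directions on a compact ball bound the operator norm there, and the mean value
  inequality on the convex ball concludes.\<close>

lemma smooth_on_loclip_on: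
  fixes f :: "'a::euclidean_space \<Rightarrow> 'b::real_normed_vector"
  assumes f: "smooth_on S f" and S: "open S"
  shows "loclip_on S f"
  unfolding loclip_on_def
proof
  fix z assume "z \<in> S"
  then obtain r where r: "r > 0" "cball z r \<subseteq> S" using S open_contains_cball by blast
  have "\<exists>B. \<forall>x\<in>cball z r. norm (frechet_derivative f (at x) b) \<le> B" for b
  proof -
    have "continuous_on (cball z r) (\<lambda>x. frechet_derivative f (at x) b)"
      using smooth_on_continuous_on[OF smooth_on_frechet_derivative[OF f]] r(2) continuous_on_subset by blast
    then have "bounded ((\<lambda>x. frechet_derivative f (at x) b) ` cball z r)"
      by (intro compact_imp_bounded compact_continuous_image) auto
    then show ?thesis by (auto simp: bounded_iff)
  qed
  then obtain B where B: "\<And>b x. x \<in> cball z r \<Longrightarrow> norm (frechet_derivative f (at x) b) \<le> B b" by metis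
  define L where "L = (\<Sum>b\<in>(Basis::'a set). \<bar>B b\<bar>)"
  have "L-lipschitz_on (cball z r) f"
  proof (rule bounded_derivative_imp_lipschitz)
    fix x assume x: "x \<in> cball z r"
    then have df: "(f has_derivative frechet_derivative f (at x)) (at x)"
      using smooth_on_differentiable[OF f] r(2) frechet_derivative_works by blast
    then show "(f has_derivative frechet_derivative f (at x)) (at x within cball z r)"
      by (rule has_derivative_at_withinI)
    have lin: "linear (frechet_derivative f (at x))" using df has_derivative_linear by blast
    show "onorm (frechet_derivative f (at x)) \<le> L"
    proof (rule onorm_le)
      fix v
      have eq: "frechet_derivative f (at x) v = (\<Sum>b\<in>Basis. (v \<bullet> b) *\<^sub>R frechet_derivative f (at x) b)"
        by (subst euclidean_representation[of v, symmetric]) (simp add: linear_sum[OF lin] linear_scale[OF lin] o_def)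
      have "norm (frechet_derivative f (at x) v) \<le> (\<Sum>b\<in>Basis. norm ((v \<bullet> b) *\<^sub>R frechet_derivative f (at x) b))"
        unfolding eq by (rule norm_sum)
      also have "\<dots> \<le> (\<Sum>b\<in>Basis. norm v * \<bar>B b\<bar>)"
        using B[OF x] by (intro sum_mono) (auto intro!: mult_mono Basis_le_norm order.trans[OF B[OF x] abs_ge_self])
      also have "\<dots> = L * norm v" by (simp add: L_def sum_distrib_left mult.commute)
      finally show "norm (frechet_derivative f (at x) v) \<le> L * norm v" .
    qed
  qed (auto simp: L_def sum_nonneg)
  then have "L-lipschitz_on (ball z r \<inter> S) f" by (rule lipschitz_on_subset) auto
  then show "\<exists>r>0. \<exists>L. L-lipschitz_on (ball z r \<inter> S) f" using r(1) by blast
qed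

section \<open>Lebesgue measure of Lipschitz images\<close>

text \<open>Subadditivity over any countable index set, by interchanging the integral with the one
  over counting measure.\<close>

lemma emeasure_UN_countable_le:
  assumes X[measurable]: "\<And>i. i \<in> I \<Longrightarrow> X i \<in> sets M" and I[simp]: "countable I"
  shows "emeasure M (\<Union>(X ` I)) \<le> (\<integral>\<^sup>+i. emeasure M (X i) \<partial>count_space I)"
proof -
  have le: "indicator (\<Union>(X ` I)) x \<le> (\<integral>\<^sup>+i. indicator (X i) x \<partial>count_space I)" for x
  proof (cases "x \<in> \<Union>(X ` I)")
    case True
    then obtain j where j: "j \<in> I" "x \<in> X j" by blast
    have "1 = (\<integral>\<^sup>+i. indicator {j} i \<partial>count_space I)"
      using j(1) by simp
    also have "\<dots> \<le> (\<integral>\<^sup>+i. indicator (X i) x \<partial>count_space I)"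
      using j by (intro nn_integral_mono) (auto split: split_indicator)
    finally show ?thesis using True by simp
  qed simp
  have [measurable]: "\<Union>(X ` I) \<in> sets M" by (intro sets.countable_UN'') auto
  have "emeasure M (\<Union>(X ` I)) = (\<integral>\<^sup>+x. indicator (\<Union>(X ` I)) x \<partial>M)" by simp
  also have "\<dots> \<le> (\<integral>\<^sup>+x. \<integral>\<^sup>+i. indicator (X i) x \<partial>count_space I \<partial>M)"
    by (intro nn_integral_mono le)
  also have "\<dots> = (\<integral>\<^sup>+i. \<integral>\<^sup>+x. indicator (X i) x \<partial>M \<partial>count_space I)"
    by (intro nn_integral_count_space_nn_integral) auto
  also have "\<dots> = (\<integral>\<^sup>+i. emeasure M (X i) \<partial>count_space I)"
    by (intro nn_integral_cong) auto
  finally show ?thesis .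
qed

text \<open>\<open>S\<close> is covered by nonoverlapping cubes inside \<open>G\<close>. Two points
  in a cube of side l are at most n l apart, so the image of the corresponding piece lies in a cube
  of side 2 L n l; hence the constant. \<open>T\<close> is a Borel subset of the image because the
  image itself may fail to be Borel.\<close>

lemma emeasure_lipschitz_image_le_open:
  fixes f :: "real ^ 'n \<Rightarrow> real ^ 'n"
  assumes lip: "L-lipschitz_on S f" and S: "S \<subseteq> cbox a b" and G: "open G" "S \<subseteq> G"
    and T: "T \<in> sets borel" "T \<subseteq> f ` S"
  shows "emeasure lborel T \<le> ennreal ((2 * L * CARD('n)) ^ CARD('n)) * emeasure lborel G"
proof -
  let ?n = "real CARD('n)"
  let ?K = "(2 * L * ?n) ^ CARD('n)"
  have L: "L \<ge> 0" using lip lipschitz_on_nonneg by blast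
  obtain r where r: "r > 0" "cbox a b \<subseteq> cball 0 r"
    using bounded_cbox[of a b] by (auto simp: bounded_pos subset_iff)
  \<comment> \<open>A cube encloses \<open>S\<close>, so that the boxes of
    \<open>covering_lemma\<close>, whose sides are those of the enclosing box divided by a power of
    two, are cubes as well.\<close>
  define a' b' :: "real ^ 'n" where "a' = (\<chi> i. - r)" and "b' = (\<chi> i. r)"
  have Sab: "S \<subseteq> cbox a' b'"
  proof
    fix x assume "x \<in> S"
    then have "norm x \<le> r" using S r by auto
    then have "\<bar>x $ i\<bar> \<le> r" for i using component_le_norm_cart[of x i] by linarith
    then show "x \<in> cbox a' b'" by (auto simp: mem_box_cart a'_def b'_def abs_le_iff minus_le_iff)
  qed
  have ne: "box a' b' \<noteq> {}" using r by (auto simp: interval_ne_empty_cart a'_def b'_def)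
  \<comment> \<open>This gauge forces every box tagged by a point of \<open>S\<close> into
    \<open>G\<close>.\<close>
  define \<gamma> where "\<gamma> x = (if x \<in> G then G else UNIV)" for x
  have \<gamma>: "gauge \<gamma>" using G(1) by (auto simp: gauge_def \<gamma>_def)
  obtain \<D> where \<D>: "countable \<D>" "\<Union>\<D> \<subseteq> cbox a' b'"
      "\<And>K. K \<in> \<D> \<Longrightarrow> interior K \<noteq> {} \<and> (\<exists>c d. K = cbox c d)"
      "pairwise (\<lambda>A B. interior A \<inter> interior B = {}) \<D>"
      "\<And>K. K \<in> \<D> \<Longrightarrow> \<exists>x \<in> S \<inter> K. K \<subseteq> \<gamma> x"
      "\<And>u v. cbox u v \<in> \<D> \<Longrightarrow> \<exists>n. \<forall>i \<in> Basis. v \<bullet> i - u \<bullet> i = (b' \<bullet> i - a' \<bullet> i) / 2^n"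
      "S \<subseteq> \<Union>\<D>"
    using covering_lemma[OF Sab ne \<gamma>] by metis
  have KO: "K \<subseteq> G" if "K \<in> \<D>" for K
    using \<D>(5)[OF that] G(2) by (force simp: \<gamma>_def)
  have ex_box: "\<exists>Q. Q \<in> sets borel \<and> f ` (S \<inter> K) \<subseteq> Q \<and> emeasure lborel Q \<le> ennreal ?K * emeasure lborel (interior K)"
    if K: "K \<in> \<D>" for K
  proof -
    obtain c d where cd: "K = cbox c d" "interior K \<noteq> {}" using \<D>(3)[OF K] by blast
    obtain m where m: "\<forall>i \<in> Basis. d \<bullet> i - c \<bullet> i = (b' \<bullet> i - a' \<bullet> i) / 2^m"
      using \<D>(6) K cd by blast
    define l where "l = 2 * r / 2 ^ m"
    have l: "l > 0" using r by (simp add: l_def)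
    have dc: "d $ i - c $ i = l" for i
      using m[rule_format, of "axis i 1"] by (simp add: axis_in_Basis_iff inner_axis a'_def b'_def l_def)
    obtain x where x: "x \<in> S" "x \<in> K" using \<D>(5)[OF K] by blast
    define Q where "Q = cbox (f x - (\<chi> i. L * ?n * l)) (f x + (\<chi> i. L * ?n * l))"
    have "f y \<in> Q" if y: "y \<in> S" "y \<in> K" for y
    proof -
      have "norm (y - x) \<le> (\<Sum>i\<in>UNIV. \<bar>(y - x) $ i\<bar>)" by (rule norm_le_l1_cart)
      also have "\<dots> \<le> (\<Sum>i\<in>(UNIV::'n set). l)"
      proof (rule sum_mono)
        fix i
        have "c $ i \<le> x $ i" "x $ i \<le> d $ i" "c $ i \<le> y $ i" "y $ i \<le> d $ i"
          using x y cd by (auto simp: mem_box_cart)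
        then show "\<bar>(y - x) $ i\<bar> \<le> l" using dc[of i] by auto
      qed
      also have "\<dots> = ?n * l" by simp
      finally have "norm (f y - f x) \<le> L * (?n * l)"
        using lipschitz_on_normD[OF lip y(1) x(1)] L by (meson mult_left_mono order_trans)
      then have "\<bar>(f y - f x) $ i\<bar> \<le> L * ?n * l" for i
        using component_le_norm_cart[of "f y - f x" i] by simp
      then have "\<bar>f y $ i - f x $ i\<bar> \<le> L * ?n * l" for i by simp
      then show ?thesis
        unfolding Q_def mem_box_cart by (simp add: abs_le_iff algebra_simps)
    qed
    moreover have "emeasure lborel Q = ennreal (\<Prod>i\<in>(Basis::(real^'n) set). 2 * L * ?n * l)"
    proof -
      define w :: "real ^ 'n" where "w = (\<chi> i. L * ?n * l)"
      have w: "w \<bullet> i = L * ?n * l" if "i \<in> Basis" for i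
        using that by (auto simp: Basis_vec_def inner_axis w_def)
      then have "emeasure lborel Q = ennreal (\<Prod>i\<in>Basis. (f x + w - (f x - w)) \<bullet> i)"
        unfolding Q_def w_def[symmetric] using L l
        by (intro emeasure_lborel_cbox) (simp add: inner_diff_left inner_add_left)
      also have "(\<Prod>i\<in>Basis. (f x + w - (f x - w)) \<bullet> i) = (\<Prod>i\<in>(Basis::(real^'n) set). 2 * L * ?n * l)"
        unfolding inner_diff_left inner_add_left using w by (intro prod.cong) auto
      finally show ?thesis .
    qed
    moreover have "(\<Prod>i\<in>(Basis::(real^'n) set). 2 * L * ?n * l) = ?K * l ^ CARD('n)"
      by (simp add: power_mult_distrib)
    moreover have "emeasure lborel (interior K) = ennreal (l ^ CARD('n))"
    proof -
      have dc': "(d - c) \<bullet> i = l" if "i \<in> Basis" for i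
        using that dc by (auto simp: Basis_vec_def inner_axis)
      then have "emeasure lborel (interior K) = ennreal (\<Prod>i\<in>Basis. (d - c) \<bullet> i)"
        unfolding cd(1) interior_cbox using l
        by (intro emeasure_lborel_box) (metis diff_ge_0_iff_ge inner_diff_left less_imp_le)
      also have "(\<Prod>i\<in>Basis. (d - c) \<bullet> i) = (\<Prod>i\<in>(Basis::(real^'n) set). l)"
        using dc' by (intro prod.cong) auto
      finally have "emeasure lborel (interior K) = ennreal (\<Prod>i\<in>(Basis::(real^'n) set). l)" .
      then show ?thesis by simp
    qed
    ultimately show ?thesis
      using L l by (intro exI[of _ Q]) (auto simp: ennreal_mult Q_def)
  qed
  define covers where "covers K Q \<longleftrightarrow> Q \<in> sets borel \<and> f ` (S \<inter> K) \<subseteq> Q \<and>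
      emeasure lborel Q \<le> ennreal ?K * emeasure lborel (interior K)" for K Q
  define Q where "Q K = (SOME Q. covers K Q)" for K
  have "covers K (Q K)" if "K \<in> \<D>" for K
    unfolding Q_def using ex_box[OF that] by (intro someI_ex[of "covers K"]) (simp add: covers_def)
  then have Q: "Q K \<in> sets borel" "f ` (S \<inter> K) \<subseteq> Q K"
      "emeasure lborel (Q K) \<le> ennreal ?K * emeasure lborel (interior K)" if "K \<in> \<D>" for K
    using that by (simp_all add: covers_def)
  have "T \<subseteq> (\<Union>K\<in>\<D>. Q K)"
  proof
    fix y assume "y \<in> T"
    then obtain x where x: "x \<in> S" "y = f x" using T(2) by auto
    then obtain K where K: "K \<in> \<D>" "x \<in> K" using \<D>(7) by auto
    then show "y \<in> (\<Union>K\<in>\<D>. Q K)" using Q(2)[OF K(1)] x by auto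
  qed
  then have "emeasure lborel T \<le> emeasure lborel (\<Union>K\<in>\<D>. Q K)"
    using Q(1) \<D>(1) by (intro emeasure_mono) auto
  also have "\<dots> \<le> (\<integral>\<^sup>+K. emeasure lborel (Q K) \<partial>count_space \<D>)"
    using Q(1) \<D>(1) by (intro emeasure_UN_countable_le) auto
  also have "\<dots> \<le> (\<integral>\<^sup>+K. ennreal ?K * emeasure lborel (interior K) \<partial>count_space \<D>)"
    using Q(3) by (intro nn_integral_mono) auto
  also have "\<dots> = ennreal ?K * (\<integral>\<^sup>+K. emeasure lborel (interior K) \<partial>count_space \<D>)"
    by (rule nn_integral_cmult) auto
  \<comment> \<open>The boxes overlap at most in their boundaries; their interiors are disjoint, so
    the volumes add up to at most that of \<open>G\<close>.\<close>
  also have "(\<integral>\<^sup>+K. emeasure lborel (interior K) \<partial>count_space \<D>) = emeasure lborel (\<Union>K\<in>\<D>. interior K)"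
    using \<D>(1,4) by (intro emeasure_UN_countable[symmetric]) (auto simp: disjoint_family_on_def pairwise_def)
  also have "\<dots> \<le> emeasure lborel G"
    using KO interior_subset G(1) by (intro emeasure_mono) fastforce+
  finally show ?thesis by (simp add: mult_left_mono)
qed

text \<open>Outer regularity: \<open>G\<close> is an open set containing \<open>S\<close> with
  arbitrarily small excess volume.\<close>

lemma emeasure_lipschitz_image_le:
  fixes f :: "real ^ 'n \<Rightarrow> real ^ 'n"
  assumes lip: "L-lipschitz_on S f" and S: "S \<in> sets borel" "bounded S"
    and T: "T \<in> sets borel" "T \<subseteq> f ` S"
  shows "emeasure lborel T \<le> ennreal ((2 * L * CARD('n)) ^ CARD('n)) * emeasure lborel S"
proof -
  let ?K = "ennreal ((2 * L * CARD('n)) ^ CARD('n))"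
  obtain a b where ab: "S \<subseteq> cbox a b" using S(2) bounded_subset_cbox_symmetric by metis
  have lm: "S \<in> lmeasurable"
    by (rule bounded_set_imp_lmeasurable[OF S(2)]) (use S(1) in auto)
  show ?thesis
  proof (rule ennreal_le_epsilon)
    fix e :: real assume "e > 0"
    \<comment> \<open>The summand 1 keeps the denominator positive when
      \<open>L = 0\<close>.\<close>
    define e' where "e' = e / ((2 * L * CARD('n)) ^ CARD('n) + 1)"
    have L: "L \<ge> 0" using lip lipschitz_on_nonneg by blast
    then have K: "(2 * L * CARD('n)) ^ CARD('n) \<ge> 0" by simp
    have e': "e' > 0" "(2 * L * CARD('n)) ^ CARD('n) * e' \<le> e"
      using \<open>e > 0\<close> K by (auto simp: e'_def field_simps add_nonneg_pos)
    obtain G where G: "open G" "S \<subseteq> G" "G - S \<in> lmeasurable" "emeasure lebesgue (G - S) < ennreal e'"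
      using sets_lebesgue_outer_open[OF fmeasurableD[OF lm] e'(1)] by metis
    have "emeasure lborel (G - S) < ennreal e'"
      using G(1,4) S(1) by simp
    moreover have "emeasure lborel G = emeasure lborel S + emeasure lborel (G - S)"
      using G(1,2) S(1) plus_emeasure[of S lborel "G - S"] by (auto simp: Un_absorb1)
    ultimately have "emeasure lborel G \<le> emeasure lborel S + ennreal e'"
      by (simp add: add_left_mono less_imp_le)
    have "emeasure lborel T \<le> ?K * emeasure lborel G"
      by (rule emeasure_lipschitz_image_le_open[OF lip ab G(1,2) T])
    also have "\<dots> \<le> ?K * (emeasure lborel S + ennreal e')"
      by (rule mult_left_mono) (fact, simp)
    also have "\<dots> = ?K * emeasure lborel S + ennreal ((2 * L * CARD('n)) ^ CARD('n) * e')"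
      using K e' by (simp add: distrib_left ennreal_mult)
    also have "\<dots> \<le> ?K * emeasure lborel S + ennreal e"
      using e' by (intro add_left_mono ennreal_leI)
    finally show "emeasure lborel T \<le> ?K * emeasure lborel S + ennreal e" .
  qed
qed

section \<open>The geodesic flow\<close>

lemma continuous_on_matrix_vector_mult:
  fixes M :: "'t::topological_space \<Rightarrow> real ^ 'm ^ 'm"
  assumes "\<And>i j. continuous_on S (\<lambda>p. M p $ i $ j)" "continuous_on S f"
  shows "continuous_on S (\<lambda>p. M p *v f p)"
  unfolding matrix_vector_mult_def
  by (intro continuous_on_vec_lambda continuous_on_sum continuous_on_mult continuous_on_component assms)

locale framed_manifold =
  fixes A :: "('x::{t2_space, second_countable_topology}, 'n::finite) chart set"
    and g :: "('x, 'n) metric_tensor"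
    and \<iota> :: "'x \<Rightarrow> real ^ 'n \<Rightarrow> ('x, 'n) tangent"
  assumes atlas: "smooth_atlas A" and metric: "riemannian_metric A g"
    and complete: "geodesically_complete A g" and frame: "smooth_frame A \<iota>"
begin

lemma atlas_cover: "\<exists>c\<in>A. x \<in> chart_dom c"
  using atlas unfolding smooth_atlas_def by blast

lemma frame_linear: "linear (\<lambda>u. \<iota> x u c)"
  using frame unfolding smooth_frame_def by blast

lemma frame_in_tangent_space: "\<iota> x u \<in> tangent_space A x"
  using frame unfolding smooth_frame_def bij_betw_def by blast

lemma frame_inj: "inj (\<iota> x)"
  using frame unfolding smooth_frame_def bij_betw_def by blast

context
  fixes c assumes c: "c \<in> A"
begin

lemma open_chart_dom: "open (chart_dom c)" and open_chart_img: "open (chart_img c)"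
  and chart_homeomorphism: "homeomorphism (chart_dom c) (chart_img c) (chart_map c) (chart_inv c)"
  using atlas c unfolding smooth_atlas_def by auto

lemma chart_inv_map: "x \<in> chart_dom c \<Longrightarrow> chart_inv c (chart_map c x) = x"
  and chart_map_inv: "z \<in> chart_img c \<Longrightarrow> chart_map c (chart_inv c z) = z"
  and chart_map_in_img: "x \<in> chart_dom c \<Longrightarrow> chart_map c x \<in> chart_img c"
  and chart_inv_in_dom: "z \<in> chart_img c \<Longrightarrow> chart_inv c z \<in> chart_dom c"
  and continuous_on_chart_map: "continuous_on (chart_dom c) (chart_map c)"
  and continuous_on_chart_inv: "continuous_on (chart_img c) (chart_inv c)"
  using chart_homeomorphism by (auto simp: homeomorphism_def)

text \<open>From this the frame is injective in each single chart, and its matrix there is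
  invertible.\<close>

lemma tangent_space_eq_tangent_of:
  assumes w: "w \<in> tangent_space A x" and x: "x \<in> chart_dom c"
  shows "w = tangent_of A c x (w c)"
proof
  fix d
  show "w d = tangent_of A c x (w c) d"
  proof (cases "d \<in> A \<and> x \<in> chart_dom d")
    case True
    then have "w d = coord_change c d x (w c)"
      using w x c unfolding tangent_space_def by blast
    then show ?thesis using True by (simp add: tangent_of_def)
  next
    case False
    then have "w d = 0" using w unfolding tangent_space_def by blast
    then show ?thesis using False by (simp only: tangent_of_def if_False)
  qed
qed

lemma frame_chart_inj:
  assumes x: "x \<in> chart_dom c"
  shows "inj (\<lambda>u. \<iota> x u c)"
proof (rule injI)
  fix u v assume eq: "\<iota> x u c = \<iota> x v c"
  have "\<iota> x u = tangent_of A c x (\<iota> x u c)"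
    by (rule tangent_space_eq_tangent_of[OF frame_in_tangent_space x])
  also have "\<dots> = tangent_of A c x (\<iota> x v c)" by (simp add: eq)
  also have "\<dots> = \<iota> x v"
    by (rule tangent_space_eq_tangent_of[OF frame_in_tangent_space x, symmetric])
  finally show "u = v" using frame_inj by (simp add: inj_eq)
qed

text \<open>Converts frame coordinates, in which the innovations are given, into coordinates of the
  chart \<open>c\<close>.\<close>

definition frame_matrix :: "real ^ 'n \<Rightarrow> real ^ 'n ^ 'n" where
  "frame_matrix z = matrix (\<lambda>u. \<iota> (chart_inv c z) u c)"

lemma frame_matrix_mult: "frame_matrix z *v u = \<iota> (chart_inv c z) u c"
  unfolding frame_matrix_def by (rule matrix_works[OF frame_linear[folded linear_matrix_vector_mul_eq]])

lemma frame_matrix_invertible: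
  assumes "z \<in> chart_img c"
  shows "invertible (frame_matrix z)"
proof -
  have "inj ((*v) (frame_matrix z))"
    using frame_chart_inj[OF chart_inv_in_dom[OF assms]] frame_matrix_mult[of z]
    by (simp add: inj_def)
  then show ?thesis
    using matrix_left_invertible_injective invertible_left_inverse by blast
qed

lemma frame_matrix_inv:
  assumes "z \<in> chart_img c"
  shows "frame_matrix z *v (matrix_inv (frame_matrix z) *v v) = v"
    and "matrix_inv (frame_matrix z) *v (frame_matrix z *v v) = v"
proof -
  have "frame_matrix z ** matrix_inv (frame_matrix z) = mat 1 \<and> matrix_inv (frame_matrix z) ** frame_matrix z = mat 1"
    using someI_ex[OF frame_matrix_invertible[OF assms, unfolded invertible_def]]
    unfolding matrix_inv_def by blast
  then show "frame_matrix z *v (matrix_inv (frame_matrix z) *v v) = v"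
    and "matrix_inv (frame_matrix z) *v (frame_matrix z *v v) = v"
    by (simp_all add: matrix_vector_mul_assoc)
qed

lemma loclip_on_frame_matrix: "loclip_on (chart_img c) (\<lambda>z. frame_matrix z $ i $ j)"
proof -
  have "smooth_on (chart_img c) (\<lambda>z. \<iota> (chart_inv c z) (axis j 1) c)"
    using frame c unfolding smooth_frame_def by blast
  then have "loclip_on (chart_img c) (\<lambda>z. \<iota> (chart_inv c z) (axis j 1) c)"
    by (rule smooth_on_loclip_on[OF _ open_chart_img])
  then have "loclip_on (chart_img c) (\<lambda>z. \<iota> (chart_inv c z) (axis j 1) c $ i)"
    by (rule loclip_on_component)
  then show ?thesis by (simp add: frame_matrix_def matrix_def)
qed

lemma loclip_on_frame_matrix_inv: "loclip_on (chart_img c) (\<lambda>z. matrix_inv (frame_matrix z) $ i $ j)"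
  by (intro loclip_on_matrix_inv loclip_on_frame_matrix frame_matrix_invertible)

text \<open>The metric is controlled on tangent spaces only. Frame coordinates turn it into an inner
  product \<open>b\<close> on \<open>real ^ 'n\<close>; with \<open>J\<close>, the change from chart
  to frame coordinates, the quadratic form of the metric matrix is
  \<open>b (J v) (J v)\<close>.\<close>

lemma metric_matrix_pos:
  assumes z: "z \<in> chart_img c" and v: "v \<noteq> 0"
  shows "v \<bullet> (metric_matrix A g c z *v v) > 0"
proof -
  define x where "x = chart_inv c z"
  have x: "x \<in> chart_dom c" using chart_inv_in_dom[OF z] by (simp add: x_def)
  define J where "J v = matrix_inv (frame_matrix z) *v v" for v
  have J: "\<iota> x (J v) c = v" for v
    using frame_matrix_inv(1)[OF z, of v] by (simp add: frame_matrix_mult x_def J_def)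
  define b where "b u u' = g x (\<iota> x u) (\<iota> x u')" for u u'
  have add: "\<iota> x (u + u') = (\<lambda>d. \<iota> x u d + \<iota> x u' d)" and scale: "\<iota> x (a *\<^sub>R u) = (\<lambda>d. a *\<^sub>R \<iota> x u d)" for u u' a
    by (simp_all add: fun_eq_iff linear_add[OF frame_linear] linear_scale[OF frame_linear])
  have sym: "b u u' = b u' u" for u u'
    using metric frame_in_tangent_space unfolding riemannian_metric_def b_def by blast
  have lin1: "linear (\<lambda>u. b u u')" for u'
    using metric frame_in_tangent_space unfolding riemannian_metric_def b_def
    by (intro linearI) (simp_all add: add scale)
  then have lin2: "linear (\<lambda>u'. b u u')" for u using sym[of u] by simp
  have tang: "tangent_of A c x v = \<iota> x (J v)" for v
    using tangent_space_eq_tangent_of[OF frame_in_tangent_space x, of "J v"] J by simp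
  have linJ: "linear J" unfolding J_def by (rule matrix_vector_mul_linear)
  have G: "metric_matrix A g c z $ i $ j = b (J (axis i 1)) (J (axis j 1))" for i j
    by (simp add: metric_matrix_def b_def tang x_def[symmetric])
  have v_eq: "v = (\<Sum>i\<in>UNIV. v $ i *\<^sub>R axis i 1)"
    by (simp add: vec_eq_iff axis_def if_distrib cong: if_cong)
  have Jv: "J v = (\<Sum>i\<in>UNIV. v $ i *\<^sub>R J (axis i 1))"
    by (subst v_eq) (simp add: linear_sum[OF linJ] linear_scale[OF linJ])
  have "v \<bullet> (metric_matrix A g c z *v v) = (\<Sum>i\<in>UNIV. v $ i * (\<Sum>j\<in>UNIV. v $ j * b (J (axis i 1)) (J (axis j 1))))"
    by (simp add: inner_vec_def matrix_vector_mult_def G mult.commute)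
  also have "\<dots> = (\<Sum>i\<in>UNIV. v $ i * b (J (axis i 1)) (J v))"
    by (simp add: Jv linear_sum[OF lin2] linear_scale[OF lin2])
  also have "\<dots> = b (J v) (J v)"
    by (subst (2) Jv) (simp add: linear_sum[OF lin1] linear_scale[OF lin1])
  also have "\<dots> > 0"
  proof -
    have "\<iota> x (J v) \<noteq> (\<lambda>d. 0)" using J[of v] v by auto
    then show ?thesis
      using metric frame_in_tangent_space unfolding riemannian_metric_def b_def by blast
  qed
  finally show ?thesis .
qed

lemma metric_matrix_invertible:
  assumes "z \<in> chart_img c"
  shows "invertible (metric_matrix A g c z)"
proof -
  have "\<forall>v. metric_matrix A g c z *v v = 0 \<longrightarrow> v = 0"
    using metric_matrix_pos[OF assms] by fastforce
  then show ?thesis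
    using matrix_left_invertible_ker invertible_left_inverse by blast
qed

lemma loclip_on_christoffel: "loclip_on (chart_img c) (christoffel A g c k i j)"
proof -
  have sm: "smooth_on (chart_img c) (\<lambda>z. metric_matrix A g c z $ i $ j)" for i j
    using metric c unfolding riemannian_metric_def by blast
  have "loclip_on (chart_img c) (partial_deriv i (\<lambda>y. metric_matrix A g c y $ j $ l))" for i j l
    unfolding partial_deriv_def
    by (rule smooth_on_loclip_on[OF smooth_on_frechet_derivative[OF sm] open_chart_img])
  moreover have "loclip_on (chart_img c) (\<lambda>z. matrix_inv (metric_matrix A g c z) $ i $ j)" for i j
    by (intro loclip_on_matrix_inv metric_matrix_invertible smooth_on_loclip_on[OF sm open_chart_img])
  ultimately have "loclip_on (chart_img c) (\<lambda>z. christoffel A g c k i j z)"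
    unfolding christoffel_def
    by (intro loclip_on_mult loclip_on_sum loclip_on_add loclip_on_diff loclip_on_const)
  then show ?thesis by simp
qed

end

section \<open>The geodesic equation as a first-order system\<close>

definition geodesic_acceleration :: "('x, 'n) chart \<Rightarrow> real ^ 'n \<Rightarrow> real ^ 'n \<Rightarrow> real ^ 'n" where
  "geodesic_acceleration c z v =
     (\<chi> k. - (\<Sum>i\<in>UNIV. \<Sum>j\<in>UNIV. christoffel A g c k i j z * v $ i * v $ j))"

definition geodesic_field :: "('x, 'n) chart \<Rightarrow> (real ^ 'n) \<times> (real ^ 'n) \<Rightarrow> (real ^ 'n) \<times> (real ^ 'n)" where
  "geodesic_field c p = (snd p, geodesic_acceleration c (fst p) (snd p))"

text \<open>States carry the velocity in frame coordinates, while the geodesic equation is written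
  in chart coordinates; this chart of the tangent bundle performs the change.\<close>

definition bundle_chart :: "('x, 'n) chart \<Rightarrow> 'x \<times> (real ^ 'n) \<Rightarrow> (real ^ 'n) \<times> (real ^ 'n)" where
  "bundle_chart c p = (chart_map c (fst p), \<iota> (fst p) (snd p) c)"

definition bundle_chart_inv :: "('x, 'n) chart \<Rightarrow> (real ^ 'n) \<times> (real ^ 'n) \<Rightarrow> 'x \<times> (real ^ 'n)" where
  "bundle_chart_inv c p = (chart_inv c (fst p), matrix_inv (frame_matrix c (fst p)) *v snd p)"

lemma loclip_on_geodesic_field:
  assumes c: "c \<in> A"
  shows "loclip_on (chart_img c \<times> UNIV) (geodesic_field c)"
proof -
  let ?S = "chart_img c \<times> (UNIV :: (real ^ 'n) set)"
  have fst: "loclip_on ?S (\<lambda>p. fst p)" and snd: "loclip_on ?S (\<lambda>p. snd p)"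
    by (intro loclip_on_bounded_linear bounded_linear_fst bounded_linear_snd)+
  have \<Gamma>: "loclip_on ?S (\<lambda>p. christoffel A g c k i j (fst p))" for k i j
    by (rule loclip_on_compose[OF fst loclip_on_christoffel[OF c]]) auto
  have v: "loclip_on ?S (\<lambda>p. snd p $ i)" for i
    by (rule loclip_on_bounded_linear) (auto intro: bounded_linear_compose[OF bounded_linear_vec_nth bounded_linear_snd])
  have "loclip_on ?S (\<lambda>p. (snd p, geodesic_acceleration c (fst p) (snd p)))"
    unfolding geodesic_acceleration_def
    by (intro loclip_on_Pair snd loclip_on_vec loclip_on_minus loclip_on_sum loclip_on_mult \<Gamma> v)
  then show ?thesis by (simp add: geodesic_field_def[abs_def])
qed

lemma bundle_chart_image:
  assumes c: "c \<in> A"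
  shows "bundle_chart c ` (chart_dom c \<times> UNIV) = chart_img c \<times> UNIV"
proof
  show "bundle_chart c ` (chart_dom c \<times> UNIV) \<subseteq> chart_img c \<times> UNIV"
    using chart_map_in_img[OF c] by (auto simp: bundle_chart_def)
  show "chart_img c \<times> UNIV \<subseteq> bundle_chart c ` (chart_dom c \<times> UNIV)"
  proof
    fix p assume "p \<in> chart_img c \<times> (UNIV :: (real ^ 'n) set)"
    then have p: "fst p \<in> chart_img c" by auto
    then have "bundle_chart c (bundle_chart_inv c p) = p" "bundle_chart_inv c p \<in> chart_dom c \<times> UNIV"
      using frame_matrix_inv(1)[OF c p, of "snd p"]
      by (auto simp: bundle_chart_def bundle_chart_inv_def chart_map_inv[OF c] chart_inv_in_dom[OF c] frame_matrix_mult[OF c])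
    then show "p \<in> bundle_chart c ` (chart_dom c \<times> UNIV)" by (metis imageI)
  qed
qed

lemma bundle_chart_homeomorphism:
  assumes c: "c \<in> A"
  shows "homeomorphism (chart_dom c \<times> UNIV) (bundle_chart c ` (chart_dom c \<times> UNIV)) (bundle_chart c) (bundle_chart_inv c)"
  unfolding bundle_chart_image[OF c]
proof (rule homeomorphismI)
  have cz: "continuous_on (chart_dom c \<times> (UNIV :: (real ^ 'n) set)) (\<lambda>p. chart_map c (fst p))"
    by (rule continuous_on_compose2[OF continuous_on_chart_map[OF c]]) (auto intro: continuous_intros)
  have "continuous_on (chart_dom c \<times> (UNIV :: (real ^ 'n) set)) (\<lambda>p. frame_matrix c (chart_map c (fst p)) $ i $ j)" for i j
    by (rule continuous_on_compose2[OF loclip_on_continuous_on[OF loclip_on_frame_matrix[OF c]] cz])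
      (auto intro: chart_map_in_img[OF c])
  then have "continuous_on (chart_dom c \<times> UNIV) (\<lambda>p. (chart_map c (fst p), frame_matrix c (chart_map c (fst p)) *v snd p))"
    by (intro continuous_on_Pair cz continuous_on_matrix_vector_mult continuous_on_snd continuous_on_id)
  then show "continuous_on (chart_dom c \<times> UNIV) (bundle_chart c)"
    by (rule continuous_on_eq) (auto simp: bundle_chart_def frame_matrix_mult[OF c] chart_inv_map[OF c])
  have "continuous_on (chart_img c \<times> (UNIV :: (real ^ 'n) set)) (\<lambda>p. matrix_inv (frame_matrix c (fst p)) $ i $ j)" for i j
    by (rule continuous_on_compose2[OF loclip_on_continuous_on[OF loclip_on_frame_matrix_inv[OF c]]])
      (auto intro: continuous_intros)
  moreover have "continuous_on (chart_img c \<times> (UNIV :: (real ^ 'n) set)) (\<lambda>p. chart_inv c (fst p))"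
    by (rule continuous_on_compose2[OF continuous_on_chart_inv[OF c]]) (auto intro: continuous_intros)
  ultimately show "continuous_on (chart_img c \<times> UNIV) (bundle_chart_inv c)"
    unfolding bundle_chart_inv_def
    by (intro continuous_on_Pair continuous_on_matrix_vector_mult continuous_on_snd continuous_on_id)
  show "bundle_chart c ` (chart_dom c \<times> UNIV) \<subseteq> chart_img c \<times> UNIV" by (simp add: bundle_chart_image[OF c])
  show "bundle_chart_inv c ` (chart_img c \<times> UNIV) \<subseteq> chart_dom c \<times> UNIV"
    using chart_inv_in_dom[OF c] by (auto simp: bundle_chart_inv_def)
  show "bundle_chart_inv c (bundle_chart c p) = p" if "p \<in> chart_dom c \<times> UNIV" for p
  proof -
    have p: "fst p \<in> chart_dom c" using that by auto
    then show ?thesis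
      using frame_matrix_inv(2)[OF c chart_map_in_img[OF c p], of "snd p"]
      by (simp add: bundle_chart_def bundle_chart_inv_def chart_inv_map[OF c] frame_matrix_mult[OF c])
  qed
  show "bundle_chart c (bundle_chart_inv c p) = p" if "p \<in> chart_img c \<times> UNIV" for p
  proof -
    have p: "fst p \<in> chart_img c" using that by auto
    then show ?thesis
      using frame_matrix_inv(1)[OF c p, of "snd p"]
      by (simp add: bundle_chart_def bundle_chart_inv_def chart_map_inv[OF c] frame_matrix_mult[OF c])
  qed
qed

sublocale charted_flow A "\<lambda>c. chart_dom c \<times> UNIV" bundle_chart bundle_chart_inv geodesic_field
proof
  show "\<exists>c\<in>A. y \<in> chart_dom c \<times> UNIV" for y :: "'x \<times> (real ^ 'n)"
    using atlas_cover[of "fst y"] by (cases y) auto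
  fix c assume c: "c \<in> A"
  show "open (chart_dom c \<times> (UNIV :: (real ^ 'n) set))"
    by (intro open_Times open_chart_dom[OF c]) simp
  show op: "open (bundle_chart c ` (chart_dom c \<times> UNIV))"
    unfolding bundle_chart_image[OF c] by (intro open_Times open_chart_img[OF c]) simp
  show "homeomorphism (chart_dom c \<times> UNIV) (bundle_chart c ` (chart_dom c \<times> UNIV)) (bundle_chart c) (bundle_chart_inv c)"
    by (rule bundle_chart_homeomorphism[OF c])
  fix z assume z: "z \<in> bundle_chart c ` (chart_dom c \<times> UNIV)"
  obtain r where r: "r > 0" "cball z r \<subseteq> bundle_chart c ` (chart_dom c \<times> UNIV)"
    using op z open_contains_cball by blast
  obtain q L where q: "q > 0" "\<And>r'. r' \<le> q \<Longrightarrow> L-lipschitz_on (ball z r' \<inter> chart_img c \<times> UNIV) (geodesic_field c)"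
    using loclip_onE[OF loclip_on_geodesic_field[OF c]] z unfolding bundle_chart_image[OF c] by metis
  \<comment> \<open>\<open>r\<close> keeps the closed ball in the chart image, and
    \<open>q / 2\<close> puts it inside the open ball on which the field is Lipschitz.\<close>
  have "cball z (min r (q / 2)) \<subseteq> ball z q \<inter> chart_img c \<times> UNIV"
    using r q(1) unfolding bundle_chart_image[OF c] by (auto simp: subset_iff)
  then have "L-lipschitz_on (cball z (min r (q / 2))) (geodesic_field c)"
    by (rule lipschitz_on_subset[OF q(2)[OF order_refl]])
  then show "\<exists>R>0. \<exists>L. cball z R \<subseteq> bundle_chart c ` (chart_dom c \<times> UNIV) \<and> L-lipschitz_on (cball z R) (geodesic_field c)"
    using r q(1) by (intro exI[of _ "min r (q / 2)"] conjI exI[of _ L]) (auto simp: subset_iff)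
qed

section \<open>Geodesics as integral curves, and the exponential map\<close>

lemma geodesic_velocity_in_tangent_space:
  assumes \<sigma>: "geodesic A g \<sigma>"
  shows "velocity A \<sigma> t \<in> tangent_space A (\<sigma> t)"
proof -
  have "velocity A \<sigma> t d = coord_change c d (\<sigma> t) (velocity A \<sigma> t c)"
    if c: "c \<in> A" "\<sigma> t \<in> chart_dom c" and d: "d \<in> A" "\<sigma> t \<in> chart_dom d" for c d
  proof -
    let ?z = "\<lambda>\<tau>. chart_map c (\<sigma> \<tau>)" and ?T = "chart_map d \<circ> chart_inv c"
    have "?z differentiable (at t)" using \<sigma> c by (simp add: geodesic_def)
    then have z: "(?z has_vector_derivative vector_derivative ?z (at t)) (at t)"
      by (simp add: vector_derivative_works)
    have "smooth_on (chart_map c ` (chart_dom c \<inter> chart_dom d)) ?T"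
      using atlas c d unfolding smooth_atlas_def by blast
    then have "?T differentiable (at (?z t))" using c d by (intro smooth_on_differentiable) auto
    then have T: "(?T has_derivative coord_change c d (\<sigma> t)) (at (?z t))"
      unfolding coord_change_def by (simp add: frechet_derivative_works)
    \<comment> \<open>The composition agrees with the curve in the chart \<open>d\<close> only while
      the curve stays in the domain of \<open>c\<close>; hence the transfer on an open set of
      times.\<close>
    have "((?T \<circ> ?z) has_vector_derivative coord_change c d (\<sigma> t) (vector_derivative ?z (at t))) (at t)"
      using vector_derivative_diff_chain_within[OF z] T has_derivative_at_withinI by blast
    moreover have "open (\<sigma> -` chart_dom c)"
      using \<sigma> open_chart_dom[OF c(1)] unfolding geodesic_def
      by (intro continuous_open_vimage) (auto simp: continuous_on_eq_continuous_at)
    ultimately have "((\<lambda>\<tau>. chart_map d (\<sigma> \<tau>)) has_vector_derivative coord_change c d (\<sigma> t) (vector_derivative ?z (at t))) (at t)"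
      by (rule has_vector_derivative_transform_within_open) (use c in \<open>auto simp: chart_inv_map\<close>)
    then show ?thesis
      using c d by (simp add: velocity_def vector_derivative_at)
  qed
  moreover have "velocity A \<sigma> t c = 0" if "\<not> (c \<in> A \<and> \<sigma> t \<in> chart_dom c)" for c
    using that by (simp only: velocity_def if_False)
  ultimately show ?thesis unfolding tangent_space_def by blast
qed

definition geodesic_lift :: "(real \<Rightarrow> 'x) \<Rightarrow> real \<Rightarrow> 'x \<times> (real ^ 'n)" where
  "geodesic_lift \<sigma> t = (\<sigma> t, inv_into UNIV (\<iota> (\<sigma> t)) (velocity A \<sigma> t))"

text \<open>In a bundle chart the lift is the pair of position and velocity, and its derivative is
  the geodesic equation. Continuity of the lift, whose second component is in frame coordinates, is
  recovered through the inverse chart.\<close>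

lemma integral_curve_geodesic_lift:
  assumes \<sigma>: "geodesic A g \<sigma>"
  shows "integral_curve (geodesic_lift \<sigma>)"
proof -
  let ?Y = "geodesic_lift \<sigma>"
  have lift: "\<iota> (\<sigma> t) (snd (?Y t)) = velocity A \<sigma> t" for t
  proof -
    have "velocity A \<sigma> t \<in> range (\<iota> (\<sigma> t))"
      using frame geodesic_velocity_in_tangent_space[OF \<sigma>] unfolding smooth_frame_def bij_betw_def by blast
    then show ?thesis by (simp add: geodesic_lift_def f_inv_into_f)
  qed
  have fst_lift: "fst (?Y t) = \<sigma> t" for t by (simp add: geodesic_lift_def)
  have deriv: "((\<lambda>\<tau>. bundle_chart c (?Y \<tau>)) has_vector_derivative geodesic_field c (bundle_chart c (?Y t))) (at t)"
    if c: "c \<in> A" "\<sigma> t \<in> chart_dom c" for c t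
  proof -
    let ?z = "\<lambda>\<tau>. chart_map c (\<sigma> \<tau>)"
    have vel: "velocity A \<sigma> t c = vector_derivative ?z (at t)" using c by (simp add: velocity_def)
    have "?z differentiable (at t)" using \<sigma> c by (simp add: geodesic_def)
    then have z: "(?z has_vector_derivative velocity A \<sigma> t c) (at t)"
      by (simp add: vector_derivative_works vel)
    have v: "((\<lambda>\<tau>. vector_derivative ?z (at \<tau>)) has_vector_derivative
        geodesic_acceleration c (?z t) (velocity A \<sigma> t c)) (at t)"
      using \<sigma> c by (simp add: geodesic_def geodesic_acceleration_def)
    have "((\<lambda>\<tau>. (?z \<tau>, vector_derivative ?z (at \<tau>))) has_vector_derivative
        (velocity A \<sigma> t c, geodesic_acceleration c (?z t) (velocity A \<sigma> t c))) (at t)"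
      by (rule has_vector_derivative_Pair[OF z v])
    moreover have "open (\<sigma> -` chart_dom c)"
      using \<sigma> open_chart_dom[OF c(1)] unfolding geodesic_def
      by (intro continuous_open_vimage) (auto simp: continuous_on_eq_continuous_at)
    ultimately have "((\<lambda>\<tau>. bundle_chart c (?Y \<tau>)) has_vector_derivative
        (velocity A \<sigma> t c, geodesic_acceleration c (?z t) (velocity A \<sigma> t c))) (at t)"
      by (rule has_vector_derivative_transform_within_open)
        (use c in \<open>auto simp: bundle_chart_def lift fst_lift velocity_def\<close>)
    then show ?thesis by (simp add: geodesic_field_def bundle_chart_def lift fst_lift)
  qed
  have "isCont ?Y t" for t
  proof -
    obtain c where c: "c \<in> A" "\<sigma> t \<in> chart_dom c" using atlas_cover by blast
    have "isCont (\<lambda>\<tau>. bundle_chart c (?Y \<tau>)) t"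
      using deriv[OF c] has_vector_derivative_continuous by blast
    moreover have dom: "?Y t \<in> chart_dom c \<times> UNIV" using c by (simp add: geodesic_lift_def)
    ultimately have "isCont (\<lambda>\<tau>. bundle_chart_inv c (bundle_chart c (?Y \<tau>))) t"
      by (intro isCont_o2[where f="\<lambda>\<tau>. bundle_chart c (?Y \<tau>)" and g="bundle_chart_inv c"] isCont_inv[OF c(1)]) auto
    moreover have "open (\<sigma> -` chart_dom c)"
      using \<sigma> open_chart_dom[OF c(1)] unfolding geodesic_def
      by (intro continuous_open_vimage) (auto simp: continuous_on_eq_continuous_at)
    then have ev: "\<forall>\<^sub>F \<tau> in nhds t. bundle_chart_inv c (bundle_chart c (?Y \<tau>)) = ?Y \<tau>"
      unfolding eventually_nhds using c inv_dom[OF c(1)]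
      by (intro exI[of _ "\<sigma> -` chart_dom c"]) (auto simp: geodesic_lift_def)
    ultimately show ?thesis using isCont_cong[OF ev] by simp
  qed
  then show ?thesis
    unfolding integral_curve_def using deriv
    by (auto simp: continuous_on_eq_continuous_at mem_Times_iff fst_lift)
qed

lemma geodesic_lift_0:
  assumes "\<sigma> 0 = x" "velocity A \<sigma> 0 = \<iota> x u"
  shows "geodesic_lift \<sigma> 0 = (x, u)"
proof -
  show ?thesis using assms by (simp add: geodesic_lift_def inv_f_f[OF frame_inj])
qed

lemma geodesic_exists: "\<exists>\<sigma>. geodesic A g \<sigma> \<and> \<sigma> 0 = x \<and> velocity A \<sigma> 0 = \<iota> x u"
  using complete atlas_cover[of x] frame_in_tangent_space unfolding geodesically_complete_def by blast

sublocale complete_charted_flow A "\<lambda>c. chart_dom c \<times> UNIV" bundle_chart bundle_chart_inv geodesic_field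
proof
  fix y :: "'x \<times> (real ^ 'n)"
  obtain \<sigma> where \<sigma>: "geodesic A g \<sigma>" "\<sigma> 0 = fst y" "velocity A \<sigma> 0 = \<iota> (fst y) (snd y)"
    using geodesic_exists by blast
  then show "\<exists>Y. integral_curve Y \<and> Y 0 = y"
    using integral_curve_geodesic_lift[OF \<sigma>(1)] geodesic_lift_0[OF \<sigma>(2,3)] by auto
qed

text \<open>\<open>Exp\<close> is a definite description; uniqueness of integral curves shows that
  all geodesics with the given initial data share their endpoint.\<close>

lemma Exp_eq_flow: "Exp A g x (\<iota> x u) = fst (flow 1 (x, u))"
proof -
  have eq: "\<sigma> 1 = fst (flow 1 (x, u))"
    if \<sigma>: "geodesic A g \<sigma>" "\<sigma> 0 = x" "velocity A \<sigma> 0 = \<iota> x u" for \<sigma>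
    using flow_unique[OF integral_curve_geodesic_lift[OF \<sigma>(1)], of 1] geodesic_lift_0[OF \<sigma>(2,3)]
    by (metis fst_conv geodesic_lift_def zero_le_one)
  show ?thesis
    unfolding Exp_def
  proof (rule the_equality)
    obtain \<sigma> where \<sigma>: "geodesic A g \<sigma>" "\<sigma> 0 = x" "velocity A \<sigma> 0 = \<iota> x u"
      using geodesic_exists by blast
    then show "\<exists>\<sigma>. geodesic A g \<sigma> \<and> \<sigma> 0 = x \<and> velocity A \<sigma> 0 = \<iota> x u \<and> fst (flow 1 (x, u)) = \<sigma> 1"
      using eq[OF \<sigma>] by (intro exI[of _ \<sigma>]) simp
  next
    fix y assume "\<exists>\<sigma>. geodesic A g \<sigma> \<and> \<sigma> 0 = x \<and> velocity A \<sigma> 0 = \<iota> x u \<and> y = \<sigma> 1"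
    then show "y = fst (flow 1 (x, u))" using eq by (elim exE conjE) simp
  qed
qed

text \<open>Points of the zero section are at rest; short geodesics are compared with these rest
  points.\<close>

lemma integral_curve_constant: "integral_curve (\<lambda>_. (x, 0))"
  unfolding integral_curve_def
proof (intro conjI ballI allI impI continuous_on_const)
  fix c assume "c \<in> A"
  have "\<iota> x 0 c = 0" by (rule linear_0[OF frame_linear])
  then have "geodesic_field c (bundle_chart c (x, 0)) = 0"
    by (simp add: geodesic_field_def geodesic_acceleration_def bundle_chart_def zero_prod_def vec_eq_iff)
  then show "((\<lambda>\<tau>. bundle_chart c (x, 0)) has_vector_derivative geodesic_field c (bundle_chart c (x, 0))) (at t)" for t
    by simp
qed

end

section \<open>Minorization by short geodesics\<close>

lemma norm_diff_le_vector_derivative_bound: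
  fixes f :: "real \<Rightarrow> 'e::real_normed_vector"
  assumes f: "\<And>t. 0 \<le> t \<Longrightarrow> t \<le> 1 \<Longrightarrow> (f has_vector_derivative f' t) (at t) \<and> norm (f' t) \<le> B"
    and t: "0 \<le> t" "t \<le> 1"
  shows "norm (f t - f 0) \<le> B"
proof -
  have B: "B \<ge> 0" by (rule order.trans[OF norm_ge_zero f[of 0, THEN conjunct2]]) auto
  have "norm (f t - f 0) \<le> B * norm (t - 0)"
  proof (rule differentiable_bound[of "{0..1}" f "\<lambda>t x. x *\<^sub>R f' t" B t 0])
    fix r :: real assume "r \<in> {0..1}"
    then have r: "(f has_vector_derivative f' r) (at r)" "norm (f' r) \<le> B" using f by auto
    show "(f has_derivative (\<lambda>x. x *\<^sub>R f' r)) (at r within {0..1})"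
      using r(1) unfolding has_vector_derivative_def by (rule has_derivative_at_withinI)
    show "onorm (\<lambda>x. x *\<^sub>R f' r) \<le> B"
      using r(2) by (intro onorm_le) (simp add: mult.commute[of B] mult_left_mono)
  qed (use t in auto)
  also have "\<dots> \<le> B" using t B by (simp add: mult_left_le)
  finally show ?thesis .
qed

lemma norm_fst_le_norm: "norm (fst p) \<le> norm p" and norm_snd_le_norm: "norm (snd p) \<le> norm p"
  by (cases p; simp add: norm_fst_le norm_snd_le)+

lemma matrix_vector_mult_norm_le:
  fixes M :: "real ^ 'n ^ 'm"
  shows "norm (M *v v) \<le> (\<Sum>i\<in>UNIV. \<Sum>j\<in>UNIV. \<bar>M $ i $ j\<bar>) * norm v"
proof -
  have "norm (M *v v) \<le> (\<Sum>i\<in>UNIV. \<bar>(M *v v) $ i\<bar>)" by (rule norm_le_l1_cart)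
  also have "\<dots> \<le> (\<Sum>i\<in>UNIV. \<Sum>j\<in>UNIV. \<bar>M $ i $ j\<bar> * norm v)"
  proof (rule sum_mono)
    fix i
    have "\<bar>(M *v v) $ i\<bar> \<le> (\<Sum>j\<in>UNIV. \<bar>M $ i $ j * v $ j\<bar>)"
      by (simp add: matrix_vector_mult_def sum_abs)
    also have "\<dots> \<le> (\<Sum>j\<in>UNIV. \<bar>M $ i $ j\<bar> * norm v)"
      using component_le_norm_cart[of v] by (intro sum_mono) (simp add: abs_mult mult_left_mono)
    finally show "\<bar>(M *v v) $ i\<bar> \<le> (\<Sum>j\<in>UNIV. \<bar>M $ i $ j\<bar> * norm v)" .
  qed
  also have "\<dots> = (\<Sum>i\<in>UNIV. \<Sum>j\<in>UNIV. \<bar>M $ i $ j\<bar>) * norm v" by (simp add: sum_distrib_right)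
  finally show ?thesis .
qed

lemma matrix_family_bounded:
  fixes M :: "'t::topological_space \<Rightarrow> real ^ 'n ^ 'm"
  assumes S: "compact S" and M: "\<And>i j. continuous_on S (\<lambda>z. M z $ i $ j)"
  obtains B where "B > 0" "\<And>z v. z \<in> S \<Longrightarrow> norm (M z *v v) \<le> B * norm v"
proof -
  let ?N = "\<lambda>z. \<Sum>i\<in>UNIV. \<Sum>j\<in>UNIV. \<bar>M z $ i $ j\<bar>"
  have "continuous_on S ?N" by (intro continuous_intros M)
  then have "bounded (?N ` S)" using S by (intro compact_imp_bounded compact_continuous_image)
  then obtain B where B: "B > 0" "\<And>z. z \<in> S \<Longrightarrow> \<bar>?N z\<bar> \<le> B" by (auto simp: bounded_pos)
  show thesis
  proof (rule that[OF B(1)])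
    fix z and v :: "real ^ 'n" assume "z \<in> S"
    then have "?N z * norm v \<le> B * norm v" using B(2)[of z] by (intro mult_right_mono) auto
    then show "norm (M z *v v) \<le> B * norm v" by (rule order.trans[OF matrix_vector_mult_norm_le])
  qed
qed

lemma emeasure_lborel_open_pos:
  fixes S :: "'a::euclidean_space set"
  assumes "open S" "S \<noteq> {}"
  shows "emeasure lborel S > 0"
  using open_not_negligible[OF assms] assms(1)
  by (auto simp: negligible_iff_null_sets null_sets_def zero_less_iff_neq_zero)

section \<open>The exponential map in a chart at small velocities\<close>

context framed_manifold
begin

text \<open>Point and velocity are in chart coordinates but the value is in the manifold: that it
  lies in the chart domain has to be proved.\<close>

definition chart_exp :: "('x, 'n) chart \<Rightarrow> real ^ 'n \<Rightarrow> real ^ 'n \<Rightarrow> 'x" where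
  "chart_exp c z v = fst (flow 1 (bundle_chart_inv c (z, v)))"

text \<open>The acceleration is a quadratic form in the velocity; this is the source of the
  quadratic error of the straight-line approximation.\<close>

lemma acceleration_quadratic_bound:
  assumes c: "c \<in> A" and S: "compact S" "S \<subseteq> chart_img c"
  obtains C where "C \<ge> 0" "\<And>z v. z \<in> S \<Longrightarrow> norm (geodesic_acceleration c z v) \<le> C * (norm v)\<^sup>2"
proof -
  have "\<exists>B. \<forall>z\<in>S. \<bar>christoffel A g c k i j z\<bar> \<le> B" for k i j
  proof -
    have "continuous_on S (christoffel A g c k i j)"
      using loclip_on_continuous_on[OF loclip_on_christoffel[OF c]] S(2) continuous_on_subset by blast
    then have "bounded (christoffel A g c k i j ` S)"
      using S(1) by (intro compact_imp_bounded compact_continuous_image)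
    then show ?thesis by (auto simp: bounded_iff)
  qed
  then obtain B where B: "\<And>k i j z. z \<in> S \<Longrightarrow> \<bar>christoffel A g c k i j z\<bar> \<le> B k i j" by metis
  define C where "C = (\<Sum>k\<in>UNIV. \<Sum>i\<in>UNIV. \<Sum>j\<in>UNIV. \<bar>B k i j\<bar>)"
  show thesis
  proof (rule that[of C])
    show "C \<ge> 0" unfolding C_def by (intro sum_nonneg) simp
    fix z v assume z: "z \<in> S"
    have "norm (geodesic_acceleration c z v) \<le> (\<Sum>k\<in>UNIV. \<bar>geodesic_acceleration c z v $ k\<bar>)"
      by (rule norm_le_l1_cart)
    also have "\<dots> \<le> (\<Sum>k\<in>UNIV. \<Sum>i\<in>UNIV. \<Sum>j\<in>UNIV. \<bar>B k i j\<bar> * (norm v)\<^sup>2)"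
    proof (rule sum_mono)
      fix k
      have "\<bar>geodesic_acceleration c z v $ k\<bar> \<le> (\<Sum>i\<in>UNIV. \<Sum>j\<in>UNIV. \<bar>christoffel A g c k i j z * v $ i * v $ j\<bar>)"
        unfolding geodesic_acceleration_def by (simp, intro order.trans[OF sum_abs] sum_mono sum_abs)
      also have "\<dots> \<le> (\<Sum>i\<in>UNIV. \<Sum>j\<in>UNIV. \<bar>B k i j\<bar> * (norm v)\<^sup>2)"
      proof (intro sum_mono)
        fix i j
        have le: "\<bar>v $ i\<bar> * \<bar>v $ j\<bar> \<le> norm v * norm v"
          using component_le_norm_cart[of v i] component_le_norm_cart[of v j] by (intro mult_mono) auto
        have "\<bar>christoffel A g c k i j z\<bar> * (\<bar>v $ i\<bar> * \<bar>v $ j\<bar>) \<le> \<bar>B k i j\<bar> * (norm v * norm v)"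
          by (rule mult_mono) (use le B[OF z, of k i j] in auto)
        then show "\<bar>christoffel A g c k i j z * v $ i * v $ j\<bar> \<le> \<bar>B k i j\<bar> * (norm v)\<^sup>2"
          by (simp add: abs_mult power2_eq_square mult.assoc)
      qed
      finally show "\<bar>geodesic_acceleration c z v $ k\<bar> \<le> (\<Sum>i\<in>UNIV. \<Sum>j\<in>UNIV. \<bar>B k i j\<bar> * (norm v)\<^sup>2)" .
    qed
    also have "\<dots> = C * (norm v)\<^sup>2" by (simp add: C_def sum_distrib_right)
    finally show "norm (geodesic_acceleration c z v) \<le> C * (norm v)\<^sup>2" .
  qed
qed

text \<open>The velocity is small, not the time: geodesics are followed over the unit interval and
  compared by \<open>tracking\<close> with rest points and with each other.\<close>

lemma chart_exp_estimates:
  assumes c: "c \<in> A" and z0: "z0 \<in> chart_img c"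
  obtains \<rho> K C where "\<rho> > 0" "K \<ge> 0" "C \<ge> 0" "cball z0 \<rho> \<subseteq> chart_img c"
    "\<And>z v. z \<in> cball z0 \<rho> \<Longrightarrow> norm v \<le> \<rho> \<Longrightarrow> chart_exp c z v \<in> chart_dom c"
    "\<And>z v v'. z \<in> cball z0 \<rho> \<Longrightarrow> norm v \<le> \<rho> \<Longrightarrow> norm v' \<le> \<rho> \<Longrightarrow>
       norm (chart_map c (chart_exp c z v) - chart_map c (chart_exp c z v')) \<le> K * norm (v - v')"
    "\<And>z v. z \<in> cball z0 \<rho> \<Longrightarrow> norm v \<le> \<rho> \<Longrightarrow>
       norm (chart_map c (chart_exp c z v) - z - v) \<le> C * (norm v)\<^sup>2"
proof -
  define p0 :: "(real ^ 'n) \<times> (real ^ 'n)" where "p0 = (z0, 0)"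
  have img: "bundle_chart c ` (chart_dom c \<times> UNIV) = chart_img c \<times> UNIV" by (rule bundle_chart_image[OF c])
  have "p0 \<in> bundle_chart c ` (chart_dom c \<times> UNIV)" using z0 unfolding img p0_def by simp
  then obtain R L where R: "R > 0" "cball p0 R \<subseteq> bundle_chart c ` (chart_dom c \<times> UNIV)"
    and lip: "L-lipschitz_on (cball p0 R) (geodesic_field c)"
    using field_lipschitz[OF c] by blast
  have L: "L \<ge> 0" using lip lipschitz_on_nonneg by blast
  define E where "E = exp L"
  have E: "E \<ge> 1" using L by (simp add: E_def)
  have expE: "exp (L * t) \<le> E" if "t \<le> 1" for t using that L by (simp add: E_def mult_left_le)
  \<comment> \<open>Gronwall over unit time costs the factor \<open>E\<close>. Initial data within
    \<open>2 * \<rho>\<close> of \<open>p0\<close>, or two velocities within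
    \<open>2 * \<rho>\<close> of each other, lead to a distance of at most \<open>R / 4\<close>,
    less than the \<open>R / 2\<close> that \<open>tracking\<close> allows.\<close>
  define \<rho> where "\<rho> = R / (8 * E)"
  have \<rho>: "\<rho> > 0" "\<rho> \<le> R / 8" "E * \<rho> = R / 8" using R(1) E by (auto simp: \<rho>_def field_simps)
  have fst_ball: "fst p \<in> cball z0 R" if "p \<in> cball p0 R" for p
    using that dist_fst_le[of p0 p] by (auto simp: p0_def)
  have z0R: "cball z0 R \<subseteq> chart_img c"
  proof
    fix z assume "z \<in> cball z0 R"
    then have "(z, 0) \<in> cball p0 R" by (simp add: p0_def dist_Pair_Pair)
    then show "z \<in> chart_img c" using R(2) img by auto
  qed
  obtain C0 where C0: "C0 \<ge> 0"
    "\<And>z v. z \<in> cball z0 R \<Longrightarrow> norm (geodesic_acceleration c z v) \<le> C0 * (norm v)\<^sup>2"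
    using acceleration_quadratic_bound[OF c compact_cball z0R] by blast
  have start: "bundle_chart_inv c (z, v) \<in> chart_dom c \<times> UNIV" "bundle_chart c (bundle_chart_inv c (z, v)) = (z, v)"
    if "z \<in> cball z0 \<rho>" for z v
  proof -
    have "z \<in> cball z0 R" using that \<rho>(2) R(1) by simp
    then have "(z, v) \<in> bundle_chart c ` (chart_dom c \<times> UNIV)" using z0R img by auto
    then show "bundle_chart_inv c (z, v) \<in> chart_dom c \<times> UNIV" "bundle_chart c (bundle_chart_inv c (z, v)) = (z, v)"
      using inv_in_dom[OF c] dom_inv[OF c] by blast+
  qed
  have const_chart: "bundle_chart c (chart_inv c z, 0) = (z, 0)" if "z \<in> cball z0 R" for z
    using that z0R chart_map_inv[OF c] linear_0[OF frame_linear] by (auto simp: bundle_chart_def)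
  have const_dom: "(chart_inv c z, 0) \<in> chart_dom c \<times> UNIV" if "z \<in> cball z0 R" for z
    using that z0R chart_inv_in_dom[OF c] by auto
  let ?Y = "\<lambda>z v t. flow t (bundle_chart_inv c (z, v))"
  have half: "?Y z v t \<in> chart_dom c \<times> UNIV \<and> bundle_chart c (?Y z v t) \<in> cball p0 (R / 2)"
    if z: "z \<in> cball z0 \<rho>" and v: "norm v \<le> \<rho>" and t: "0 \<le> t" "t \<le> 1" for z v t
  proof -
    have "norm ((z, v) - p0) \<le> norm (z - z0) + norm v"
      using norm_Pair_le[of "z - z0" v] by (simp add: p0_def)
    then have d: "norm ((z, v) - p0) \<le> 2 * \<rho>" using z v by (simp add: dist_norm norm_minus_commute)
    then have "E * norm ((z, v) - p0) \<le> E * (2 * \<rho>)" using E by (intro mult_left_mono) auto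
    then have d': "E * norm ((z, v) - p0) \<le> R / 4" using \<rho>(3) by simp
    have z0': "z0 \<in> cball z0 R" using R(1) by simp
    have *: "?Y z v t \<in> chart_dom c \<times> UNIV \<and> bundle_chart c (?Y z v t) \<in> cball p0 R \<and>
       norm (bundle_chart c (?Y z v t) - bundle_chart c (chart_inv c z0, 0))
         \<le> exp (L * t) * norm (bundle_chart c (?Y z v 0) - bundle_chart c (chart_inv c z0, 0))"
      by (rule tracking[OF c R(2) lip integral_curve_constant _ integral_curve_flow _ _ t])
        (use const_chart[OF z0'] const_dom[OF z0'] start[OF z] R(1) d' in \<open>auto simp: flow_0 p0_def[symmetric] E_def\<close>)
    have "exp (L * t) * norm ((z, v) - p0) \<le> E * norm ((z, v) - p0)"
      using expE[OF t(2)] by (intro mult_right_mono) auto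
    then have "norm (bundle_chart c (?Y z v t) - p0) \<le> R / 4"
      using * d' const_chart[OF z0'] start(2)[OF z] by (simp add: flow_0 p0_def)
    then show ?thesis using * R(1) by (simp add: dist_norm norm_minus_commute)
  qed
  have fst_chart: "fst (bundle_chart c p) = chart_map c (fst p)" for p by (simp add: bundle_chart_def)
  show thesis
  proof (rule that[of \<rho> E "C0 * E\<^sup>2"])
    show "cball z0 \<rho> \<subseteq> chart_img c" using z0R \<rho>(2) R(1) by (auto simp: subset_iff)
    show "chart_exp c z v \<in> chart_dom c" if "z \<in> cball z0 \<rho>" "norm v \<le> \<rho>" for z v
      using half[OF that, of 1] by (auto simp: chart_exp_def mem_Times_iff)
    show "norm (chart_map c (chart_exp c z v) - chart_map c (chart_exp c z v')) \<le> E * norm (v - v')"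
      if z: "z \<in> cball z0 \<rho>" and v: "norm v \<le> \<rho>" "norm v' \<le> \<rho>" for z v v'
    proof -
      have "norm (v - v') \<le> 2 * \<rho>" using norm_triangle_ineq4[of v v'] v by simp
      then have "E * norm (v - v') \<le> E * (2 * \<rho>)" using E by (intro mult_left_mono) auto
      then have d: "E * norm (v - v') < R / 2" using \<rho>(3) R(1) by simp
      have nv: "norm ((z, v) - (z, v')) = norm (v - v')" by (simp add: norm_Pair)
      have "norm (bundle_chart c (?Y z v 1) - bundle_chart c (?Y z v' 1))
         \<le> exp (L * 1) * norm (bundle_chart c (?Y z v 0) - bundle_chart c (?Y z v' 0))"
        by (rule tracking[OF c R(2) lip integral_curve_flow half[OF z v(2)] integral_curve_flow, THEN conjunct2, THEN conjunct2])
          (use start[OF z] d in \<open>auto simp: flow_0 E_def nv\<close>)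
      then have "norm (bundle_chart c (?Y z v 1) - bundle_chart c (?Y z v' 1)) \<le> E * norm (v - v')"
        using start[OF z] by (simp add: flow_0 E_def norm_Pair)
      then have "norm (fst (bundle_chart c (?Y z v 1) - bundle_chart c (?Y z v' 1))) \<le> E * norm (v - v')"
        by (rule order.trans[OF norm_fst_le_norm])
      then show ?thesis by (simp add: fst_chart chart_exp_def)
    qed
    show "norm (chart_map c (chart_exp c z v) - z - v) \<le> C0 * E\<^sup>2 * (norm v)\<^sup>2"
      if z: "z \<in> cball z0 \<rho>" and v: "norm v \<le> \<rho>" for z v
    proof -
      let ?h = "\<lambda>t. bundle_chart c (?Y z v t)"
      have zR: "z \<in> cball z0 R" and zR2: "(z, 0) \<in> cball p0 (R / 2)"
        using z \<rho>(2) R(1) by (auto simp: p0_def dist_Pair_Pair)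
      have h0: "?h 0 = (z, v)" using start[OF z] by (simp add: flow_0)
      have "E * norm v \<le> E * \<rho>" using E v by (intro mult_left_mono) auto
      then have d: "E * norm v < R / 2" using \<rho>(3) R(1) by simp
      have nv: "norm ((z, v) - (z, 0)) = norm v" by (simp add: norm_Pair)
      \<comment> \<open>The comparison curve rests at \<open>z\<close>, not at \<open>z0\<close>:
        the initial distance is then exactly \<open>norm v\<close>, and the bound is proportional to
        it.\<close>
      have snd_bound: "norm (snd (?h t)) \<le> E * norm v" if t: "0 \<le> t" "t \<le> 1" for t
      proof -
        have "norm (?h t - bundle_chart c (chart_inv c z, 0)) \<le> exp (L * t) * norm (?h 0 - bundle_chart c (chart_inv c z, 0))"
          by (rule tracking[OF c R(2) lip integral_curve_constant _ integral_curve_flow _ _ t, THEN conjunct2, THEN conjunct2])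
            (use const_chart[OF zR] const_dom[OF zR] start[OF z] zR2 d in \<open>auto simp: flow_0 E_def norm_Pair\<close>)
        then have "norm (?h t - (z, 0)) \<le> exp (L * t) * norm v"
          using h0 const_chart[OF zR] by (simp add: norm_Pair)
        moreover have "exp (L * t) * norm v \<le> E * norm v" using expE[OF t(2)] by (intro mult_right_mono) auto
        moreover have "norm (snd (?h t)) \<le> norm (?h t - (z, 0))"
          using norm_snd_le_norm[of "?h t - (z, 0)"] by simp
        ultimately show ?thesis by linarith
      qed
      have deriv: "(?h has_vector_derivative geodesic_field c (?h t)) (at t)" if "0 \<le> t" "t \<le> 1" for t
        by (rule integral_curve_flow[unfolded integral_curve_def, THEN conjunct2, rule_format, OF c])
          (use half[OF z v that] in simp)
      have acc: "norm (geodesic_acceleration c (fst (?h t)) (snd (?h t))) \<le> C0 * E\<^sup>2 * (norm v)\<^sup>2"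
        if t: "0 \<le> t" "t \<le> 1" for t
      proof -
        have "?h t \<in> cball p0 R" using half[OF z v t] R(1) by auto
        then have "norm (geodesic_acceleration c (fst (?h t)) (snd (?h t))) \<le> C0 * (norm (snd (?h t)))\<^sup>2"
          by (intro C0(2) fst_ball)
        also have "\<dots> \<le> C0 * (E * norm v)\<^sup>2"
          using snd_bound[OF t] C0(1) by (intro mult_left_mono power_mono) auto
        finally show ?thesis by (simp add: power_mult_distrib mult.assoc)
      qed
      \<comment> \<open>Two integrations over the unit interval: the acceleration bounds the change
        of velocity, which in turn bounds the deviation from the line z + t v.\<close>
      have snd_diff: "norm (snd (?h t) - snd (?h 0)) \<le> C0 * E\<^sup>2 * (norm v)\<^sup>2" if "0 \<le> t" "t \<le> 1" for t
      proof (rule norm_diff_le_vector_derivative_bound[where f="\<lambda>t. snd (?h t)", OF _ that])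
        fix t :: real assume t: "0 \<le> t" "t \<le> 1"
        have "((\<lambda>t. snd (?h t)) has_vector_derivative snd (geodesic_field c (?h t))) (at t)"
          by (rule bounded_linear.has_vector_derivative[OF bounded_linear_snd deriv[OF t]])
        then show "((\<lambda>t. snd (?h t)) has_vector_derivative geodesic_acceleration c (fst (?h t)) (snd (?h t))) (at t) \<and>
            norm (geodesic_acceleration c (fst (?h t)) (snd (?h t))) \<le> C0 * E\<^sup>2 * (norm v)\<^sup>2"
          using acc[OF t] by (simp add: geodesic_field_def)
      qed
      have "norm ((fst (?h 1) - 1 *\<^sub>R v) - (fst (?h 0) - 0 *\<^sub>R v)) \<le> C0 * E\<^sup>2 * (norm v)\<^sup>2"
      proof (rule norm_diff_le_vector_derivative_bound[where f="\<lambda>t. fst (?h t) - t *\<^sub>R v"])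
        fix t :: real assume t: "0 \<le> t" "t \<le> 1"
        have "((\<lambda>t. fst (?h t)) has_vector_derivative fst (geodesic_field c (?h t))) (at t)"
          by (rule bounded_linear.has_vector_derivative[OF bounded_linear_fst deriv[OF t]])
        moreover have "((\<lambda>t. t *\<^sub>R v) has_vector_derivative v) (at t)"
          by (auto intro!: derivative_eq_intros)
        ultimately have "((\<lambda>t. fst (?h t) - t *\<^sub>R v) has_vector_derivative fst (geodesic_field c (?h t)) - v) (at t)"
          by (rule has_vector_derivative_diff)
        then show "((\<lambda>t. fst (?h t) - t *\<^sub>R v) has_vector_derivative snd (?h t) - v) (at t) \<and>
           norm (snd (?h t) - v) \<le> C0 * E\<^sup>2 * (norm v)\<^sup>2"
          using snd_diff[OF t] by (simp add: geodesic_field_def h0)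
      qed auto
      then show ?thesis by (simp add: h0 fst_chart chart_exp_def algebra_simps)
    qed
  qed (use \<rho>(1) E C0(1) in auto)
qed

text \<open>A fixed point of v \<mapsto> v - (\<Phi> v - b) solves \<Phi> v = b. Rewritten as (b -
  z) - (\<Phi> v - z - v), its value has norm at most \<rho>/2 + C \<rho>^2 \<le> \<rho>, so
  Brouwer's theorem applies to the ball of radius \<rho>.\<close>

lemma chart_exp_covers:
  assumes \<rho>: "\<rho> > 0" "C * \<rho> \<le> 1 / 2"
    and lip: "\<And>v v'. norm v \<le> \<rho> \<Longrightarrow> norm v' \<le> \<rho> \<Longrightarrow>
       norm (chart_map c (chart_exp c z v) - chart_map c (chart_exp c z v')) \<le> K * norm (v - v')"
    and est: "\<And>v. norm v \<le> \<rho> \<Longrightarrow> norm (chart_map c (chart_exp c z v) - z - v) \<le> C * (norm v)\<^sup>2"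
    and C: "C \<ge> 0" and K: "K \<ge> 0" and b: "norm (b - z) \<le> \<rho> / 2"
  obtains v where "norm v \<le> \<rho>" "chart_map c (chart_exp c z v) = b"
proof -
  let ?\<Phi> = "\<lambda>v. chart_map c (chart_exp c z v)"
  have "K-lipschitz_on (cball 0 \<rho>) ?\<Phi>"
    using lip K by (intro lipschitz_onI) (auto simp: dist_norm)
  then have cont: "continuous_on (cball 0 \<rho>) (\<lambda>v. v - (?\<Phi> v - b))"
    by (intro continuous_intros lipschitz_on_continuous_on)
  have maps: "(\<lambda>v. v - (?\<Phi> v - b)) \<in> cball 0 \<rho> \<rightarrow> cball 0 \<rho>"
  proof
    fix v assume "v \<in> cball (0 :: real ^ 'n) \<rho>"
    then have v: "norm v \<le> \<rho>" by simp
    have "C * (norm v)\<^sup>2 \<le> C * \<rho> * \<rho>"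
      using v C \<rho>(1) by (auto simp: power2_eq_square mult.assoc intro!: mult_left_mono mult_mono)
    also have "\<dots> \<le> 1 / 2 * \<rho>" using \<rho> by (intro mult_right_mono) auto
    finally have "norm (?\<Phi> v - z - v) \<le> \<rho> / 2" using est[OF v] by simp
    then have "norm ((b - z) - (?\<Phi> v - z - v)) \<le> \<rho>"
      using norm_triangle_ineq4[of "b - z" "?\<Phi> v - z - v"] b by linarith
    moreover have "v - (?\<Phi> v - b) = (b - z) - (?\<Phi> v - z - v)" by simp
    ultimately show "v - (?\<Phi> v - b) \<in> cball 0 \<rho>" by (simp only: mem_cball_0)
  qed
  obtain v where "v \<in> cball 0 \<rho>" "v - (?\<Phi> v - b) = v"
    by (rule brouwer_ball[OF \<rho>(1) cont maps])
  then show thesis by (intro that[of v]) auto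
qed

section \<open>The one-step kernel of the recursion\<close>

lemma locally_lipschitz_isCont:
  fixes s :: "'x \<Rightarrow> 'b::metric_space"
  assumes "locally_lipschitz A s"
  shows "isCont s x"
proof -
  obtain c where c: "c \<in> A" "x \<in> chart_dom c" using atlas_cover by blast
  have "loclip_on (chart_img c) (s \<circ> chart_inv c)"
    using assms c(1) unfolding locally_lipschitz_def loclip_on_def by blast
  then have "continuous_on (chart_img c) (s \<circ> chart_inv c)" by (rule loclip_on_continuous_on)
  then have "continuous_on (chart_dom c) (\<lambda>y. (s \<circ> chart_inv c) (chart_map c y))"
    by (rule continuous_on_compose2[OF _ continuous_on_chart_map[OF c(1)]])
      (auto intro: chart_map_in_img[OF c(1)])
  then have "continuous_on (chart_dom c) s"
    by (rule continuous_on_eq) (simp add: chart_inv_map[OF c(1)])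
  then show ?thesis
    using open_chart_dom[OF c(1)] c(2) by (simp add: continuous_on_eq_continuous_at)
qed

lemma exp_step_eq_flow: "exp_step A g \<iota> \<gamma> s x u = fst (flow 1 (x, u - \<gamma> *\<^sub>R s x))"
  unfolding exp_step_def Exp_eq_flow by (simp add: algebra_simps)

lemma exp_step_eq_chart_exp:
  assumes "c \<in> A" "x \<in> chart_dom c"
  shows "exp_step A g \<iota> \<gamma> s x u =
    chart_exp c (chart_map c x) (frame_matrix c (chart_map c x) *v (u - \<gamma> *\<^sub>R s x))"
proof -
  have "bundle_chart c (x, u - \<gamma> *\<^sub>R s x) = (chart_map c x, frame_matrix c (chart_map c x) *v (u - \<gamma> *\<^sub>R s x))"
    using assms by (simp add: bundle_chart_def frame_matrix_mult chart_inv_map)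
  then have "bundle_chart_inv c (chart_map c x, frame_matrix c (chart_map c x) *v (u - \<gamma> *\<^sub>R s x)) = (x, u - \<gamma> *\<^sub>R s x)"
    using inv_dom[OF assms(1), of "(x, u - \<gamma> *\<^sub>R s x)"] assms(2) by simp
  then show ?thesis by (simp add: exp_step_eq_flow chart_exp_def)
qed

text \<open>Unlike the local estimates this concerns arbitrary velocities; it is the purpose of
  \<open>isCont_flow\<close> and leads to measurability of the kernel.\<close>

lemma continuous_on_exp_step:
  assumes "locally_lipschitz A s"
  shows "continuous_on UNIV (\<lambda>p. exp_step A g \<iota> \<gamma> s (fst p) (snd p))"
proof -
  have "continuous_on UNIV s"
    using locally_lipschitz_isCont[OF assms] by (simp add: continuous_on_eq_continuous_at)
  then have "continuous_on UNIV (\<lambda>p. s (fst p))"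
    by (rule continuous_on_compose2) (auto intro: continuous_intros)
  then have shift: "continuous_on UNIV (\<lambda>p. (fst p, snd p - \<gamma> *\<^sub>R s (fst p)))"
    by (intro continuous_intros)
  have "continuous_on UNIV (\<lambda>p. fst (flow 1 p))"
    using isCont_flow[of 1] by (simp add: continuous_on_eq_continuous_at isCont_fst)
  then have "continuous_on UNIV (\<lambda>p. fst (flow 1 (fst p, snd p - \<gamma> *\<^sub>R s (fst p))))"
    by (rule continuous_on_compose2[OF _ shift]) auto
  then show ?thesis by (simp add: exp_step_eq_flow)
qed

text \<open>Second countability identifies the Borel sets of the product with the product
  sigma-algebra.\<close>

lemma borel_measurable_exp_step:
  assumes "locally_lipschitz A s"
  shows "case_prod (exp_step A g \<iota> \<gamma> s) \<in> borel \<Otimes>\<^sub>M borel \<rightarrow>\<^sub>M borel"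
  using borel_measurable_continuous_onI[OF continuous_on_exp_step[OF assms]]
  unfolding borel_prod case_prod_beta' .

text \<open>Let \<open>S\<close> be the set of innovations that lead from \<open>x\<close> into
  \<open>B\<close> at small velocity. A Lipschitz map, with constant independent of
  \<open>x\<close>, takes \<open>S\<close> to a set covering the coordinates of the part of
  \<open>B\<close> in \<open>W\<close>; so \<open>S\<close> has at least a fixed fraction of that
  volume, and \<open>q\<close> exceeds \<open>q0\<close> on \<open>S\<close>.\<close>

lemma step_kernel_locally_minorized:
  fixes q :: "real ^ 'n \<Rightarrow> real"
  assumes prob: "prob_space M" and lipschitz: "locally_lipschitz A s"
    and density: "distributed M lborel V (\<lambda>u. ennreal (q u))"
    and q_pos: "\<And>u. q u > 0" and q_lsc: "lower_semicontinuous q"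
  shows "\<exists>W \<nu>. x0 \<in> W \<and> minorizing_on_opens (step_kernel M V (exp_step A g \<iota> \<gamma> s)) W \<nu>"
proof -
  let ?F = "exp_step A g \<iota> \<gamma> s"
  obtain c where c: "c \<in> A" "x0 \<in> chart_dom c" using atlas_cover by blast
  define z0 where "z0 = chart_map c x0"
  have z0: "z0 \<in> chart_img c" using c by (simp add: z0_def chart_map_in_img)
  obtain \<rho>0 K C where \<rho>0: "\<rho>0 > 0" and K: "K \<ge> 0" and C: "C \<ge> 0" and img: "cball z0 \<rho>0 \<subseteq> chart_img c"
    and dom: "\<And>z v. z \<in> cball z0 \<rho>0 \<Longrightarrow> norm v \<le> \<rho>0 \<Longrightarrow> chart_exp c z v \<in> chart_dom c"
    and lip: "\<And>z v v'. z \<in> cball z0 \<rho>0 \<Longrightarrow> norm v \<le> \<rho>0 \<Longrightarrow> norm v' \<le> \<rho>0 \<Longrightarrow>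
       norm (chart_map c (chart_exp c z v) - chart_map c (chart_exp c z v')) \<le> K * norm (v - v')"
    and est: "\<And>z v. z \<in> cball z0 \<rho>0 \<Longrightarrow> norm v \<le> \<rho>0 \<Longrightarrow>
       norm (chart_map c (chart_exp c z v) - z - v) \<le> C * (norm v)\<^sup>2"
    by (rule chart_exp_estimates[OF c(1) z0], rule that)
  have cont: "continuous_on (cball z0 \<rho>0) (\<lambda>z. frame_matrix c z $ i $ j)"
    "continuous_on (cball z0 \<rho>0) (\<lambda>z. matrix_inv (frame_matrix c z) $ i $ j)" for i j
    using loclip_on_continuous_on[OF loclip_on_frame_matrix[OF c(1)]]
      loclip_on_continuous_on[OF loclip_on_frame_matrix_inv[OF c(1)]] img continuous_on_subset by blast+
  obtain J where J: "J > 0" "\<And>z v. z \<in> cball z0 \<rho>0 \<Longrightarrow> norm (frame_matrix c z *v v) \<le> J * norm v"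
    using matrix_family_bounded[OF compact_cball cont(1)] by blast
  obtain J' where J': "J' > 0" "\<And>z v. z \<in> cball z0 \<rho>0 \<Longrightarrow> norm (matrix_inv (frame_matrix c z) *v v) \<le> J' * norm v"
    using matrix_family_bounded[OF compact_cball cont(2)] by blast
  \<comment> \<open>The innovation that cancels the drift at \<open>x0\<close>, giving velocity 0;
    \<open>q\<close> is bounded below near it.\<close>
  define u0 where "u0 = \<gamma> *\<^sub>R s x0"
  define q0 where "q0 = q u0 / 2"
  have q0: "q0 > 0" "q0 < q u0" using q_pos[of u0] by (auto simp: q0_def)
  then have "eventually (\<lambda>u. q0 < q u) (nhds u0)"
    using q_lsc unfolding lower_semicontinuous_def by blast
  then obtain \<eta> where \<eta>: "\<eta> > 0" "\<And>u. dist u u0 < \<eta> \<Longrightarrow> q0 < q u"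
    unfolding eventually_nhds_metric by blast
  \<comment> \<open>In this order, the bounds serve the estimates for \<open>chart_exp\<close>, the
    condition \<open>C * \<rho> \<le> 1 / 2\<close> for Brouwer, and that velocities up to \<rho>
    come from innovations within \<open>\<eta> / 2\<close> of \<open>\<gamma> *\<^sub>R s x\<close>.
    \<open>C + 1\<close> avoids division by zero.\<close>
  define \<rho> where "\<rho> = Min {\<rho>0, 1 / (2 * (C + 1)), \<eta> / (4 * J')}"
  have \<rho>: "\<rho> > 0" "\<rho> \<le> \<rho>0" "\<rho> \<le> 1 / (2 * (C + 1))" "\<rho> \<le> \<eta> / (4 * J')"
    using \<rho>0 C \<eta>(1) J'(1) by (auto simp: \<rho>_def)
  have C\<rho>: "C * \<rho> \<le> 1 / 2"
  proof -
    have "C * \<rho> \<le> (C + 1) * (1 / (2 * (C + 1)))" using \<rho> C by (intro mult_mono) auto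
    also have "\<dots> = 1 / 2" using C by (simp add: divide_simps)
    finally show ?thesis .
  qed
  have J'\<rho>: "J' * \<rho> < \<eta> / 2"
  proof -
    have "J' * \<rho> \<le> J' * (\<eta> / (4 * J'))" using \<rho>(4) J'(1) by (intro mult_left_mono) auto
    also have "\<dots> < \<eta> / 2" using J'(1) \<eta>(1) by simp
    finally show ?thesis .
  qed
  \<comment> \<open>Any two points of \<open>W\<close> are less than \<open>\<rho> / 2\<close> apart
    in coordinates, as \<open>chart_exp_covers\<close> requires; the second factor keeps the drift
    within \<open>\<eta> / 2\<close> of \<open>u0\<close>.\<close>
  define W where "W = {x \<in> chart_dom c. chart_map c x \<in> ball z0 (\<rho> / 4)} \<inter> s -` {y. dist (\<gamma> *\<^sub>R y) u0 < \<eta> / 2}"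
  have "open W"
    unfolding W_def
  proof (intro open_Int)
    have "open (chart_dom c \<inter> chart_map c -` ball z0 (\<rho> / 4))"
      using open_chart_dom[OF c(1)] continuous_on_chart_map[OF c(1)]
      by (intro continuous_open_preimage) auto
    then show "open {x \<in> chart_dom c. chart_map c x \<in> ball z0 (\<rho> / 4)}" by (simp add: Int_def vimage_def)
    show "open (s -` {y. dist (\<gamma> *\<^sub>R y) u0 < \<eta> / 2})"
      by (intro continuous_open_vimage open_Collect_less continuous_intros locally_lipschitz_isCont[OF lipschitz])
  qed
  have "x0 \<in> W" using c \<rho>(1) \<eta>(1) by (auto simp: W_def z0_def u0_def)
  have W_dom: "W \<subseteq> chart_dom c" by (auto simp: W_def)
  have W_ball: "chart_map c x \<in> cball z0 \<rho>0" if "x \<in> W" for x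
    using that \<rho>(1,2) by (auto simp: W_def)
  define W' where "W' = chart_img c \<inter> chart_inv c -` W"
  have W'_pre: "open (chart_img c \<inter> chart_inv c -` N)" if "open N" for N
    using continuous_on_chart_inv[OF c(1)] open_chart_img[OF c(1)] that
    by (intro continuous_open_preimage) auto
  have W': "open W'" unfolding W'_def by (rule W'_pre[OF \<open>open W\<close>])
  \<comment> \<open>Lebesgue measure on the coordinates of \<open>W\<close>, carried to the
    manifold. It is restricted first because \<open>chart_inv c\<close> has arbitrary values off the
    chart image.\<close>
  define N where "N = distr (restrict_space lborel W') borel (chart_inv c)"
  have inv_meas: "chart_inv c \<in> restrict_space lborel W' \<rightarrow>\<^sub>M borel"
  proof -
    have "continuous_on W' (chart_inv c)"
      using continuous_on_chart_inv[OF c(1)] by (rule continuous_on_subset) (auto simp: W'_def)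
    then have "chart_inv c \<in> borel_measurable (restrict_space borel W')"
      by (rule borel_measurable_continuous_on_restrict)
    moreover have "sets (restrict_space borel W') = sets (restrict_space lborel W')"
      by (rule sets_restrict_space_cong) simp
    ultimately show ?thesis using measurable_cong_sets by blast
  qed
  have W'_meas: "W' \<in> sets lborel" using W' by simp
  have pre_meas: "chart_inv c -` B \<inter> W' \<in> sets borel" if "B \<in> sets borel" for B
    using measurable_sets[OF inv_meas that] W'_meas
    by (auto simp: space_restrict_space sets_restrict_space_iff)
  have N: "emeasure N B = emeasure lborel (chart_inv c -` B \<inter> W')" if "B \<in> sets borel" for B
    unfolding N_def using inv_meas that W'_meas
    by (simp add: emeasure_distr space_restrict_space emeasure_restrict_space)
  \<comment> \<open>The volume factor of a \<open>K * J\<close>-Lipschitz map; the summand 1 keeps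
    it positive when \<open>K = 0\<close>.\<close>
  define D where "D = (2 * (K * J) * CARD('n)) ^ CARD('n) + 1"
  have D: "D \<ge> 1" using K J(1) by (simp add: D_def)
  define \<nu> where "\<nu> = scale_measure (ennreal (q0 / D)) N"
  have V_meas: "V \<in> M \<rightarrow>\<^sub>M lborel" using density by (rule distributed_measurable)
  have F_meas: "?F x \<in> borel \<rightarrow>\<^sub>M borel" for x
    using measurable_Pair2[OF borel_measurable_exp_step[OF lipschitz], of x] by simp
  have minor: "emeasure \<nu> B \<le> emeasure (step_kernel M V ?F x) B" if x: "x \<in> W" and B: "B \<in> sets borel" for x B
  proof -
    let ?z = "chart_map c x"
    let ?G = "\<lambda>u. frame_matrix c ?z *v (u - \<gamma> *\<^sub>R s x)"
    have xd: "x \<in> chart_dom c" using x W_dom by blast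
    have z: "?z \<in> cball z0 \<rho>0" "?z \<in> chart_img c" using W_ball[OF x] img by auto
    have F: "?F x u = chart_exp c ?z (?G u)" for u by (rule exp_step_eq_chart_exp[OF c(1) xd])
    define S where "S = {u. norm (?G u) \<le> \<rho> \<and> ?F x u \<in> B}"
    have G_cont: "continuous_on UNIV ?G"
      by (intro continuous_on_matrix_vector_mult continuous_intros)
    have S_borel: "S \<in> sets borel"
    proof -
      have "{u. norm (?G u) \<le> \<rho>} \<in> sets borel"
        using G_cont by (intro borel_closed closed_Collect_le continuous_intros)
      moreover have "?F x -` B \<in> sets borel" using measurable_sets[OF F_meas B, of x] by simp
      moreover have "S = {u. norm (?G u) \<le> \<rho>} \<inter> ?F x -` B" by (auto simp: S_def)
      ultimately show ?thesis by simp
    qed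
    \<comment> \<open>Velocity and variation of the drift each contribute less than
      \<open>\<eta> / 2\<close>.\<close>
    have S_near: "dist u u0 < \<eta>" if "u \<in> S" for u
    proof -
      have "norm (u - \<gamma> *\<^sub>R s x) = norm (matrix_inv (frame_matrix c ?z) *v ?G u)"
        using frame_matrix_inv(2)[OF c(1) z(2)] by simp
      also have "\<dots> \<le> J' * norm (?G u)" by (rule J'(2)[OF z(1)])
      also have "\<dots> \<le> J' * \<rho>" using that J'(1) by (intro mult_left_mono) (auto simp: S_def)
      finally have "dist u (\<gamma> *\<^sub>R s x) < \<eta> / 2" using J'\<rho> by (simp add: dist_norm)
      moreover have "dist (\<gamma> *\<^sub>R s x) u0 < \<eta> / 2" using x by (auto simp: W_def)
      ultimately show ?thesis using dist_triangle[of u u0 "\<gamma> *\<^sub>R s x"] by linarith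
    qed
    have S_bounded: "bounded S"
      by (rule bounded_subset[OF bounded_ball[of u0 \<eta>]]) (use S_near in \<open>auto simp: dist_commute\<close>)
    have F_lip: "(K * J)-lipschitz_on S (\<lambda>u. chart_map c (?F x u))"
    proof (rule lipschitz_onI)
      fix u u' assume u: "u \<in> S" "u' \<in> S"
      have "norm (?G u - ?G u') = norm (frame_matrix c ?z *v (u - u'))"
        by (simp flip: matrix_vector_mult_diff_distrib)
      also have "\<dots> \<le> J * norm (u - u')" by (rule J(2)[OF z(1)])
      finally have "K * norm (?G u - ?G u') \<le> K * (J * norm (u - u'))" using K by (rule mult_left_mono)
      moreover have "norm (chart_map c (?F x u) - chart_map c (?F x u')) \<le> K * norm (?G u - ?G u')"
        unfolding F using u \<rho>(2) by (intro lip[OF z(1)]) (auto simp: S_def)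
      ultimately show "dist (chart_map c (?F x u)) (chart_map c (?F x u')) \<le> K * J * dist u u'"
        by (simp add: dist_norm mult.assoc)
    qed (use K J in simp)
    \<comment> \<open>Every point of \<open>W\<close> is reached from \<open>x\<close> at velocity
      of norm at most \<rho>. That the endpoint is in the chart domain allows passing from equal
      coordinates to equal points, hence to membership in \<open>B\<close>.\<close>
    have cover: "chart_inv c -` B \<inter> W' \<subseteq> (\<lambda>u. chart_map c (?F x u)) ` S"
    proof
      fix b assume b: "b \<in> chart_inv c -` B \<inter> W'"
      then have b': "b \<in> chart_img c" "chart_inv c b \<in> W" "chart_inv c b \<in> B" by (auto simp: W'_def)
      then have "b \<in> ball z0 (\<rho> / 4)" using chart_map_inv[OF c(1)] by (auto simp: W_def)
      moreover have "?z \<in> ball z0 (\<rho> / 4)" using x by (auto simp: W_def)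
      ultimately have near: "norm (b - ?z) \<le> \<rho> / 2"
        using dist_triangle2[of b ?z z0] by (simp add: dist_norm norm_minus_commute)
      have lip': "norm (chart_map c (chart_exp c ?z v) - chart_map c (chart_exp c ?z v')) \<le> K * norm (v - v')"
        if "norm v \<le> \<rho>" "norm v' \<le> \<rho>" for v v'
        using that \<rho>(2) by (intro lip[OF z(1)]) auto
      have est': "norm (chart_map c (chart_exp c ?z v) - ?z - v) \<le> C * (norm v)\<^sup>2" if "norm v \<le> \<rho>" for v
        using that \<rho>(2) by (intro est[OF z(1)]) auto
      obtain v where v: "norm v \<le> \<rho>" "chart_map c (chart_exp c ?z v) = b"
        by (rule chart_exp_covers[OF \<rho>(1) C\<rho> lip' est' C K near])
      define u where "u = \<gamma> *\<^sub>R s x + matrix_inv (frame_matrix c ?z) *v v"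
      have Gu: "?G u = v" using frame_matrix_inv(1)[OF c(1) z(2)] by (simp add: u_def)
      have Fu: "?F x u = chart_exp c ?z v" by (simp add: F Gu)
      have "chart_exp c ?z v \<in> chart_dom c" using dom[OF z(1)] v(1) \<rho>(2) by simp
      then have "?F x u = chart_inv c b" using chart_inv_map[OF c(1)] v(2) Fu by metis
      then have "u \<in> S" using b'(3) Gu v(1) by (simp add: S_def)
      moreover have "chart_map c (?F x u) = b" by (simp add: Fu v(2))
      ultimately show "b \<in> (\<lambda>u. chart_map c (?F x u)) ` S" by blast
    qed
    have "emeasure N B \<le> ennreal ((2 * (K * J) * CARD('n)) ^ CARD('n)) * emeasure lborel S"
      unfolding N[OF B] by (rule emeasure_lipschitz_image_le[OF F_lip S_borel S_bounded pre_meas[OF B] cover])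
    also have "\<dots> \<le> ennreal D * emeasure lborel S" by (intro mult_right_mono ennreal_leI) (auto simp: D_def)
    finally have "ennreal (q0 / D) * emeasure N B \<le> ennreal (q0 / D) * (ennreal D * emeasure lborel S)"
      by (rule mult_left_mono) simp
    also have "\<dots> = ennreal q0 * emeasure lborel S"
      using D q0(1) by (simp add: mult.assoc[symmetric] ennreal_mult[symmetric])
    also have "\<dots> = (\<integral>\<^sup>+u. ennreal q0 * indicator S u \<partial>lborel)"
      using S_borel by (simp add: nn_integral_cmult_indicator)
    also have "\<dots> \<le> (\<integral>\<^sup>+u. ennreal (q u) * indicator (?F x -` B) u \<partial>lborel)"
    proof (rule nn_integral_mono)
      fix u
      show "ennreal q0 * indicator S u \<le> ennreal (q u) * indicator (?F x -` B) u"
      proof (cases "u \<in> S")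
        case True
        then have "q0 \<le> q u" "u \<in> ?F x -` B" using \<eta>(2)[OF S_near] by (auto simp: S_def less_imp_le)
        then show ?thesis using True by (simp add: ennreal_leI)
      qed simp
    qed
    also have "\<dots> = emeasure M (V -` (?F x -` B) \<inter> space M)"
      using measurable_sets[OF F_meas B, of x] by (intro distributed_emeasure[OF density, symmetric]) simp
    also have "\<dots> = emeasure (step_kernel M V ?F x) B"
    proof -
      have "(\<lambda>\<omega>. ?F x (V \<omega>)) \<in> M \<rightarrow>\<^sub>M borel"
        by (rule measurable_compose[OF V_meas]) (use F_meas in simp)
      then show ?thesis unfolding step_kernel_def using B by (simp add: emeasure_distr vimage_comp comp_def)
    qed
    finally show ?thesis by (simp add: \<nu>_def)
  qed
  have pos: "emeasure \<nu> G > 0" if G: "open G" "G \<inter> W \<noteq> {}" for G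
  proof -
    obtain y where y: "y \<in> G" "y \<in> W" using G by blast
    have "chart_inv c -` G \<inter> W' = (chart_img c \<inter> chart_inv c -` G) \<inter> W'" by (auto simp: W'_def)
    then have "open (chart_inv c -` G \<inter> W')" using W'_pre[OF G(1)] W' by auto
    moreover have "chart_map c y \<in> chart_inv c -` G \<inter> W'"
      using y W_dom chart_inv_map[OF c(1)] chart_map_in_img[OF c(1)] by (auto simp: W'_def)
    ultimately have "emeasure lborel (chart_inv c -` G \<inter> W') > 0"
      by (intro emeasure_lborel_open_pos) auto
    then show ?thesis
      using N[of G] G(1) q0(1) D by (simp add: \<nu>_def ennreal_zero_less_mult_iff)
  qed
  have "sets \<nu> = sets borel" by (simp add: \<nu>_def N_def)
  then have "minorizing_on_opens (step_kernel M V ?F) W \<nu>"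
    unfolding minorizing_on_opens_def using \<open>open W\<close> minor pos by blast
  then show ?thesis using \<open>x0 \<in> W\<close> by blast
qed

end

theorem theorem3p1:
  fixes A :: "('x::{t2_space, second_countable_topology}, 'n::finite) chart set"
    and g :: "('x, 'n) metric_tensor"
    and \<iota> :: "'x \<Rightarrow> real ^ 'n \<Rightarrow> ('x, 'n) tangent"
    and s :: "'x \<Rightarrow> real ^ 'n"
    and q :: "real ^ 'n \<Rightarrow> real"
    and \<gamma> :: real
    and M :: "'w measure"
    and \<phi> :: "nat \<Rightarrow> 'w \<Rightarrow> 'x"
    and U :: "nat \<Rightarrow> 'w \<Rightarrow> real ^ 'n"
    and P :: "'x \<Rightarrow> 'x measure"
  assumes hadamard: "hadamard_manifold A g"
    and frame: "smooth_frame A \<iota>"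
    and gamma_pos: "\<gamma> > 0"
    and prob: "prob_space M"
    and init: "\<phi> 0 \<in> M \<rightarrow>\<^sub>M borel"
    and indep: "prob_space.indep_vars M (\<lambda>_. borel) (\<lambda>k. U (Suc k)) UNIV"
    and ident: "\<And>k. distr M borel (U (Suc k)) = distr M borel (U 1)"
    and indep_init: "prob_space.indep_set M
           {\<phi> 0 -` B \<inter> space M | B. B \<in> sets borel}
           {(\<lambda>\<omega> k. U (Suc k) \<omega>) -` B \<inter> space M | B. B \<in> sets (PiM UNIV (\<lambda>_. borel))}"
    and step: "\<And>k \<omega>. \<omega> \<in> space M \<Longrightarrow> \<phi> (Suc k) \<omega> = exp_step A g \<iota> \<gamma> s (\<phi> k \<omega>) (U (Suc k) \<omega>)"
    and lipschitz: "locally_lipschitz A s"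
    and density: "distributed M lborel (U 1) (\<lambda>u. ennreal (q u))"
    and q_pos: "\<And>u. q u > 0"
    and q_lsc: "lower_semicontinuous q"
    and kernel: "P = step_kernel M (U 1) (exp_step A g \<iota> \<gamma> s)"
  shows "markov_chain M P \<phi> \<and> irreducible_kernel P \<and> aperiodic_kernel P \<and> T_chain P \<and>
    (\<forall>C. compact C \<longrightarrow> small_set P C)"
proof -
  interpret framed_manifold A g \<iota>
    using hadamard frame by unfold_locales (auto simp: hadamard_manifold_def)
  have chain: "markov_chain M P \<phi>"
    unfolding kernel using prob init indep ident indep_init step borel_measurable_exp_step[OF lipschitz]
    by (rule markov_chain_recursion)
  \<comment> \<open>From here on the geometry acts only through connectedness and the local
    minorization.\<close>
  interpret locally_minorized_kernel P
  proof
    show "markov_kernel P" using chain by (simp add: markov_chain_def)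
    show "connected (UNIV :: 'x set)" using hadamard by (simp add: hadamard_manifold_def)
    show "\<exists>V \<nu>. x0 \<in> V \<and> minorizing_on_opens P V \<nu>" for x0
      unfolding kernel by (rule step_kernel_locally_minorized[OF prob lipschitz density q_pos q_lsc])
  qed
  show ?thesis using chain irreducible aperiodic T_chain compact_small by blast
qed

end
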